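(* Let $k$ be an algebraically closed field of characteristic $0$, let $H$ be a semisimple Hopf algebra over $k$, let $m$ be a positive integer, and let $\tau$ be a Hopf algebra automorphism of $H$ with $\tau^m=\mathrm{Id}$. For any finite-dimensional left $H$-module $V$ with character $\chi$, the $m$-th twisted Frobenius--Schur indicator satisfies $$\nu_m(\chi,\tau)=\operatorname{tr}\left(\alpha|_{\left(\widetilde{V^{\otimes m}}\right)^H}\right),$$ where $\widetilde{V^{\otimes m}}$ is the twisted tensor power of $V$ and $\alpha$ is the cyclic permutation of tensor factors.
   Context: $\Lambda\in H$ denotes the unique two-sided integral normalized by $\varepsilon(\Lambda)=1$, where $\varepsilon$ is the counit; Sweedler notation is $\Delta^{m-1}(h)=\sum_{(h)}h_1\otimes\cdots\otimes h_m$. For an $H$-module $(V,\rho)$ with character $\chi$ and $\tau^m=\mathrm{Id}$, the $m$-th twisted Frobenius--Schur indicator is $$\nu_m(\chi,\tau)=\sum_{(\Lambda)}\chi\left(\Lambda_1\tau(\Lambda_2)\cdots\tau^{m-1}(\Lambda_m)\right).$$ $\widetilde{V^{\otimes m}}$ is the $H$-module with underlying space $V^{\otimes m}$ and action $$h\cdot(v_1\otimes\cdots\otimes v_m)=\sum_{(h)}\rho(h_1)v_1\otimes\rho(\tau(h_2))v_2\otimes\cdots\otimes\rho(\tau^{m-1}(h_m))v_m.$$ For an $H$-module $W$, $W^H=\{w\in W: h\cdot w=\varepsilon(h)w \text{ for all } h\in H\}$. The linear map $\alpha:V^{\otimes m}\to V^{\otimes m}$ is $\alpha(v_1\otimes v_2\otimes\cdots\otimes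 v_m)=v_2\otimes\cdots\otimes v_m\otimes v_1$; it maps $(\widetilde{V^{\otimes m}})^H$ to itself, so its restriction $\alpha|_{(\widetilde{V^{\otimes m}})^H}$ is an endomorphism of this space. *)

theory Defs
  imports
    "HOL-Library.Function_Algebras"
    "HOL-Computational_Algebra.Polynomial"
begin

section \<open>Trace of an endomorphism of a finite-dimensional subspace\<close>

definition trace_on ::
  "('k::field \<Rightarrow> 'v::ab_group_add \<Rightarrow> 'v) \<Rightarrow> 'v set \<Rightarrow> ('v \<Rightarrow> 'v) \<Rightarrow> 'k"
where
  "trace_on sV W f =
     (let B = (SOME B. \<not> module.dependent sV B \<and> module.span sV B = W)
      in \<Sum>b\<in>B. module.representation sV B (f b) b)"


section \<open>Tensor powers of a vector space\<close>

definition multilinear ::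
  "('k::field \<Rightarrow> 'v::ab_group_add \<Rightarrow> 'v) \<Rightarrow> ('k \<Rightarrow> 'w::ab_group_add \<Rightarrow> 'w) \<Rightarrow> nat \<Rightarrow> ('v list \<Rightarrow> 'w) \<Rightarrow> bool"
where
  "multilinear sV sW n F \<longleftrightarrow>
     (\<forall>vs i. length vs = n \<longrightarrow> i < n \<longrightarrow> Vector_Spaces.linear sV sW (\<lambda>v. F (vs[i := v])))"

text \<open>
  Over a field, \<open>V\<^sup>\<otimes>\<^sup>n\<close> embeds into the dual of the space of \<open>n\<close>-linear forms on \<open>V\<close>, the pure tensor
  \<open>v\<^sub>1 \<otimes> \<dots> \<otimes> v\<^sub>n\<close> acting by evaluation at \<open>(v\<^sub>1, \<dots>, v\<^sub>n)\<close>; this holds in any dimension. The tensor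
  power is taken to be the linear span of these evaluations. All tensor powers of \<open>V\<close> thus live in
  one type. Functions that are not multilinear are sent to \<open>0\<close>, so that two
  tensors are equal as soon as they agree on multilinear forms.
\<close>

type_synonym ('k, 'v) tensor = "('v list \<Rightarrow> 'k) \<Rightarrow> 'k"

definition tscale :: "'k::field \<Rightarrow> ('k, 'v) tensor \<Rightarrow> ('k, 'v) tensor" where
  "tscale c t = (\<lambda>f. c * t f)"

interpretation tensor_space: vector_space tscale
  by unfold_locales (auto simp: tscale_def fun_eq_iff algebra_simps)

locale tensor_powers = vector_space scale
  for scale :: "'a::field \<Rightarrow> 'b::ab_group_add \<Rightarrow> 'b"
begin

definition tensor :: "'b list \<Rightarrow> ('a, 'b) tensor" where
  "tensor vs = (\<lambda>f. if multilinear scale (*) (length vs) f then f vs else 0)"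

definition tensor_power :: "nat \<Rightarrow> ('a, 'b) tensor set" where
  "tensor_power n = tensor_space.span {tensor vs | vs. length vs = n}"

text \<open>
  For an \<open>n\<close>-linear map \<open>F\<close> with values in a vector space with scalar multiplication \<open>sW\<close>,
  \<open>tensor_lift sW n F t\<close> is the value at \<open>t\<close> of the linear map \<open>V\<^sup>\<otimes>\<^sup>n \<rightarrow> W\<close> induced by \<open>F\<close>: write \<open>t\<close> as a
  linear combination of pure tensors and replace each of them by the value of \<open>F\<close>. If \<open>t\<close> is an (iterated)
  coproduct \<open>\<Delta>\<^sup>n\<^sup>-\<^sup>1(h)\<close>, this is the Sweedler sum of \<open>F(h\<^sub>1, \<dots>, h\<^sub>n)\<close>. Well-definedness and
  linearity are proved below.
\<close>

definition tensor_lift ::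
  "('a \<Rightarrow> 'w::ab_group_add \<Rightarrow> 'w) \<Rightarrow> nat \<Rightarrow> ('b list \<Rightarrow> 'w) \<Rightarrow> ('a, 'b) tensor \<Rightarrow> 'w"
where
  "tensor_lift sW n F t =
     (THE w. \<exists>cs :: ('a \<times> 'b list) list. (\<forall>(c, vs) \<in> set cs. length vs = n) \<and>
        t = (\<Sum>(c, vs)\<leftarrow>cs. tscale c (tensor vs)) \<and> w = (\<Sum>(c, vs)\<leftarrow>cs. sW c (F vs)))"

lemma tensor_power_expand:
  assumes "t \<in> tensor_power n"
  shows "\<exists>cs. (\<forall>(c, vs) \<in> set cs. length vs = n) \<and> t = (\<Sum>(c, vs)\<leftarrow>cs. tscale c (tensor vs))"
  using assms unfolding tensor_power_def
proof (induction rule: tensor_space.span_induct_alt)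
  case base
  show ?case by (rule exI[of _ "[]"]) simp
next
  case (step c x y)
  then obtain cs vs where "\<forall>(c, vs) \<in> set cs. length vs = n" "y = (\<Sum>(c, vs)\<leftarrow>cs. tscale c (tensor vs))"
    "x = tensor vs" "length vs = n" by blast
  then show ?case by (intro exI[of _ "(c, vs) # cs"]) auto
qed

lemma multilinear_compose:
  assumes "multilinear scale sW n F" and "Vector_Spaces.linear sW (*) g"
  shows "multilinear scale (*) n (\<lambda>vs. g (F vs))"
  using assms Vector_Spaces.linear_compose unfolding multilinear_def o_def by blast

lemma lift_sum_unique:
  assumes W: "vector_space sW" and F: "multilinear scale sW n F"
    and cs: "\<forall>(c, vs) \<in> set cs. length vs = n" and ds: "\<forall>(c, vs) \<in> set ds. length vs = n"
    and eq: "(\<Sum>(c, vs)\<leftarrow>cs. tscale c (tensor vs)) = (\<Sum>(c, vs)\<leftarrow>ds. tscale c (tensor vs))"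
  shows "(\<Sum>(c, vs)\<leftarrow>cs. sW c (F vs)) = (\<Sum>(c, vs)\<leftarrow>ds. sW c (F vs))"
proof (rule ccontr)
  interpret W: vector_space sW by fact
  interpret Wk: vector_space_pair sW "(*) :: 'a \<Rightarrow> 'a \<Rightarrow> 'a"
    by unfold_locales (auto simp: algebra_simps)
  let ?s = "\<lambda>cs. \<Sum>(c, vs)\<leftarrow>cs. sW c (F vs)"
  assume "?s cs \<noteq> ?s ds"
  then have "W.independent {?s cs - ?s ds}" by simp
  then obtain g where g: "Vector_Spaces.linear sW (*) g" and g1: "g (?s cs - ?s ds) = 1"
    using Wk.linear_independent_extend[of "{?s cs - ?s ds}" "\<lambda>_. 1"] by auto
  interpret g: Vector_Spaces.linear sW "(*)" g by fact
  have ml: "multilinear scale (*) n (\<lambda>vs. g (F vs))" using multilinear_compose[OF F g] .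
  have *: "(\<Sum>(c, vs)\<leftarrow>es. tscale c (tensor vs)) (\<lambda>vs. g (F vs)) = g (?s es)"
    if "\<forall>(c, vs) \<in> set es. length vs = n" for es
    using that
  proof (induction es)
    case Nil
    show ?case by (simp add: g.zero)
  next
    case (Cons e es)
    obtain c vs where e: "e = (c, vs)" by force
    have "tscale c (tensor vs) (\<lambda>vs. g (F vs)) = c * g (F vs)"
      using Cons.prems ml by (simp add: e tscale_def tensor_def)
    with Cons show ?case by (simp add: e g.add g.scale)
  qed
  have "g (?s cs) = g (?s ds)" using *[OF cs] *[OF ds] eq by simp
  then show False using g1 by (simp add: g.diff)
qed

lemma tensor_lift_sum:
  assumes "vector_space sW" and "multilinear scale sW n F" and "\<forall>(c, vs) \<in> set cs. length vs = n"
  shows "tensor_lift sW n F (\<Sum>(c, vs)\<leftarrow>cs. tscale c (tensor vs)) = (\<Sum>(c, vs)\<leftarrow>cs. sW c (F vs))"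
  unfolding tensor_lift_def
proof (rule the_equality)
  show "\<exists>ds. (\<forall>(c, vs) \<in> set ds. length vs = n) \<and>
      (\<Sum>(c, vs)\<leftarrow>cs. tscale c (tensor vs)) = (\<Sum>(c, vs)\<leftarrow>ds. tscale c (tensor vs)) \<and>
      (\<Sum>(c, vs)\<leftarrow>cs. sW c (F vs)) = (\<Sum>(c, vs)\<leftarrow>ds. sW c (F vs))"
    by (rule exI[of _ cs], intro conjI assms(3) refl)
qed (elim exE conjE, hypsubst, rule lift_sum_unique[OF assms(1,2) _ assms(3) sym])

lemma tensor_lift_tensor:
  assumes "vector_space sW" and "multilinear scale sW n F" and "length vs = n"
  shows "tensor_lift sW n F (tensor vs) = F vs"
proof -
  interpret W: vector_space sW by fact
  have "\<forall>(c, ws) \<in> set [(1, vs)]. length ws = n" using assms(3) by simp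
  from tensor_lift_sum[OF assms(1,2) this] show ?thesis
    by (simp only: list.map sum_list.Cons sum_list.Nil prod.case add_0_right
        tensor_space.scale_one W.scale_one)
qed

lemma tensor_lift_add:
  assumes W: "vector_space sW" and F: "multilinear scale sW n F"
    and t: "t \<in> tensor_power n" and u: "u \<in> tensor_power n"
  shows "tensor_lift sW n F (t + u) = tensor_lift sW n F t + tensor_lift sW n F u"
proof -
  obtain cs where cs: "\<forall>(c, vs) \<in> set cs. length vs = n" "t = (\<Sum>(c, vs)\<leftarrow>cs. tscale c (tensor vs))"
    using tensor_power_expand[OF t] by (elim exE conjE)
  obtain ds where ds: "\<forall>(c, vs) \<in> set ds. length vs = n" "u = (\<Sum>(c, vs)\<leftarrow>ds. tscale c (tensor vs))"
    using tensor_power_expand[OF u] by (elim exE conjE)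
  have "\<forall>(c, vs) \<in> set (cs @ ds). length vs = n" using cs(1) ds(1) by auto
  from tensor_lift_sum[OF W F this] show ?thesis
    unfolding cs(2) ds(2) tensor_lift_sum[OF W F cs(1)] tensor_lift_sum[OF W F ds(1)]
    by (simp only: map_append sum_list.append)
qed

lemma tensor_lift_scale:
  assumes W: "vector_space sW" and F: "multilinear scale sW n F" and t: "t \<in> tensor_power n"
  shows "tensor_lift sW n F (tscale a t) = sW a (tensor_lift sW n F t)"
proof -
  interpret W: vector_space sW by fact
  obtain cs where cs: "\<forall>(c, vs) \<in> set cs. length vs = n" "t = (\<Sum>(c, vs)\<leftarrow>cs. tscale c (tensor vs))"
    using tensor_power_expand[OF t] by (elim exE conjE)
  let ?ds = "map (\<lambda>(c, vs). (a * c, vs)) cs"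
  have ds: "\<forall>(c, vs) \<in> set ?ds. length vs = n" using cs(1) by auto
  have 1: "(\<Sum>(c, vs)\<leftarrow>?ds. tscale c (tensor vs)) = tscale a t" unfolding cs(2)
  proof (induction cs)
    case (Cons e cs)
    then show ?case
      by (simp only: list.map sum_list.Cons split_beta fst_conv snd_conv
          tensor_space.scale_right_distrib tensor_space.scale_scale)
  qed (simp only: list.map sum_list.Nil tensor_space.scale_zero_right)
  have 2: "(\<Sum>(c, vs)\<leftarrow>?ds. sW c (F vs)) = sW a (\<Sum>(c, vs)\<leftarrow>cs. sW c (F vs))"
    by (induction cs) (auto simp: W.scale_right_distrib)
  show ?thesis
    using tensor_lift_sum[OF W F ds] tensor_lift_sum[OF W F cs(1)] 1 2 cs(2) by simp
qed

definition cyclic_perm :: "nat \<Rightarrow> ('a, 'b) tensor \<Rightarrow> ('a, 'b) tensor" where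
  "cyclic_perm n = tensor_lift tscale n (\<lambda>vs. tensor (rotate1 vs))"

end


section \<open>Semisimple Hopf algebras and their modules\<close>

locale k_algebra = tensor_powers scale
  for scale :: "'k::field \<Rightarrow> 'h::ring_1 \<Rightarrow> 'h" +
  assumes scale_mult_left: "scale c x * y = scale c (x * y)"
    and scale_mult_right: "x * scale c y = scale c (x * y)"
begin

definition left_ideal :: "'h set \<Rightarrow> bool" where
  "left_ideal L \<longleftrightarrow> subspace L \<and> (\<forall>h. \<forall>x\<in>L. h * x \<in> L)"

text \<open>Complete reducibility of the left regular module.\<close>

definition semisimple :: bool where
  "semisimple \<longleftrightarrow> (\<forall>L. left_ideal L \<longrightarrow>
     (\<exists>L'. left_ideal L' \<and> L \<inter> L' = {0} \<and> (\<forall>h. \<exists>x\<in>L. \<exists>y\<in>L'. h = x + y)))"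

end

locale hopf_algebra = k_algebra scale
  for scale :: "'k::field \<Rightarrow> 'h::ring_1 \<Rightarrow> 'h" +
  fixes \<Delta> :: "'h \<Rightarrow> ('k, 'h) tensor"
    and \<epsilon> :: "'h \<Rightarrow> 'k"
    and S :: "'h \<Rightarrow> 'h"
  assumes comult_linear: "Vector_Spaces.linear scale tscale \<Delta>"
    and comult_in_tensor_power: "\<Delta> h \<in> tensor_power 2"
    and counit_linear: "Vector_Spaces.linear scale (*) \<epsilon>"
    and antipode_linear: "Vector_Spaces.linear scale scale S"
    and coassoc:
      "tensor_lift tscale 2 (\<lambda>xs. tensor_lift tscale 2 (\<lambda>ys. tensor [ys ! 0, ys ! 1, xs ! 1]) (\<Delta> (xs ! 0))) (\<Delta> h) =
       tensor_lift tscale 2 (\<lambda>xs. tensor_lift tscale 2 (\<lambda>ys. tensor [xs ! 0, ys ! 0, ys ! 1]) (\<Delta> (xs ! 1))) (\<Delta> h)"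
    and counit_left: "tensor_lift scale 2 (\<lambda>xs. scale (\<epsilon> (xs ! 0)) (xs ! 1)) (\<Delta> h) = h"
    and counit_right: "tensor_lift scale 2 (\<lambda>xs. scale (\<epsilon> (xs ! 1)) (xs ! 0)) (\<Delta> h) = h"
    and comult_mult:
      "\<Delta> (g * h) = tensor_lift tscale 2 (\<lambda>xs. tensor_lift tscale 2
         (\<lambda>ys. tensor [xs ! 0 * ys ! 0, xs ! 1 * ys ! 1]) (\<Delta> h)) (\<Delta> g)"
    and comult_one: "\<Delta> 1 = tensor [1, 1]"
    and counit_mult: "\<epsilon> (g * h) = \<epsilon> g * \<epsilon> h"
    and counit_one: "\<epsilon> 1 = 1"
    and antipode_left: "tensor_lift scale 2 (\<lambda>xs. S (xs ! 0) * xs ! 1) (\<Delta> h) = scale (\<epsilon> h) 1"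
    and antipode_right: "tensor_lift scale 2 (\<lambda>xs. xs ! 0 * S (xs ! 1)) (\<Delta> h) = scale (\<epsilon> h) 1"
begin

text \<open>\<open>iter_comult n\<close> is \<open>\<Delta>\<^sup>n : H \<rightarrow> H\<^sup>\<otimes>\<^sup>n\<^sup>+\<^sup>1\<close>, obtained by splitting the first tensor factor repeatedly.\<close>

primrec iter_comult :: "nat \<Rightarrow> 'h \<Rightarrow> ('k, 'h) tensor" where
  "iter_comult 0 h = tensor [h]"
| "iter_comult (Suc n) h =
     tensor_lift tscale (Suc n)
       (\<lambda>xs. tensor_lift tscale 2 (\<lambda>ys. tensor (ys @ tl xs)) (\<Delta> (hd xs)))
       (iter_comult n h)"

definition two_sided_integral :: "'h \<Rightarrow> bool" where
  "two_sided_integral x \<longleftrightarrow> (\<forall>h. h * x = scale (\<epsilon> h) x \<and> x * h = scale (\<epsilon> h) x)"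

definition normalized_integral :: "'h" where
  "normalized_integral = (THE x. two_sided_integral x \<and> \<epsilon> x = 1)"

definition hopf_automorphism :: "('h \<Rightarrow> 'h) \<Rightarrow> bool" where
  "hopf_automorphism \<tau> \<longleftrightarrow>
     bij \<tau> \<and> Vector_Spaces.linear scale scale \<tau> \<and>
     (\<forall>g h. \<tau> (g * h) = \<tau> g * \<tau> h) \<and> \<tau> 1 = 1 \<and>
     (\<forall>h. \<Delta> (\<tau> h) = tensor_lift tscale 2 (\<lambda>xs. tensor [\<tau> (xs ! 0), \<tau> (xs ! 1)]) (\<Delta> h)) \<and>
     (\<forall>h. \<epsilon> (\<tau> h) = \<epsilon> h) \<and> (\<forall>h. \<tau> (S h) = S (\<tau> h))"

definition twisted_FS_indicator :: "nat \<Rightarrow> ('h \<Rightarrow> 'k) \<Rightarrow> ('h \<Rightarrow> 'h) \<Rightarrow> 'k" where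
  "twisted_FS_indicator m \<chi> \<tau> =
     tensor_lift (*) m (\<lambda>xs. \<chi> (prod_list (map (\<lambda>i. (\<tau> ^^ i) (xs ! i)) [0..<m])))
       (iter_comult (m - 1) normalized_integral)"

end

locale hopf_module = hopf_algebra scale \<Delta> \<epsilon> S + V: tensor_powers sV
  for scale :: "'k::field \<Rightarrow> 'h::ring_1 \<Rightarrow> 'h"
    and \<Delta> :: "'h \<Rightarrow> ('k, 'h) tensor" and \<epsilon> :: "'h \<Rightarrow> 'k" and S :: "'h \<Rightarrow> 'h"
    and sV :: "'k \<Rightarrow> 'v::ab_group_add \<Rightarrow> 'v" +
  fixes \<rho> :: "'h \<Rightarrow> 'v \<Rightarrow> 'v"
  assumes action_linear: "Vector_Spaces.linear sV sV (\<rho> h)"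
    and action_add: "\<rho> (g + h) v = \<rho> g v + \<rho> h v"
    and action_scale: "\<rho> (scale c h) v = sV c (\<rho> h v)"
    and action_mult: "\<rho> (g * h) v = \<rho> g (\<rho> h v)"
    and action_one: "\<rho> 1 v = v"
begin

definition character :: "'h \<Rightarrow> 'k" where
  "character h = trace_on sV UNIV (\<rho> h)"

definition twisted_action :: "nat \<Rightarrow> ('h \<Rightarrow> 'h) \<Rightarrow> 'h \<Rightarrow> ('k, 'v) tensor \<Rightarrow> ('k, 'v) tensor" where
  "twisted_action m \<tau> h t =
     tensor_lift tscale m
       (\<lambda>hs. V.tensor_lift tscale m
          (\<lambda>vs. V.tensor (map (\<lambda>i. \<rho> ((\<tau> ^^ i) (hs ! i)) (vs ! i)) [0..<m])) t)
       (iter_comult (m - 1) h)"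

definition twisted_invariants :: "nat \<Rightarrow> ('h \<Rightarrow> 'h) \<Rightarrow> ('k, 'v) tensor set" where
  "twisted_invariants m \<tau> =
     {w \<in> V.tensor_power m. \<forall>h. twisted_action m \<tau> h w = tscale (\<epsilon> h) w}"

end

end

theory Submission
  imports Defs
begin

text \<open>
  Write \<open>L\<close> for the normalized integral and \<open>W\<close> for the invariants of the twisted tensor power. Acting with
  \<open>L\<close> is a projection onto \<open>W\<close>. If the cyclic permutation \<open>\<alpha>\<close> commutes with this projection, then the trace
  of \<open>\<alpha>\<close> on \<open>W\<close> is the trace of \<open>\<alpha> \<circ> L\<close> on the whole tensor power. For operators \<open>A\<^sub>1, \<dots>, A\<^sub>m\<close> on \<open>V\<close> the
  trace of \<open>\<alpha> \<circ> (A\<^sub>1 \<otimes> \<dots> \<otimes> A\<^sub>m)\<close> is a sum over closed paths of matrix entries, namely the trace of the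
  product \<open>A\<^sub>1 \<cdots> A\<^sub>m\<close> (\<open>sum_coords_rotate\<close>); with \<open>A\<^sub>i = \<rho>(\<tau>\<^sup>i\<^sup>-\<^sup>1(L\<^sub>i))\<close> this is the indicator.

  It does if the iterated coproduct of \<open>L\<close> is invariant under cyclic rotation and under \<open>\<tau>\<close>. The second
  property is uniqueness of the integral. The first one reduces to \<open>L\<^sub>1 \<otimes> L\<^sub>2 = L\<^sub>2 \<otimes> L\<^sub>1\<close>,
  and this is where the depth lies: it amounts to the theorem of Larson and Radford that the antipode \<open>S\<close> of
  a semisimple Hopf algebra in characteristic 0 is an involution (\<open>antipode_involution\<close>). Most of the text
  is a proof of that theorem by traces on \<open>H\<close>.

  Elements of \<open>H\<close> can be moved from one leg of \<open>\<Delta>(L)\<close> to the other, so the second legs span \<open>H\<close>. Hence \<open>\<lambda>(h) = tr(x \<mapsto> h S\<^sup>2(x))\<close> is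
  defined. It is a left integral of the dual with \<open>\<lambda>(L) = 1\<close> and a nondegenerate form with Nakayama
  automorphism \<open>S\<^sup>2\<close>. The grouplike \<open>g = \<lambda>(L\<^sub>1) L\<^sub>2\<close> measures the failure of \<open>\<lambda>\<close> to be a right integral, and
  comparing \<open>\<lambda> \<circ> S\<close> with \<open>\<lambda>\<close> gives Radford's formula \<open>S\<^sup>4(h) = g\<^sup>-\<^sup>1 h g\<close>.

  The number \<open>\<lambda>(1) = tr S\<^sup>2\<close> is nonzero (\<open>lam_one_nonzero\<close>). The element \<open>q = S(L\<^sub>2) L\<^sub>1\<close> is invertible, because the
  regular character satisfies \<open>\<chi>(h) = \<lambda>(g h q)\<close> and its trace form is nondegenerate. If \<open>\<lambda>(1) = 0\<close>, then \<open>\<lambda>\<close>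
  vanishes on all powers of \<open>g\<close>, and this gives power-sum relations between the joint eigenvalues of the
  commuting elements \<open>q\<^sup>-\<^sup>1\<close> and \<open>g\<^sup>-\<^sup>1\<close>. A sum-of-squares argument over \<open>\<rat>\<close> shows that they are contradictory
  (\<open>eigenvalue_system_unsolvable\<close>). Therefore \<open>g = 1\<close> and \<open>S\<^sup>4 = id\<close>.

  Finally let \<open>n = dim H\<close>. Then \<open>h \<mapsto> \<chi>(h\<^sub>1) h\<^sub>2 / n\<close> is an idempotent that commutes with \<open>S\<^sup>2\<close>, and the trace
  of its composition with \<open>S\<^sup>2\<close> is \<open>\<lambda>(1) / n\<close>. Since \<open>S\<^sup>4 = id\<close>, this trace is an integer. So \<open>tr S\<^sup>2\<close> is a
  nonzero multiple of \<open>n\<close>, which forces \<open>S\<^sup>2 = id\<close> or \<open>S\<^sup>2 = - id\<close>, and \<open>S\<^sup>2(1) = 1\<close>.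
\<close>

section \<open>Traces\<close>

context vector_space
begin

text \<open>The trace of a finite-rank map can be read off from any presentation of it as a sum of functionals times
  vectors; only the values on \<open>W\<close> matter. In particular the value does not depend on the basis that is chosen in
  \<^const>\<open>trace_on\<close>.\<close>

lemma trace_on_eq_sum:
  assumes W: "subspace W" and S: "finite S" "W \<subseteq> span S"
    and I: "finite I" and lin: "\<And>i. i \<in> I \<Longrightarrow> Vector_Spaces.linear scale (*) (\<phi> i)"
    and w: "\<And>i. i \<in> I \<Longrightarrow> w i \<in> W"
    and f: "\<And>x. x \<in> W \<Longrightarrow> f x = (\<Sum>i\<in>I. scale (\<phi> i x) (w i))"
  shows "trace_on scale W f = (\<Sum>i\<in>I. \<phi> i (w i))"
proof -
  define B where "B = (SOME B. independent B \<and> span B = W)"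
  obtain C where C: "C \<subseteq> W" "independent C" "W \<subseteq> span C" "card C = dim W"
    by (rule basis_exists)
  have "independent C \<and> span C = W"
    using C(2) span_subspace[OF C(1,3) W] by simp
  then have B: "independent B" "span B = W"
    using someI[of "\<lambda>B. independent B \<and> span B = W" C] unfolding B_def by auto
  have "finite B"
    using independent_span_bound[OF S(1) B(1)] B(2) S(2) span_superset[of B] by auto
  have "trace_on scale W f = (\<Sum>b\<in>B. representation B (f b) b)"
    by (simp add: trace_on_def B_def Let_def)
  also have "\<dots> = (\<Sum>b\<in>B. \<Sum>i\<in>I. \<phi> i b * representation B (w i) b)"
  proof (rule sum.cong[OF refl])
    fix b assume "b \<in> B"
    then have "b \<in> W" using B(2) span_base by auto
    have scaleW: "scale (\<phi> i b) (w i) \<in> span B" if "i \<in> I" for i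
      using w[OF that] B(2) by (auto intro: span_scale)
    have "representation B (f b) = (\<lambda>c. \<Sum>i\<in>I. representation B (scale (\<phi> i b) (w i)) c)"
      unfolding f[OF \<open>b \<in> W\<close>] by (rule representation_sum[OF B(1) scaleW])
    also have "\<dots> = (\<lambda>c. \<Sum>i\<in>I. \<phi> i b * representation B (w i) c)"
      using representation_scale[OF B(1)] w B(2) by (intro ext sum.cong refl) metis
    finally show "representation B (f b) b = (\<Sum>i\<in>I. \<phi> i b * representation B (w i) b)" by simp
  qed
  also have "\<dots> = (\<Sum>i\<in>I. \<Sum>b\<in>B. \<phi> i b * representation B (w i) b)" by (rule sum.swap)
  also have "\<dots> = (\<Sum>i\<in>I. \<phi> i (w i))"
  proof (rule sum.cong[OF refl])
    fix i assume i: "i \<in> I"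
    interpret \<phi>: Vector_Spaces.linear scale "(*)" "\<phi> i" by (rule lin[OF i])
    have "\<phi> i (w i) = \<phi> i (\<Sum>b\<in>B. scale (representation B (w i) b) b)"
      using sum_representation_eq[OF B(1) _ \<open>finite B\<close> subset_refl, of "w i"] w[OF i] B(2) by simp
    also have "\<dots> = (\<Sum>b\<in>B. \<phi> i b * representation B (w i) b)"
      by (simp add: \<phi>.sum \<phi>.scale mult.commute)
    finally show "(\<Sum>b\<in>B. \<phi> i b * representation B (w i) b) = \<phi> i (w i)" ..
  qed
  finally show ?thesis .
qed

end

locale fd_space = vector_space scale
  for scale :: "'k::field \<Rightarrow> 'v::ab_group_add \<Rightarrow> 'v" +
  assumes finite_spanning: "\<exists>B. finite B \<and> span B = UNIV"
begin

definition Bas :: "'v set" where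
  "Bas = (SOME B. independent B \<and> span B = UNIV)"

definition crd :: "'v \<Rightarrow> 'v \<Rightarrow> 'k" where
  "crd b x = representation Bas x b"

abbreviation endo :: "('v \<Rightarrow> 'v) \<Rightarrow> bool" where
  "endo f \<equiv> Vector_Spaces.linear scale scale f"

abbreviation tr :: "('v \<Rightarrow> 'v) \<Rightarrow> 'k" where
  "tr \<equiv> trace_on scale UNIV"

lemma Bas: "independent Bas" "span Bas = UNIV"
proof -
  obtain C where "C \<subseteq> UNIV" "independent C" "UNIV \<subseteq> span C" "card C = dim UNIV"
    by (rule basis_exists)
  then have "independent C \<and> span C = UNIV" by auto
  then show "independent Bas" "span Bas = UNIV"
    using someI[of "\<lambda>B. independent B \<and> span B = UNIV" C] unfolding Bas_def by auto
qed

lemma finite_independent: "independent C \<Longrightarrow> finite C"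
  using finite_spanning independent_span_bound by blast

lemma finite_Bas: "finite Bas"
  by (rule finite_independent[OF Bas(1)])

lemma crd_linear: "Vector_Spaces.linear scale (*) (crd b)"
  unfolding crd_def by (rule linear_representation[OF Bas])

lemma expand: "x = (\<Sum>b\<in>Bas. scale (crd b x) b)"
  using sum_representation_eq[OF Bas(1) _ finite_Bas subset_refl, of x] Bas(2)
  by (simp add: crd_def)

lemma linear_expand:
  assumes "Vector_Spaces.linear scale s f"
  shows "f x = (\<Sum>b\<in>Bas. s (crd b x) (f b))"
proof -
  interpret Vector_Spaces.linear scale s f by fact
  have "f x = f (\<Sum>b\<in>Bas. scale (crd b x) b)" using expand[of x] by (rule arg_cong)
  then show ?thesis by (simp only: sum local.scale)
qed

lemma tr_eq_sum:
  assumes "finite I" and "\<And>i. i \<in> I \<Longrightarrow> Vector_Spaces.linear scale (*) (\<phi> i)"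
    and "\<And>x. f x = (\<Sum>i\<in>I. scale (\<phi> i x) (w i))"
  shows "tr f = (\<Sum>i\<in>I. \<phi> i (w i))"
  by (rule trace_on_eq_sum[OF subspace_UNIV finite_Bas _ assms(1,2) UNIV_I assms(3)])
    (simp_all add: Bas)

lemma tr_eq_sum_list:
  assumes "\<And>p. p \<in> set ps \<Longrightarrow> Vector_Spaces.linear scale (*) (\<phi> p)"
    and "\<And>x. f x = (\<Sum>p\<leftarrow>ps. scale (\<phi> p x) (w p))"
  shows "tr f = (\<Sum>p\<leftarrow>ps. \<phi> p (w p))"
proof -
  have "f x = (\<Sum>i<length ps. scale (\<phi> (ps ! i) x) (w (ps ! i)))" for x
    unfolding assms(2) by (simp add: sum_list_sum_nth atLeast0LessThan)
  from tr_eq_sum[OF _ assms(1)[OF nth_mem] this] show ?thesis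
    by (simp add: sum_list_sum_nth atLeast0LessThan)
qed

lemma tr_basis: "tr f = (\<Sum>b\<in>Bas. crd b (f b))"
  by (simp add: trace_on_def Bas_def crd_def Let_def)

lemma tr_add: "tr (\<lambda>x. f x + g x) = tr f + tr g"
  using crd_linear[unfolded Vector_Spaces.linear_iff] by (simp add: tr_basis sum.distrib)

lemma tr_scale: "tr (\<lambda>x. scale c (f x)) = c * tr f"
  using crd_linear[unfolded Vector_Spaces.linear_iff] by (simp add: tr_basis sum_distrib_left)

lemma tr_comm:
  assumes f: "endo f" and g: "endo g"
  shows "tr (\<lambda>x. f (g x)) = tr (\<lambda>x. g (f x))"
proof -
  have lin: "Vector_Spaces.linear scale (*) (\<lambda>x. crd b (g x))" for b
    using Vector_Spaces.linear_compose[OF g crd_linear] by (simp add: o_def)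
  have "tr (\<lambda>x. f (g x)) = (\<Sum>b\<in>Bas. crd b (g (f b)))"
    by (rule tr_eq_sum[OF finite_Bas lin]) (rule linear_expand[OF f])
  then show ?thesis by (simp add: tr_basis)
qed

text \<open>The trace of an idempotent is its rank. In characteristic 0 this number determines whether the idempotent
  vanishes, and it is an integer in the field; both facts are exploited for the regular character and for
  \<open>S\<^sup>2\<close>.\<close>

lemma tr_idempotent:
  assumes E: "endo E" and idem: "\<And>x. E (E x) = E x"
  shows "\<exists>r. tr E = of_nat r \<and> (r = 0 \<longrightarrow> (\<forall>x. E x = 0))"
proof -
  interpret E: Vector_Spaces.linear scale scale E by fact
  obtain C where C': "C \<subseteq> range E" "independent C" "range E \<subseteq> span C" "card C = dim (range E)"
    by (rule basis_exists)
  then have C: "independent C" "span C = range E"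
    using span_subspace[OF C'(1,3) E.subspace_image[OF subspace_UNIV]] by auto
  have fin: "finite C" by (rule finite_independent[OF C(1)])
  have EC: "E c = c" if "c \<in> C" for c
    using that span_base[OF that] C(2) idem by auto
  have rng: "E x \<in> span C" for x using C(2) by auto
  have vs: "vector_space ((*) :: 'k \<Rightarrow> 'k \<Rightarrow> 'k)"
    by unfold_locales (simp_all add: algebra_simps)
  have lin: "Vector_Spaces.linear scale (*) (\<lambda>x. representation C (E x) c)" for c
    unfolding Vector_Spaces.linear_iff
    using representation_add[OF C(1) rng rng] representation_scale[OF C(1) rng]
    by (simp add: E.add E.scale vs vector_space_axioms)
  have "tr E = (\<Sum>c\<in>C. representation C (E c) c)"
    by (rule tr_eq_sum[OF fin lin])
      (use sum_representation_eq[OF C(1) rng fin subset_refl] in simp)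
  also have "\<dots> = of_nat (card C)"
    using C(1) by (simp add: EC representation_basis)
  finally have "tr E = of_nat (card C)" .
  moreover have "card C = 0 \<longrightarrow> (\<forall>x. E x = 0)"
  proof
    assume "card C = 0"
    with fin C(2) have "range E = {0}" by simp
    then show "\<forall>x. E x = 0" by auto
  qed
  ultimately show ?thesis by (intro exI[of _ "card C"] conjI)
qed

lemma tr_ident: "tr (\<lambda>x. x) = of_nat (card Bas)"
  using Bas by (simp add: tr_basis crd_def representation_basis)

end

section \<open>Simultaneous triangularization of two commuting operators\<close>

context fd_space
begin

text \<open>The list is read from the right: its tails span a flag of invariant subspaces, each vector is an
  eigenvector modulo the span of the vectors after it, and \<open>a\<close> records the eigenvalues.\<close>

primrec triangular :: "('v \<Rightarrow> 'v) \<Rightarrow> ('v \<Rightarrow> 'k) \<Rightarrow> 'v list \<Rightarrow> bool" where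
  "triangular f a [] \<longleftrightarrow> True"
| "triangular f a (v # vs) \<longleftrightarrow>
     triangular f a vs \<and> v \<notin> span (set vs) \<and> f v - scale (a v) v \<in> span (set vs)"

lemma triangular_cong:
  "(\<And>v. v \<in> set vs \<Longrightarrow> a v = b v) \<Longrightarrow> triangular f a vs = triangular f b vs"
  by (induction vs) auto

lemma triangular_independent:
  "triangular f a vs \<Longrightarrow> independent (set vs) \<and> distinct vs"
proof (induction vs)
  case (Cons v vs)
  then have "independent (insert v (set vs))" by (intro independent_insertI) auto
  then show ?case using Cons span_base[of v "set vs"] by auto
qed (simp add: independent_empty)

lemma triangular_invariant:
  assumes f: "endo f"
  shows "triangular f a vs \<Longrightarrow> x \<in> span (set vs) \<Longrightarrow> f x \<in> span (set vs)"
proof (induction vs arbitrary: x)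
  case Nil
  interpret f: Vector_Spaces.linear scale scale f by (rule f)
  from Nil show ?case by simp
next
  case (Cons v vs)
  interpret f: Vector_Spaces.linear scale scale f by (rule f)
  have mono: "span (set vs) \<subseteq> span (set (v # vs))" by (rule span_mono) auto
  obtain k where k: "x - scale k v \<in> span (set vs)"
    using Cons.prems(2) by (auto simp: span_breakdown_eq)
  have "f (x - scale k v) \<in> span (set (v # vs))" using Cons k mono by auto
  moreover have "f v - scale (a v) v \<in> span (set (v # vs))" using Cons.prems(1) mono by auto
  moreover have "scale (a v) v \<in> span (set (v # vs))" by (intro span_scale span_base) simp
  ultimately have "f (x - scale k v) \<in> span (set (v # vs))" "f v \<in> span (set (v # vs))"
    using span_add[of "f v - scale (a v) v" _ "scale (a v) v"] by simp_all
  then have "f (x - scale k v) + scale k (f v) \<in> span (set (v # vs))"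
    by (intro span_add span_scale)
  moreover have "f (x - scale k v) + scale k (f v) = f x" by (simp add: f.diff f.scale)
  ultimately show ?case by simp
qed

lemma triangular_compose:
  assumes f: "endo f"
  shows "triangular f a vs \<Longrightarrow> triangular g b vs \<Longrightarrow> triangular (\<lambda>x. f (g x)) (\<lambda>v. a v * b v) vs"
proof (induction vs)
  case (Cons v vs)
  interpret f: Vector_Spaces.linear scale scale f by (rule f)
  have "f (g v - scale (b v) v) + scale (b v) (f v - scale (a v) v) \<in> span (set vs)"
    using Cons.prems triangular_invariant[OF f, of a vs] by (auto intro!: span_add span_scale)
  moreover have "f (g v) - scale (a v * b v) v = f (g v - scale (b v) v) + scale (b v) (f v - scale (a v) v)"
    by (simp add: f.diff f.scale scale_right_diff_distrib mult.commute)
  ultimately show ?case using Cons by simp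
qed simp

lemma triangular_id:
  "independent (set vs) \<and> distinct vs \<Longrightarrow> triangular (\<lambda>x. x) (\<lambda>_. 1) vs"
proof (induction vs)
  case (Cons v vs)
  then show ?case
    by (auto simp: span_zero independent_insert intro: independent_mono[of "insert v (set vs)"])
qed simp

lemma triangular_power:
  assumes f: "endo f" and t: "triangular f a vs"
  shows "triangular (f ^^ i) (\<lambda>v. a v ^ i) vs"
proof (induction i)
  case 0
  show ?case using triangular_id triangular_independent[OF t] by (simp add: id_def)
next
  case (Suc i)
  show ?case using triangular_compose[OF f t Suc] by (simp add: o_def)
qed

lemma tr_triangular:
  assumes f: "endo f" and t: "triangular f a vs"
    and span: "span (set vs) = UNIV"
  shows "tr f = sum a (set vs)"
proof -
  let ?r = "representation (set vs)"
  have ind: "independent (set vs)" using triangular_independent[OF t] by simp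
  have lin: "Vector_Spaces.linear scale (*) (\<lambda>x. ?r (f x) c)" for c
    using Vector_Spaces.linear_compose[OF f linear_representation[OF ind span]] by (simp add: o_def)
  have "tr f = (\<Sum>c\<in>set vs. ?r (f c) c)"
    by (rule tr_eq_sum[OF _ lin])
      (use sum_representation_eq[OF ind _ _ subset_refl] span in auto)
  also have "\<dots> = sum a (set vs)"
  proof (rule sum.cong[OF refl])
    have "triangular f a us \<Longrightarrow> set us \<subseteq> set vs \<Longrightarrow> v \<in> set us \<Longrightarrow> ?r (f v) v = a v" for us v
    proof (induction us)
      case (Cons u us)
      show ?case
      proof (cases "v = u")
        case True
        let ?s = "f u - scale (a u) u"
        have s: "?s \<in> span (set us)" and u: "u \<notin> span (set us)" using Cons.prems by auto
        then have "u \<notin> set us" using span_base by auto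
        have "?r ?s u = representation (set us) ?s u"
          using representation_extend[OF ind s] Cons.prems by auto
        also have "\<dots> = 0" using representation_ne_zero[of "set us" ?s u] \<open>u \<notin> set us\<close> by auto
        finally have 0: "?r ?s u = 0" .
        have "?r (?s + scale (a u) u) u = ?r ?s u + a u * ?r u u"
          unfolding representation_add[OF ind, unfolded span, OF UNIV_I UNIV_I]
            representation_scale[OF ind, unfolded span, OF UNIV_I] ..
        then show ?thesis using 0 True Cons.prems ind by (simp add: representation_basis)
      qed (use Cons in auto)
    qed simp
    from this[OF t] show "?r (f c) c = a c" if "c \<in> set vs" for c using that by auto
  qed
  finally show ?thesis .
qed

definition poly_op :: "('v \<Rightarrow> 'v) \<Rightarrow> 'k poly \<Rightarrow> 'v \<Rightarrow> 'v" where
  "poly_op A p v = fold_coeffs (\<lambda>c w. scale c v + A w) p 0"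

context
  fixes A :: "'v \<Rightarrow> 'v" assumes A: "endo A"
begin

interpretation A: Vector_Spaces.linear scale scale A by (rule A)

lemma poly_op_0 [simp]: "poly_op A 0 v = 0"
  by (simp add: poly_op_def)

lemma poly_op_pCons [simp]: "poly_op A (pCons c p) v = scale c v + A (poly_op A p v)"
  by (cases "c = 0 \<and> p = 0") (auto simp: poly_op_def)

lemma poly_op_add: "poly_op A (p + q) v = poly_op A p v + poly_op A q v"
  by (induction p q rule: poly_induct2) (auto simp: scale_left_distrib A.add)

lemma poly_op_smult: "poly_op A (smult c p) v = scale c (poly_op A p v)"
  by (induction p) (auto simp: scale_right_distrib A.scale)

lemma poly_op_diff: "poly_op A (p - q) v = poly_op A p v - poly_op A q v"
  using poly_op_add[of p "smult (-1) q"] poly_op_smult[of "-1" q] by simp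

lemma poly_op_sum: "poly_op A (\<Sum>i\<in>I. p i) v = (\<Sum>i\<in>I. poly_op A (p i) v)"
  by (induction I rule: infinite_finite_induct) (auto simp: poly_op_add)

lemma poly_op_monom: "poly_op A (monom c i) v = scale c ((A ^^ i) v)"
  by (induction i) (auto simp: monom_0 monom_Suc A.scale)

lemma poly_op_shift: "poly_op A p (A v - scale k v) = A (poly_op A p v) - scale k (poly_op A p v)"
proof (induction p)
  case (pCons c p)
  then show ?case
    by (simp add: A.add A.diff A.scale scale_right_diff_distrib scale_right_distrib mult.commute)
qed simp

lemma poly_op_linear_factor: "poly_op A ([:-k, 1:] * p) v = poly_op A p (A v - scale k v)"
  by (simp add: poly_op_shift poly_op_diff poly_op_smult)

lemma annihilating_poly: "\<exists>p. p \<noteq> 0 \<and> poly_op A p v = 0"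
proof (cases "inj (\<lambda>i. (A ^^ i) v)")
  case True
  then have "infinite (range (\<lambda>i. (A ^^ i) v))" using finite_imageD by blast
  then have "dependent (range (\<lambda>i. (A ^^ i) v))" using finite_independent by blast
  then obtain t u w where t: "finite t" "t \<subseteq> range (\<lambda>i. (A ^^ i) v)" "(\<Sum>w\<in>t. scale (u w) w) = 0"
      "w \<in> t" "u w \<noteq> 0"
    unfolding dependent_explicit by blast
  define I where "I = {i. (A ^^ i) v \<in> t}"
  have tI: "t = (\<lambda>i. (A ^^ i) v) ` I" using t(2) by (auto simp: I_def)
  have I: "finite I" "inj_on (\<lambda>i. (A ^^ i) v) I"
    using t(1) True finite_vimageI[OF t(1) True] inj_on_subset[OF True] by (auto simp: I_def vimage_def)
  let ?p = "\<Sum>i\<in>I. monom (u ((A ^^ i) v)) i"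
  have "poly_op A ?p v = 0"
    using t(3) by (simp add: poly_op_sum poly_op_monom tI sum.reindex[OF I(2)])
  moreover obtain i where "i \<in> I" "w = (A ^^ i) v" using t(4) tI by auto
  then have "coeff ?p i \<noteq> 0" using I(1) t(5) by (simp add: coeff_sum)
  then have "?p \<noteq> 0" by auto
  ultimately show ?thesis by blast
next
  case False
  then obtain i j where ij: "i \<noteq> j" "(A ^^ i) v = (A ^^ j) v" by (auto simp: inj_def)
  have "coeff (monom 1 i + monom (-1) j :: 'k poly) i \<noteq> 0" using ij(1) by simp
  then have "monom 1 i + monom (-1) j \<noteq> (0 :: 'k poly)" by (metis coeff_0)
  moreover have "poly_op A (monom 1 i + monom (-1) j) v = 0"
    using ij(2) by (simp add: poly_op_add poly_op_monom)
  ultimately show ?thesis by blast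
qed

end

lemma linear_power: "endo f \<Longrightarrow> endo (f ^^ i)"
proof (induction i)
  case 0
  show ?case by (simp add: id_def linear_ident)
next
  case (Suc i)
  then show ?case using Vector_Spaces.linear_compose[of scale scale "f ^^ i" scale f] by (simp add: o_def)
qed

end

locale fd_space_closed = fd_space scale
  for scale :: "'k::alg_closed_field \<Rightarrow> 'v::ab_group_add \<Rightarrow> 'v"
begin

text \<open>An eigenvector in the quotient \<open>E / W\<close>: factor an annihilating polynomial into linear factors
  and apply them one after the other until the vector falls into \<open>W\<close>.\<close>

lemma eigenvector_modulo:
  assumes A: "endo A"
    and W: "subspace W" and E: "subspace E" "\<And>x. x \<in> E \<Longrightarrow> A x \<in> E"
    and v: "v \<in> E" "v \<notin> W"
  shows "\<exists>v k. v \<in> E \<and> v \<notin> W \<and> A v - scale k v \<in> W"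
proof -
  have "p \<noteq> 0 \<Longrightarrow> poly_op A p v \<in> W \<Longrightarrow> v \<in> E \<Longrightarrow> v \<notin> W \<Longrightarrow> ?thesis" for p v
  proof (induction "degree p" arbitrary: p v)
    case 0
    interpret A: Vector_Spaces.linear scale scale A by (rule A)
    obtain c where c: "p = [:c:]" using 0 degree_eq_zeroE by metis
    then have "scale (inverse c) (poly_op A p v) \<in> W" using 0 W subspace_scale by blast
    then show ?case using c 0 by (simp add: poly_op_pCons[OF A] poly_op_0[OF A])
  next
    case (Suc n)
    obtain k where "poly p k = 0" using alg_closed_imp_poly_has_root[of p] Suc(2) by auto
    then obtain r where r: "p = [:-k, 1:] * r" by (auto simp: poly_eq_0_iff_dvd)
    have r0: "r \<noteq> 0" using r Suc by auto
    have "degree p = degree [:-k, 1:] + degree r" unfolding r using r0 by (intro degree_mult_eq) auto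
    then have deg: "n = degree r" using Suc(2) by simp
    let ?v = "A v - scale k v"
    have "?v \<in> E" using E Suc.prems by (auto intro: subspace_diff subspace_scale)
    moreover have "poly_op A r ?v \<in> W" using Suc.prems(2) unfolding r poly_op_linear_factor[OF A] .
    ultimately show ?case using Suc(1)[OF deg r0, of ?v] Suc.prems by blast
  qed
  moreover obtain p where "p \<noteq> 0" "poly_op A p v = 0" using annihilating_poly[OF A] by blast
  ultimately show ?thesis using v W subspace_0 by metis
qed

text \<open>An eigenspace of \<open>A\<close> modulo an invariant subspace is invariant under every operator that commutes with
  \<open>A\<close>, hence contains an eigenvector of \<open>B\<close> modulo that subspace.\<close>

lemma commuting_triangular_extend:
  assumes A: "endo A" and B: "endo B"
    and AB: "\<And>x. A (B x) = B (A x)"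
    and vs: "triangular A a vs" "triangular B b vs" "span (set vs) \<noteq> UNIV"
  shows "\<exists>v k l. triangular A (a(v := k)) (v # vs) \<and> triangular B (b(v := l)) (v # vs) \<and> v \<notin> set vs"
proof -
  interpret A: Vector_Spaces.linear scale scale A by (rule A)
  interpret B: Vector_Spaces.linear scale scale B by (rule B)
  let ?W = "span (set vs)"
  obtain u where "u \<notin> ?W" using vs(3) by blast
  then obtain v k where v: "v \<notin> ?W" "A v - scale k v \<in> ?W"
    using eigenvector_modulo[OF A, of ?W UNIV u] by auto
  let ?E = "{x. A x - scale k x \<in> ?W}"
  have "subspace ?E"
  proof (rule subspaceI)
    show "0 \<in> ?E" by (simp add: span_zero)
    show "x + y \<in> ?E" if "x \<in> ?E" "y \<in> ?E" for x y
      using span_add[of "A x - scale k x" _ "A y - scale k y"] that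
      by (simp add: A.add scale_right_distrib algebra_simps)
    show "scale c x \<in> ?E" if "x \<in> ?E" for c x
      using span_scale[of "A x - scale k x" _ c] that
      by (simp add: A.scale scale_right_diff_distrib mult.commute)
  qed
  moreover have "B x \<in> ?E" if "x \<in> ?E" for x
    using triangular_invariant[OF B vs(2), of "A x - scale k x"] that by (simp add: B.diff B.scale AB)
  ultimately obtain w l where w: "w \<in> ?E" "w \<notin> ?W" "B w - scale l w \<in> ?W"
    using eigenvector_modulo[OF B, of ?W ?E v] v by auto
  have ws: "w \<notin> set vs" using w(2) span_base by auto
  have "triangular A (a(w := k)) vs" "triangular B (b(w := l)) vs"
    using vs(1,2) ws by (metis fun_upd_other triangular_cong)+
  then have "triangular A (a(w := k)) (w # vs)" "triangular B (b(w := l)) (w # vs)"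
    using w by auto
  then show ?thesis using ws by blast
qed

text \<open>Any triangular system can be extended, so it may be started at a given common eigenvector \<open>v0\<close>. Fixing
  \<open>v0\<close> guarantees that the pair of eigenvalues \<open>(1, 1)\<close> occurs among the joint eigenvalues.\<close>

lemma commuting_triangular:
  assumes A: "endo A" and B: "endo B"
    and AB: "\<And>x. A (B x) = B (A x)"
    and v0: "v0 \<noteq> 0" "A v0 = v0" "B v0 = v0"
  shows "\<exists>X a b. finite X \<and> v0 \<in> X \<and> a v0 = 1 \<and> b v0 = 1 \<and>
    (\<forall>i j. tr (\<lambda>x. (A ^^ i) ((B ^^ j) x)) = (\<Sum>v\<in>X. a v ^ i * b v ^ j))"
proof -
  have step: "\<exists>us a b. triangular A a us \<and> triangular B b us \<and> v0 \<in> set us \<and> a v0 = 1 \<and> b v0 = 1 \<and>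
      span (set us) = UNIV"
    if "triangular A a vs" "triangular B b vs" "v0 \<in> set vs" "a v0 = 1" "b v0 = 1" for a b vs
    using that
  proof (induction "card Bas - length vs" arbitrary: vs a b rule: less_induct)
    case less
    show ?case
    proof (cases "span (set vs) = UNIV")
      case True
      then show ?thesis using less.prems by blast
    next
      case False
      obtain v k l where v: "triangular A (a(v := k)) (v # vs)" "triangular B (b(v := l)) (v # vs)"
          "v \<notin> set vs"
        using commuting_triangular_extend[OF A B AB less.prems(1,2) False] by blast
      have "independent (set (v # vs))" "distinct (v # vs)"
        using triangular_independent[OF v(1)] by auto
      then have "length (v # vs) \<le> card Bas"
        using independent_span_bound[OF finite_Bas, of "set (v # vs)"] Bas(2)
          distinct_card[of "v # vs"] by simp
      then have "card Bas - length (v # vs) < card Bas - length vs" by simp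
      then show ?thesis
        by (rule less.hyps[OF _ v(1,2)]) (use less.prems v(3) in auto)
    qed
  qed
  obtain vs a b where vs: "triangular A a vs" "triangular B b vs" "v0 \<in> set vs" "a v0 = 1" "b v0 = 1"
      "span (set vs) = UNIV"
    using step[of "\<lambda>_. 1" "[v0]" "\<lambda>_. 1"] v0 by (auto simp: span_zero)
  have "tr (\<lambda>x. (A ^^ i) ((B ^^ j) x)) = (\<Sum>v\<in>set vs. a v ^ i * b v ^ j)" for i j
  proof (rule tr_triangular[OF _ _ vs(6)])
    show "endo (\<lambda>x. (A ^^ i) ((B ^^ j) x))"
      using Vector_Spaces.linear_compose[OF linear_power[OF B] linear_power[OF A]] by (simp add: o_def)
    show "triangular (\<lambda>x. (A ^^ i) ((B ^^ j) x)) (\<lambda>v. a v ^ i * b v ^ j) vs"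
      by (intro triangular_compose linear_power triangular_power A B vs)
  qed
  then show ?thesis using vs by blast
qed

end

section \<open>A positivity argument\<close>

text \<open>Power-sum relations in \<open>y\<close> hold for every polynomial in \<open>y\<close>; a polynomial that vanishes at all values of
  \<open>y\<close> other than \<open>c\<close> isolates the fibre over \<open>c\<close>.\<close>

lemma sum_fibre_eq_0:
  fixes f y :: "'x \<Rightarrow> 'k::field"
  assumes X: "finite X" and 0: "\<And>i. (\<Sum>x\<in>X. f x * y x ^ i) = 0"
  shows "(\<Sum>x | x \<in> X \<and> y x = c. f x) = 0"
proof -
  define q where "q = (\<Prod>d\<in>y ` X - {c}. [:-d, 1:])"
  have "(\<Sum>x\<in>X. f x * poly q (y x)) = (\<Sum>x\<in>X. \<Sum>i\<le>degree q. coeff q i * (f x * y x ^ i))"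
    by (simp add: poly_altdef sum_distrib_left algebra_simps)
  also have "\<dots> = (\<Sum>i\<le>degree q. coeff q i * (\<Sum>x\<in>X. f x * y x ^ i))"
    by (subst sum.swap) (simp add: sum_distrib_left)
  finally have "(\<Sum>x\<in>X. f x * poly q (y x)) = 0" by (simp add: 0)
  moreover have "(\<Sum>x\<in>X. f x * poly q (y x)) = (\<Sum>x | x \<in> X \<and> y x = c. f x * poly q (y x))"
    using X by (intro sum.mono_neutral_right) (auto simp: q_def poly_prod)
  moreover have "\<dots> = poly q c * (\<Sum>x | x \<in> X \<and> y x = c. f x)"
    by (auto simp: sum_distrib_left mult.commute intro!: sum.cong)
  moreover have "poly q c \<noteq> 0" using X by (auto simp: q_def poly_prod)
  ultimately show ?thesis by simp
qed

lemma rational_functional_exists: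
  fixes c :: "'k::field_char_0"
  assumes "c \<noteq> 0"
  shows "\<exists>\<phi> :: 'k \<Rightarrow> rat. (\<forall>x y. \<phi> (x + y) = \<phi> x + \<phi> y) \<and> (\<forall>q x. \<phi> (of_rat q * x) = q * \<phi> x) \<and> \<phi> c \<noteq> 0"
proof -
  interpret vector_space_pair "\<lambda>q x. of_rat q * x :: 'k" "(*) :: rat \<Rightarrow> rat \<Rightarrow> rat"
    by unfold_locales (auto simp: algebra_simps of_rat_add of_rat_mult)
  have "vs1.independent {c}" using assms by simp
  from linear_independent_extend[OF this, of "\<lambda>_. 1"] obtain \<phi> where
    "Vector_Spaces.linear (\<lambda>q x. of_rat q * x :: 'k) (*) \<phi>" "\<phi> c = 1" by auto
  then show ?thesis unfolding Vector_Spaces.linear_iff by (intro exI[of _ \<phi>]) auto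
qed

text \<open>The fields of definition of the eigenvalues are uncontrolled, so positivity is obtained from a
  \<open>\<rat>\<close>-linear functional \<open>\<phi>\<close> instead of an absolute value. Put \<open>d = a\<^sup>2 b\<close> and choose square roots \<open>R\<close>; then
  \<open>a R(b) = \<plusminus> R(d)\<close>. With \<open>e\<close> denoting this sign, the first relations say that \<open>\<Sum> e R(d)\<close> vanishes on
  each fibre of \<open>b\<close>, and the second ones that \<open>\<Sum> (e R(b) - R(d))\<close> vanishes on each fibre of \<open>d\<close> with
  \<open>d \<noteq> 0\<close>. The coefficients are rational, so \<open>\<phi>\<close> can be applied to the summands. Grouping
  \<open>\<Sum> e \<phi>(R(d)) \<phi>(R(b))\<close> by \<open>b\<close> gives \<open>0\<close>, and grouping it by \<open>d\<close> gives \<open>\<Sum> \<phi>(R(d))\<^sup>2\<close>. So \<open>\<phi>\<close> kills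
  every \<open>R(d)\<close>, but \<open>d = 1\<close> at \<open>x0\<close> and \<open>\<phi>\<close> can be chosen nonzero at \<open>R(1)\<close>.\<close>

lemma eigenvalue_system_unsolvable:
  fixes a b :: "'x \<Rightarrow> 'k::{alg_closed_field, field_char_0}"
  assumes X: "finite X"
    and 1: "\<And>i. (\<Sum>x\<in>X. a x * b x ^ i) = 0"
    and 2: "\<And>j. (\<Sum>x\<in>X. a x * b x * (a x ^ 2 * b x) ^ j) = (\<Sum>x\<in>X. (a x ^ 2 * b x) ^ Suc j)"
    and x0: "x0 \<in> X" "a x0 = 1" "b x0 = 1"
  shows False
proof -
  define d where "d x = a x ^ 2 * b x" for x
  define R where "R y = (SOME r. r ^ 2 = y)" for y :: 'k
  have R: "R y ^ 2 = y" for y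
    unfolding R_def using nth_root_exists[of 2 y] by (auto intro: someI_ex)
  have R0: "R y = 0 \<longleftrightarrow> y = 0" for y using R[of y] by auto
  \<comment> \<open>outside \<open>d = 0\<close> this is the sign in \<open>a R(b) = \<plusminus> R(d)\<close>; where \<open>d = 0\<close> both sides vanish\<close>
  define e :: "'x \<Rightarrow> rat" where "e x = (if a x * R (b x) = R (d x) then 1 else -1)" for x
  have e: "a x * R (b x) = of_rat (e x) * R (d x)" for x
  proof -
    have "(a x * R (b x)) ^ 2 = R (d x) ^ 2" by (simp add: power_mult_distrib R d_def)
    then show ?thesis by (auto simp: power2_eq_iff e_def of_rat_minus)
  qed
  have ab: "a x * b x = of_rat (e x) * R (d x) * R (b x)" for x
    using e[of x] R[of "b x"] by (metis mult.assoc power2_eq_square)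
  obtain \<phi> :: "'k \<Rightarrow> rat" where \<phi>: "\<And>x y. \<phi> (x + y) = \<phi> x + \<phi> y" "\<And>q x. \<phi> (of_rat q * x) = q * \<phi> x"
      "\<phi> (R 1) \<noteq> 0"
    using rational_functional_exists[of "R 1"] R0 by auto
  have \<phi>0: "\<phi> 0 = 0" using \<phi>(1)[of 0 0] by simp
  have \<phi>sum: "\<phi> (\<Sum>x\<in>Y. f x) = (\<Sum>x\<in>Y. \<phi> (f x))" for f :: "'x \<Rightarrow> 'k" and Y
    by (induction Y rule: infinite_finite_induct) (auto simp: \<phi> \<phi>0)
  let ?t = "\<lambda>x. e x * \<phi> (R (d x)) * \<phi> (R (b x))"
  have "(\<Sum>x | x \<in> X \<and> b x = c. ?t x) = 0" for c
  proof -
    have "(\<Sum>x | x \<in> X \<and> b x = c. of_rat (e x) * R (d x)) = (\<Sum>x | x \<in> X \<and> b x = c. a x) * R c"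
      by (simp add: sum_distrib_right flip: e)
    then have "(\<Sum>x | x \<in> X \<and> b x = c. of_rat (e x) * R (d x)) = 0"
      by (simp add: sum_fibre_eq_0[OF X 1])
    then have "\<phi> (\<Sum>x | x \<in> X \<and> b x = c. of_rat (e x) * R (d x)) = 0" by (simp add: \<phi>0)
    then have "(\<Sum>x | x \<in> X \<and> b x = c. e x * \<phi> (R (d x))) * \<phi> (R c) = 0"
      by (simp add: \<phi>sum \<phi>)
    then show ?thesis by (simp add: sum_distrib_right)
  qed
  then have "(\<Sum>c\<in>b ` X. \<Sum>x | x \<in> X \<and> b x = c. ?t x) = 0" by simp
  then have t1: "sum ?t X = 0" by (simp add: sum.image_gen[OF X, of ?t b])
  have "(\<Sum>x | x \<in> X \<and> d x = c. ?t x - \<phi> (R (d x)) ^ 2) = 0" for c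
  proof (cases "c = 0")
    case True
    moreover have "R 0 = 0" using R0 by simp
    ultimately show ?thesis by (auto simp: \<phi>0 intro!: sum.neutral)
  next
    case False
    have "(\<Sum>x\<in>X. (a x * b x - d x) * d x ^ j) = 0" for j
      using 2[of j] by (simp add: d_def[symmetric] sum_subtractf left_diff_distrib)
    from sum_fibre_eq_0[OF X this] have "(\<Sum>x | x \<in> X \<and> d x = c. a x * b x - d x) = 0" .
    moreover have "(\<Sum>x | x \<in> X \<and> d x = c. a x * b x - d x) =
        R c * (\<Sum>x | x \<in> X \<and> d x = c. of_rat (e x) * R (b x) - R c)"
      unfolding sum_distrib_left
      by (intro sum.cong refl) (auto simp: ab algebra_simps R power2_eq_square[symmetric])
    ultimately have "(\<Sum>x | x \<in> X \<and> d x = c. of_rat (e x) * R (b x) + of_rat (-1) * R c) = 0"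
      using False R0 by (simp add: of_rat_minus)
    then have "\<phi> (\<Sum>x | x \<in> X \<and> d x = c. of_rat (e x) * R (b x) + of_rat (-1) * R c) = 0"
      by (simp only: \<phi>0)
    then have "\<phi> (R c) * (\<Sum>x | x \<in> X \<and> d x = c. e x * \<phi> (R (b x)) + (-1) * \<phi> (R c)) = 0"
      unfolding \<phi>sum \<phi> by simp
    then show ?thesis
      unfolding sum_distrib_left
      by (elim trans[rotated]) (auto simp: algebra_simps power2_eq_square intro!: sum.cong)
  qed
  then have "(\<Sum>c\<in>d ` X. \<Sum>x | x \<in> X \<and> d x = c. ?t x - \<phi> (R (d x)) ^ 2) = 0" by simp
  then have "(\<Sum>x\<in>X. ?t x - \<phi> (R (d x)) ^ 2) = 0"
    by (simp add: sum.image_gen[OF X, of "\<lambda>x. ?t x - \<phi> (R (d x)) ^ 2" d])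
  then have "(\<Sum>x\<in>X. \<phi> (R (d x)) ^ 2) = 0" using t1 by (simp add: sum_subtractf)
  then have "\<phi> (R (d x0)) = 0" using X x0(1) by (simp add: sum_nonneg_eq_0_iff)
  then show False using \<phi>(3) x0 by (simp add: d_def)
qed

section \<open>Sweedler calculus\<close>

lemma vector_space_field: "vector_space ((*) :: 'k::field \<Rightarrow> 'k \<Rightarrow> 'k)"
  by unfold_locales (simp_all add: algebra_simps)

context tensor_powers
begin

lemma tensor_in_power: "length vs = n \<Longrightarrow> tensor vs \<in> tensor_power n"
  unfolding tensor_power_def by (auto intro: tensor_space.span_base)

lemma tensor_power_subspace: "tensor_space.subspace (tensor_power n)"
  unfolding tensor_power_def by simp

lemma tensor_power_sum_list:
  "(\<And>p. p \<in> set ps \<Longrightarrow> t p \<in> tensor_power n) \<Longrightarrow> (\<Sum>p\<leftarrow>ps. t p) \<in> tensor_power n"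
  by (induction ps)
    (auto intro: tensor_space.subspace_add tensor_space.subspace_0 tensor_power_subspace)

lemma tensor_lift_zero:
  assumes "vector_space sW" and "multilinear scale sW n F"
  shows "tensor_lift sW n F 0 = 0"
  using tensor_lift_sum[OF assms, of "[]"] by simp

lemma tensor_lift_sum_list:
  assumes "vector_space sW" and "multilinear scale sW n F"
    and "\<And>p. p \<in> set ps \<Longrightarrow> t p \<in> tensor_power n"
  shows "tensor_lift sW n F (\<Sum>p\<leftarrow>ps. t p) = (\<Sum>p\<leftarrow>ps. tensor_lift sW n F (t p))"
  using assms(3)
proof (induction ps)
  case Nil
  show ?case by (simp only: list.map sum_list.Nil tensor_lift_zero[OF assms(1,2)])
next
  case (Cons p ps)
  have "t p \<in> tensor_power n" "(\<Sum>p\<leftarrow>ps. t p) \<in> tensor_power n"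
    using Cons.prems by (auto intro: tensor_power_sum_list)
  then show ?case using Cons
    by (simp only: list.map sum_list.Cons tensor_lift_add[OF assms(1,2)] list.set_intros)
qed

lemma tensor_update:
  assumes "i < length vs"
  shows "Vector_Spaces.linear scale tscale (\<lambda>v. tensor (vs[i := v]))"
  unfolding Vector_Spaces.linear_iff
proof (intro conjI allI)
  show "vector_space scale" "vector_space tscale"
    by (rule vector_space_axioms, rule tensor_space.vector_space_axioms)
  show "tensor (vs[i := x + y]) = tensor (vs[i := x]) + tensor (vs[i := y])" for x y
    using assms by (auto simp: tensor_def fun_eq_iff multilinear_def Vector_Spaces.linear_iff)
  show "tensor (vs[i := scale c x]) = tscale c (tensor (vs[i := x]))" for c x
    using assms by (auto simp: tensor_def tscale_def fun_eq_iff multilinear_def Vector_Spaces.linear_iff)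
qed

lemma multilinear_tensor: "multilinear scale tscale n tensor"
  by (auto simp: multilinear_def tensor_update)

end

text \<open>Every rule about Sweedler sums needs multilinearity of the summand. The collection \<open>lin\<close> contains the
  closure properties by which all these side conditions are proved.\<close>

named_theorems lin

context hopf_algebra
begin

abbreviation linH :: "('k \<Rightarrow> 'w::ab_group_add \<Rightarrow> 'w) \<Rightarrow> ('h \<Rightarrow> 'w) \<Rightarrow> bool" where
  "linH s f \<equiv> Vector_Spaces.linear scale s f"

definition bilinH :: "('k \<Rightarrow> 'w::ab_group_add \<Rightarrow> 'w) \<Rightarrow> ('h \<Rightarrow> 'h \<Rightarrow> 'w) \<Rightarrow> bool" where
  "bilinH s F \<longleftrightarrow> (\<forall>b. linH s (\<lambda>a. F a b)) \<and> (\<forall>a. linH s (\<lambda>b. F a b))"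

lemma [lin]:
  "(\<And>b. linH s (\<lambda>a. F a b)) \<Longrightarrow> (\<And>a. linH s (\<lambda>b. F a b)) \<Longrightarrow> bilinH s F"
  by (simp add: bilinH_def)

text \<open>A chosen presentation of the coproduct as a sum of pure tensors; \<open>sw F h\<close> below is the Sweedler sum
  \<open>\<Sum> F(h\<^sub>1, h\<^sub>2)\<close> formed with it. For bilinear \<open>F\<close> it is independent of the choice, but linearity in \<open>F\<close> and
  interchange of two sums hold for arbitrary \<open>F\<close>.\<close>

definition cop :: "'h \<Rightarrow> ('h \<times> 'h) list" where
  "cop h = (SOME ps. \<Delta> h = (\<Sum>(a, b)\<leftarrow>ps. tensor [a, b]))"

definition sw :: "('h \<Rightarrow> 'h \<Rightarrow> 'w::comm_monoid_add) \<Rightarrow> 'h \<Rightarrow> 'w" where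
  "sw F h = (\<Sum>(a, b)\<leftarrow>cop h. F a b)"

lemma tscale_tensor: "tscale c (tensor [a, b]) = tensor [scale c a, b]"
  using tensor_update[of 0 "[a, b]"] by (simp add: Vector_Spaces.linear_iff)

lemma comult_cop: "\<Delta> h = (\<Sum>(a, b)\<leftarrow>cop h. tensor [a, b])"
proof -
  obtain cs where cs: "\<forall>(c, vs) \<in> set cs. length vs = 2" "\<Delta> h = (\<Sum>(c, vs)\<leftarrow>cs. tscale c (tensor vs))"
    using tensor_power_expand[OF comult_in_tensor_power[of h]] by blast
  have "(\<Sum>(c, vs)\<leftarrow>cs. tscale c (tensor vs)) =
      (\<Sum>(a, b)\<leftarrow>map (\<lambda>(c, vs). (scale c (vs ! 0), vs ! 1)) cs. tensor [a, b])"
    using cs(1)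
  proof (induction cs)
    case (Cons e cs)
    obtain c vs where e: "e = (c, vs)" by force
    then obtain a b where "vs = [a, b]" using Cons.prems by (auto simp: numeral_2_eq_2 length_Suc_conv)
    then show ?case using Cons e by (simp add: tscale_tensor)
  qed simp
  with cs(2) have "\<Delta> h = (\<Sum>(a, b)\<leftarrow>map (\<lambda>(c, vs). (scale c (vs ! 0), vs ! 1)) cs. tensor [a, b])"
    by (rule trans)
  then show ?thesis unfolding cop_def by (rule someI)
qed

lemma sw_cong: "(\<And>a b. F a b = G a b) \<Longrightarrow> sw F h = sw G h"
  by (simp add: sw_def)

lemma sw_swap:
  fixes F :: "'h \<Rightarrow> 'h \<Rightarrow> 'h \<Rightarrow> 'h \<Rightarrow> 'w::comm_monoid_add"
  shows "sw (\<lambda>a b. sw (\<lambda>c d. F a b c d) g) h = sw (\<lambda>c d. sw (\<lambda>a b. F a b c d) h) g"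
proof -
  have "(\<Sum>p\<leftarrow>ps. \<Sum>q\<leftarrow>qs. G p q) = (\<Sum>q\<leftarrow>qs. \<Sum>p\<leftarrow>ps. G p q)"
    for G :: "'h \<times> 'h \<Rightarrow> 'h \<times> 'h \<Rightarrow> 'w" and ps qs
    by (induction ps) (simp_all add: sum_list_addf)
  from this[of "\<lambda>p q. F (fst p) (snd p) (fst q) (snd q)" "cop g" "cop h"] show ?thesis
    by (simp add: sw_def case_prod_unfold)
qed

lemma sw_add: "sw (\<lambda>a b. F a b + G a b) h = sw F h + sw G h"
  by (simp add: sw_def case_prod_unfold sum_list_addf)

lemma sw_sum:
  fixes F :: "'i \<Rightarrow> 'h \<Rightarrow> 'h \<Rightarrow> 'w::comm_monoid_add"
  shows "sw (\<lambda>a b. \<Sum>i\<in>I. F i a b) h = (\<Sum>i\<in>I. sw (F i) h)"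
proof -
  have "(\<Sum>p\<leftarrow>ps. \<Sum>i\<in>I. G i p) = (\<Sum>i\<in>I. \<Sum>p\<leftarrow>ps. G i p)" for G :: "'i \<Rightarrow> 'h \<times> 'h \<Rightarrow> 'w" and ps
    by (induction ps) (simp_all add: sum.distrib)
  then show ?thesis by (simp add: sw_def case_prod_unfold)
qed

lemma sw_apply:
  assumes "Vector_Spaces.linear s t g"
  shows "g (sw F h) = sw (\<lambda>a b. g (F a b)) h"
proof -
  interpret g: Vector_Spaces.linear s t g by fact
  have "g (\<Sum>p\<leftarrow>ps. F (fst p) (snd p)) = (\<Sum>p\<leftarrow>ps. g (F (fst p) (snd p)))" for ps
    by (induction ps) (simp_all add: g.add)
  then show ?thesis by (simp add: sw_def case_prod_unfold)
qed

lemma tensor_lift_comult: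
  assumes "vector_space sW" and "multilinear scale sW 2 F"
  shows "tensor_lift sW 2 F (\<Delta> h) = sw (\<lambda>a b. F [a, b]) h"
proof -
  have "tensor_lift sW 2 F (\<Sum>p\<leftarrow>cop h. tensor [fst p, snd p]) =
      (\<Sum>p\<leftarrow>cop h. tensor_lift sW 2 F (tensor [fst p, snd p]))"
    by (intro tensor_lift_sum_list assms tensor_in_power) simp
  also have "\<dots> = (\<Sum>p\<leftarrow>cop h. F [fst p, snd p])"
    by (simp add: tensor_lift_tensor[OF assms])
  finally show ?thesis by (simp add: comult_cop[of h] sw_def case_prod_unfold)
qed

lemma linear_target: "Vector_Spaces.linear s t f \<Longrightarrow> vector_space t"
  by (simp add: Vector_Spaces.linear_iff)

lemma bilinH_target: "bilinH s F \<Longrightarrow> vector_space s"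
  by (auto simp: bilinH_def intro: linear_target)

lemma multilinear_bilinH: "bilinH s F \<Longrightarrow> multilinear scale s 2 (\<lambda>xs. F (xs ! 0) (xs ! 1))"
  by (auto simp: multilinear_def bilinH_def numeral_2_eq_2 length_Suc_conv less_Suc_eq)

lemma tensor_lift_sw:
  "bilinH s F \<Longrightarrow> tensor_lift s 2 (\<lambda>xs. F (xs ! 0) (xs ! 1)) (\<Delta> h) = sw F h"
  using tensor_lift_comult[OF bilinH_target multilinear_bilinH] by simp

lemma linH_sw: "bilinH s F \<Longrightarrow> linH s (sw F)"
  unfolding Vector_Spaces.linear_iff
proof (intro conjI allI)
  assume F: "bilinH s F"
  note \<Delta> = comult_linear[unfolded Vector_Spaces.linear_iff]
  note lift = tensor_lift_sw[OF F, symmetric]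
  show "vector_space scale" by (rule vector_space_axioms)
  show "vector_space s" by (rule bilinH_target[OF F])
  show "sw F (x + y) = sw F x + sw F y" for x y
    unfolding lift using \<Delta>
      tensor_lift_add[OF bilinH_target[OF F] multilinear_bilinH[OF F] comult_in_tensor_power comult_in_tensor_power]
    by simp
  show "sw F (scale c x) = s c (sw F x)" for c x
    unfolding lift using \<Delta>
      tensor_lift_scale[OF bilinH_target[OF F] multilinear_bilinH[OF F] comult_in_tensor_power]
    by simp
qed

lemma lin_comp:
  "Vector_Spaces.linear s t g \<Longrightarrow> Vector_Spaces.linear r s f \<Longrightarrow> Vector_Spaces.linear r t (\<lambda>x. g (f x))"
  using Vector_Spaces.linear_compose[of r s f t g] by (simp add: o_def)

lemma bilin_1: "bilinH s F \<Longrightarrow> linH scale f \<Longrightarrow> linH s (\<lambda>x. F (f x) b)"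
  by (rule lin_comp[of scale s "\<lambda>a. F a b"]) (auto simp: bilinH_def)

lemma bilin_2: "bilinH s F \<Longrightarrow> linH scale f \<Longrightarrow> linH s (\<lambda>x. F a (f x))"
  by (rule lin_comp[of scale s "F a"]) (auto simp: bilinH_def)

lemma [lin]: "bilinH s F \<Longrightarrow> linH scale f \<Longrightarrow> linH s (\<lambda>x. sw F (f x))"
  by (rule lin_comp[OF linH_sw])

lemma lin_sw_par [lin]:
  assumes "\<And>a b. linH s (\<lambda>x. F x a b)"
  shows "linH s (\<lambda>x. sw (\<lambda>a b. F x a b) h)"
  unfolding Vector_Spaces.linear_iff
proof (intro conjI allI)
  note F = assms[unfolded Vector_Spaces.linear_iff]
  show "vector_space scale" "vector_space s" using F by auto
  show "sw (F (x + y)) h = sw (F x) h + sw (F y) h" for x y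
    unfolding sw_add[symmetric] by (rule sw_cong) (use F in blast)
  interpret s: vector_space s using F by blast
  show "sw (F (scale c x)) h = s c (sw (F x) h)" for c x
    unfolding sw_apply[OF s.linear_scale_self[of c]] by (rule sw_cong) (use F in blast)
qed

lemma lin_ident [lin]: "linH scale (\<lambda>x. x)"
  by (rule linear_ident)

lemma [lin]: "linH scale f \<Longrightarrow> linH scale (\<lambda>x. f x * c)"
  by (simp add: Vector_Spaces.linear_iff distrib_right scale_mult_left)

lemma [lin]: "linH scale f \<Longrightarrow> linH scale (\<lambda>x. c * f x)"
  by (simp add: Vector_Spaces.linear_iff distrib_left scale_mult_right)

lemma [lin]: "linH scale f \<Longrightarrow> linH scale (\<lambda>x. S (f x))"
  by (rule lin_comp[OF antipode_linear])

lemma [lin]: "linH scale f \<Longrightarrow> linH (*) (\<lambda>x. \<epsilon> (f x))"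
  by (rule lin_comp[OF counit_linear])

lemma lin_scale_1: "vector_space s \<Longrightarrow> linH (*) f \<Longrightarrow> linH s (\<lambda>x. s (f x) w)"
  by (rule lin_comp[OF vector_space.linear_scale_left])

lemma lin_scale_2: "linH s f \<Longrightarrow> linH s (\<lambda>x. s c (f x))"
  by (rule lin_comp[OF vector_space.linear_scale_self[OF linear_target]])

lemmas bilin_lin = bilin_1 bilin_2 lin_scale_1[OF bilinH_target]

lemmas [lin] = lin_scale_1[OF vector_space_axioms] lin_scale_1[OF vector_space_field]
  lin_scale_2[of scale] lin_scale_2[of "(*)"]

lemma [lin]:
  "linH scale f \<Longrightarrow> linH tscale (\<lambda>x. tensor [f x, b])"
  "linH scale f \<Longrightarrow> linH tscale (\<lambda>x. tensor [a, f x])"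
  "linH scale f \<Longrightarrow> linH tscale (\<lambda>x. tensor [f x, b, c])"
  "linH scale f \<Longrightarrow> linH tscale (\<lambda>x. tensor [a, f x, c])"
  "linH scale f \<Longrightarrow> linH tscale (\<lambda>x. tensor [a, b, f x])"
  using lin_comp[OF tensor_update[of 0 "[0,b]"]]
    lin_comp[OF tensor_update[of 1 "[a,0]"]]
    lin_comp[OF tensor_update[of 0 "[0,b,c]"]] lin_comp[OF tensor_update[of 1 "[a,0,c]"]]
    lin_comp[OF tensor_update[of 2 "[a,b,0]"]] by simp_all

lemma tensor_lift_sw2:
  assumes "bilinH tscale (\<lambda>x y. sw (F x y) (G x y))" and "\<And>x y. bilinH tscale (F x y)"
  shows "tensor_lift tscale 2 (\<lambda>xs. tensor_lift tscale 2 (\<lambda>ys. F (xs ! 0) (xs ! 1) (ys ! 0) (ys ! 1))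
    (\<Delta> (G (xs ! 0) (xs ! 1)))) (\<Delta> h) = sw (\<lambda>x y. sw (F x y) (G x y)) h"
  unfolding tensor_lift_sw[OF assms(2)] by (rule tensor_lift_sw[OF assms(1)])

lemma sw_coassoc:
  assumes "\<And>b c. linH s (\<lambda>a. F a b c)" "\<And>a c. linH s (\<lambda>b. F a b c)" "\<And>a b. linH s (\<lambda>c. F a b c)"
  shows "sw (\<lambda>x c. sw (\<lambda>a b. F a b c) x) h = sw (\<lambda>a x. sw (\<lambda>b c. F a b c) x) h"
proof -
  have vs: "vector_space s" using assms(1) linear_target by blast
  define G where "G xs = F (xs ! 0) (xs ! 1) (xs ! 2)" for xs
  have ml: "multilinear scale s 3 G"
    using assms by (auto simp: multilinear_def G_def numeral_3_eq_3 length_Suc_conv less_Suc_eq)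
  have eq: "sw (\<lambda>x c. sw (\<lambda>a b. tensor [a, b, c]) x) h = sw (\<lambda>a x. sw (\<lambda>b c. tensor [a, b, c]) x) h"
    by (rule trans[OF sym[OF tensor_lift_sw2[where F = "\<lambda>x y a b. tensor [a, b, y]" and G = "\<lambda>x y. x"]]
          trans[OF coassoc tensor_lift_sw2[where F = "\<lambda>x y a b. tensor [x, a, b]" and G = "\<lambda>x y. y"]]])
      (rule lin)+
  have *: "tensor_lift s 3 G (sw (\<lambda>x y. sw (T x y) (U x y)) h) = sw (\<lambda>x y. sw (\<lambda>a b. tensor_lift s 3 G (T x y a b)) (U x y)) h"
    if T: "\<And>x y a b. T x y a b \<in> tensor_power 3" for T U
    unfolding sw_def case_prod_unfold
    by (subst tensor_lift_sum_list[OF vs ml], intro tensor_power_sum_list T,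
        subst tensor_lift_sum_list[OF vs ml T], rule refl)
  have "tensor_lift s 3 G (tensor [a, b, c]) = F a b c" for a b c
    by (simp add: tensor_lift_tensor[OF vs ml] G_def)
  with arg_cong[OF eq, of "tensor_lift s 3 G"] show ?thesis
    by (simp add: * tensor_in_power)
qed

lemma sw_mult:
  assumes F: "bilinH s F"
  shows "sw F (g * h) = sw (\<lambda>a b. sw (\<lambda>c d. F (a * c) (b * d)) h) g"
proof -
  let ?G = "\<lambda>xs. F (xs ! 0) (xs ! 1)"
  note vs = bilinH_target[OF F] and ml = multilinear_bilinH[OF F]
  have "\<Delta> (g * h) = sw (\<lambda>a b. sw (\<lambda>c d. tensor [a * c, b * d]) h) g"
    by (rule trans[OF comult_mult
          tensor_lift_sw2[where F = "\<lambda>x y a b. tensor [x * a, y * b]" and G = "\<lambda>x y. h"]])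
      (rule lin)+
  then have "sw F (g * h) = tensor_lift s 2 ?G (sw (\<lambda>a b. sw (\<lambda>c d. tensor [a * c, b * d]) h) g)"
    using tensor_lift_sw[OF F] by metis
  also have "\<dots> = sw (\<lambda>a b. sw (\<lambda>c d. tensor_lift s 2 ?G (tensor [a * c, b * d])) h) g"
    unfolding sw_def case_prod_unfold
    by (subst tensor_lift_sum_list[OF vs ml], intro tensor_power_sum_list tensor_in_power, simp,
        subst tensor_lift_sum_list[OF vs ml tensor_in_power], simp, rule refl)
  also have "\<dots> = sw (\<lambda>a b. sw (\<lambda>c d. F (a * c) (b * d)) h) g"
    by (subst tensor_lift_tensor[OF vs ml]) simp_all
  finally show ?thesis .
qed

lemma sw_one:
  assumes F: "bilinH s F"
  shows "sw F 1 = F 1 1"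
proof -
  have "tensor_lift s 2 (\<lambda>xs. F (xs ! 0) (xs ! 1)) (tensor [1, 1]) = F 1 1"
    by (subst tensor_lift_tensor[OF bilinH_target[OF F] multilinear_bilinH[OF F]]) simp_all
  then show ?thesis using tensor_lift_sw[OF F, of 1] by (simp only: comult_one)
qed

lemma sw_counit_1:
  assumes f: "linH s f"
  shows "sw (\<lambda>a b. s (\<epsilon> a) (f b)) h = f h"
proof -
  have "sw (\<lambda>a b. scale (\<epsilon> a) b) h = h"
    by (rule trans[OF sym[OF tensor_lift_sw[where F = "\<lambda>a b. scale (\<epsilon> a) b"]] counit_left]) (rule lin)+
  from arg_cong[OF this, of f] show ?thesis
    using f by (simp add: sw_apply[OF f] Vector_Spaces.linear_iff)
qed

lemma sw_counit_2:
  assumes f: "linH s f"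
  shows "sw (\<lambda>a b. s (\<epsilon> b) (f a)) h = f h"
proof -
  have "sw (\<lambda>a b. scale (\<epsilon> b) a) h = h"
    by (rule trans[OF sym[OF tensor_lift_sw[where F = "\<lambda>a b. scale (\<epsilon> b) a"]] counit_right]) (rule lin)+
  from arg_cong[OF this, of f] show ?thesis
    using f by (simp add: sw_apply[OF f] Vector_Spaces.linear_iff)
qed

lemma sw_antipode_1:
  assumes f: "linH s f"
  shows "sw (\<lambda>a b. f (S a * b)) h = s (\<epsilon> h) (f 1)"
proof -
  have "sw (\<lambda>a b. S a * b) h = scale (\<epsilon> h) 1"
    by (rule trans[OF sym[OF tensor_lift_sw[where F = "\<lambda>a b. S a * b"]] antipode_left]) (rule lin)+
  from arg_cong[OF this, of f] show ?thesis
    using f by (simp add: sw_apply[OF f] Vector_Spaces.linear_iff)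
qed

lemma sw_antipode_2:
  assumes f: "linH s f"
  shows "sw (\<lambda>a b. f (a * S b)) h = s (\<epsilon> h) (f 1)"
proof -
  have "sw (\<lambda>a b. a * S b) h = scale (\<epsilon> h) 1"
    by (rule trans[OF sym[OF tensor_lift_sw[where F = "\<lambda>a b. a * S b"]] antipode_right]) (rule lin)+
  from arg_cong[OF this, of f] show ?thesis
    using f by (simp add: sw_apply[OF f] Vector_Spaces.linear_iff)
qed

section \<open>The antipode\<close>

lemma antipode_one: "S 1 = 1"
proof -
  have "sw (\<lambda>a b. S a * b) 1 = S 1 * 1" by (rule sw_one) (rule lin)+
  moreover have "sw (\<lambda>a b. S a * b) 1 = scale (\<epsilon> 1) 1" by (rule sw_antipode_1[OF lin_ident])
  ultimately show ?thesis by (simp add: counit_one)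
qed

lemma counit_antipode: "\<epsilon> (S h) = \<epsilon> h"
proof -
  have "sw (\<lambda>a b. \<epsilon> (S a * b)) h = \<epsilon> h * \<epsilon> 1" by (rule sw_antipode_1) (rule lin)+
  moreover have "sw (\<lambda>a b. \<epsilon> (S a * b)) h = sw (\<lambda>a b. \<epsilon> b * \<epsilon> (S a)) h"
    by (rule sw_cong) (simp add: counit_mult)
  moreover have "\<dots> = \<epsilon> (S h)" by (rule sw_counit_2[where f = "\<lambda>a. \<epsilon> (S a)"]) (rule lin)+
  ultimately show ?thesis by (simp add: counit_one)
qed

text \<open>Both sides equal \<open>\<Sum> S(h\<^sub>1) S(g\<^sub>1) g\<^sub>2 h\<^sub>2 S(g\<^sub>3 h\<^sub>3)\<close>: collapse either the first two factors of each kind or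
  the last two.\<close>

lemma antipode_mult: "S (g * h) = S h * S g"
proof -
  \<comment> \<open>the arguments are split as \<open>(a\<^sub>1 \<otimes> a\<^sub>2) \<otimes> a\<^sub>3\<close> and \<open>(b\<^sub>1 \<otimes> b\<^sub>2) \<otimes> b\<^sub>3\<close>\<close>
  define X where "X = sw (\<lambda>x a3. sw (\<lambda>a1 a2. sw (\<lambda>y b3. sw (\<lambda>b1 b2. S b1 * S a1 * a2 * b2 * S (a3 * b3)) y) h) x) g"
  have "X = sw (\<lambda>x a3. sw (\<lambda>a1 a2. sw (\<lambda>y b3. sw (\<lambda>b1 b2. S b1 * (S a1 * a2) * b2 * S (a3 * b3)) y) h) x) g"
    by (simp add: X_def mult.assoc)
  also have "\<dots> = sw (\<lambda>x a3. scale (\<epsilon> x) (sw (\<lambda>y b3. sw (\<lambda>b1 b2. S b1 * 1 * b2 * S (a3 * b3)) y) h)) g"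
    by (intro sw_cong sw_antipode_1[where f = "\<lambda>z. sw (\<lambda>y b3. sw (\<lambda>b1 b2. S b1 * z * b2 * S (c * b3)) y) h" for c])
      (rule lin)+
  also have "\<dots> = sw (\<lambda>y b3. sw (\<lambda>b1 b2. (S b1 * b2) * S (g * b3)) y) h"
    unfolding mult_1_right
    by (rule sw_counit_1[where f = "\<lambda>a3. sw (\<lambda>y b3. sw (\<lambda>b1 b2. S b1 * b2 * S (a3 * b3)) y) h"]) (rule lin)+
  also have "\<dots> = sw (\<lambda>y b3. scale (\<epsilon> y) (1 * S (g * b3))) h"
    by (intro sw_cong sw_antipode_1[where f = "\<lambda>z. z * S (g * b)" for b]) (rule lin)+
  also have "\<dots> = 1 * S (g * h)"
    by (rule sw_counit_1[where f = "\<lambda>b. 1 * S (g * b)"]) (rule lin)+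
  finally have 1: "X = S (g * h)" by simp
  have "X = sw (\<lambda>a1 x. sw (\<lambda>a2 a3. sw (\<lambda>y b3. sw (\<lambda>b1 b2. S b1 * S a1 * a2 * b2 * S (a3 * b3)) y) h) x) g"
    unfolding X_def by (rule sw_coassoc) (rule lin)+
  also have "\<dots> = sw (\<lambda>a1 x. sw (\<lambda>a2 a3. sw (\<lambda>b1 y. sw (\<lambda>b2 b3. S b1 * S a1 * ((a2 * b2) * S (a3 * b3))) y) h) x) g"
    unfolding mult.assoc[symmetric] by (intro sw_cong sw_coassoc) (rule lin)+
  also have "\<dots> = sw (\<lambda>a1 x. sw (\<lambda>b1 y. sw (\<lambda>a2 a3. sw (\<lambda>b2 b3. S b1 * S a1 * ((a2 * b2) * S (a3 * b3))) y) x) h) g"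
    by (intro sw_cong sw_swap)
  also have "\<dots> = sw (\<lambda>a1 x. sw (\<lambda>b1 y. sw (\<lambda>u v. S b1 * S a1 * (u * S v)) (x * y)) h) g"
    by (intro sw_cong sw_mult[symmetric]) (rule lin)+
  also have "\<dots> = sw (\<lambda>a1 x. sw (\<lambda>b1 y. scale (\<epsilon> (x * y)) (S b1 * S a1 * 1)) h) g"
    by (intro sw_cong sw_antipode_2) (rule lin)+
  also have "\<dots> = sw (\<lambda>a1 x. sw (\<lambda>b1 y. scale (\<epsilon> y) (scale (\<epsilon> x) (S b1 * S a1))) h) g"
    by (simp add: counit_mult mult.commute)
  also have "\<dots> = sw (\<lambda>a1 x. scale (\<epsilon> x) (S h * S a1)) g"
    by (intro sw_cong sw_counit_2[where f = "\<lambda>b. scale (\<epsilon> x) (S b * S a)" for x a]) (rule lin)+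
  also have "\<dots> = S h * S g"
    by (rule sw_counit_2) (rule lin)+
  finally show ?thesis using 1 by simp
qed

text \<open>Both sides equal the sum of \<open>F(u h\<^sub>2 S(h\<^sub>5), v h\<^sub>3 S(h\<^sub>4))\<close> with \<open>u \<otimes> v = \<Delta>(S(h\<^sub>1))\<close>: the factors
  \<open>S(h\<^sub>1) h\<^sub>2\<close> collapse since \<open>\<Delta>\<close> is multiplicative, and on the other hand \<open>h\<^sub>3 S(h\<^sub>4)\<close> and then \<open>h\<^sub>2 S(h\<^sub>5)\<close> do.\<close>

lemma sw_antipode:
  assumes F: "bilinH s F"
  shows "sw F (S h) = sw (\<lambda>a b. F (S b) (S a)) h"
proof -
  note [lin] = bilin_lin[OF F] lin_scale_2[of s]
  \<comment> \<open>the argument is split as \<open>(h\<^sub>1 \<otimes> (h\<^sub>2 \<otimes> h\<^sub>3)) \<otimes> (h\<^sub>4 \<otimes> h\<^sub>5)\<close>\<close>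
  define X where "X = sw (\<lambda>p q. sw (\<lambda>h1 r. sw (\<lambda>h2 h3. sw (\<lambda>h4 h5.
    sw (\<lambda>u v. F (u * h2 * S h5) (v * h3 * S h4)) (S h1)) q) r) p) h"
  have "X = sw (\<lambda>p q. sw (\<lambda>h1 r. sw (\<lambda>h2 h3.
    sw (\<lambda>u v. sw (\<lambda>h4 h5. F (u * h2 * S h5) (v * h3 * S h4)) q) (S h1)) r) p) h"
    unfolding X_def by (intro sw_cong sw_swap)
  also have "\<dots> = sw (\<lambda>p q. sw (\<lambda>h1 r. sw (\<lambda>u v. sw (\<lambda>h2 h3.
    sw (\<lambda>h4 h5. F (u * h2 * S h5) (v * h3 * S h4)) q) r) (S h1)) p) h"
    by (intro sw_cong sw_swap)
  also have "\<dots> = sw (\<lambda>p q. sw (\<lambda>h1 r. sw (\<lambda>u v. sw (\<lambda>h4 h5. F (u * S h5) (v * S h4)) q) (S h1 * r)) p) h"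
    by (intro sw_cong sw_mult[symmetric, where F = "\<lambda>x y. sw (\<lambda>h4 h5. F (x * S h5) (y * S h4)) q" for q])
      (rule lin)+
  also have "\<dots> = sw (\<lambda>p q. s (\<epsilon> p) (sw (\<lambda>u v. sw (\<lambda>h4 h5. F (u * S h5) (v * S h4)) q) 1)) h"
    by (intro sw_cong sw_antipode_1[where f = "\<lambda>z. sw (\<lambda>u v. sw (\<lambda>h4 h5. F (u * S h5) (v * S h4)) q) z" for q]) (rule lin)+
  also have "\<dots> = sw (\<lambda>u v. sw (\<lambda>h4 h5. F (u * S h5) (v * S h4)) h) 1"
    by (rule sw_counit_1[where f = "\<lambda>q. sw (\<lambda>u v. sw (\<lambda>h4 h5. F (u * S h5) (v * S h4)) q) 1"]) (rule lin)+
  also have "\<dots> = sw (\<lambda>h4 h5. F (1 * S h5) (1 * S h4)) h"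
    by (rule sw_one) (rule lin)+
  finally have 1: "X = sw (\<lambda>a b. F (S b) (S a)) h" by simp
  have "X = sw (\<lambda>h1 w. sw (\<lambda>r q. sw (\<lambda>h2 h3. sw (\<lambda>h4 h5.
    sw (\<lambda>u v. F (u * h2 * S h5) (v * h3 * S h4)) (S h1)) q) r) w) h"
    unfolding X_def by (rule sw_coassoc) (rule lin)+
  also have "\<dots> = sw (\<lambda>h1 w. sw (\<lambda>h2 t. sw (\<lambda>h3 q. sw (\<lambda>h4 h5.
    sw (\<lambda>u v. F (u * h2 * S h5) (v * h3 * S h4)) (S h1)) q) t) w) h"
    by (intro sw_cong sw_coassoc) (rule lin)+
  also have "\<dots> = sw (\<lambda>h1 w. sw (\<lambda>h2 t. sw (\<lambda>x h5. sw (\<lambda>h3 h4.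
    sw (\<lambda>u v. F (u * h2 * S h5) (v * h3 * S h4)) (S h1)) x) t) w) h"
    by (intro sw_cong sw_coassoc[symmetric]) (rule lin)+
  also have "\<dots> = sw (\<lambda>h1 w. sw (\<lambda>h2 t. sw (\<lambda>x h5. s (\<epsilon> x)
    (sw (\<lambda>u v. F (u * h2 * S h5) (v * 1)) (S h1))) t) w) h"
    unfolding mult.assoc
    by (intro sw_cong sw_antipode_2[where f = "\<lambda>z. sw (\<lambda>u v. F (u * (h2 * S h5)) (v * z)) (S h1)" for h1 h2 h5]) (rule lin)+
  also have "\<dots> = sw (\<lambda>h1 w. sw (\<lambda>h2 t. sw (\<lambda>u v. F (u * h2 * S t) (v * 1)) (S h1)) w) h"
    by (intro sw_cong sw_counit_1[where f = "\<lambda>h5. sw (\<lambda>u v. F (u * h2 * S h5) (v * 1)) (S h1)" for h1 h2]) (rule lin)+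
  also have "\<dots> = sw (\<lambda>h1 w. s (\<epsilon> w) (sw (\<lambda>u v. F (u * 1) (v * 1)) (S h1))) h"
    unfolding mult.assoc
    by (intro sw_cong sw_antipode_2[where f = "\<lambda>z. sw (\<lambda>u v. F (u * z) (v * 1)) (S h1)" for h1]) (rule lin)+
  also have "\<dots> = sw (\<lambda>u v. F (u * 1) (v * 1)) (S h)"
    by (rule sw_counit_2) (rule lin)+
  finally show ?thesis using 1 by simp
qed

end

section \<open>The integral of a semisimple Hopf algebra\<close>

context hopf_algebra
begin

text \<open>A complement of the kernel of the counit is spanned by a normalized left integral \<open>x\<close>. It is a right
  integral because the left ideal \<open>x \<cdot> ker \<epsilon>\<close> has square zero, and a semisimple algebra has no such ideal
  other than \<open>0\<close>.\<close>

lemma integral_exists: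
  assumes ss: semisimple
  shows "\<exists>x. two_sided_integral x \<and> \<epsilon> x = 1"
proof -
  interpret \<epsilon>: Vector_Spaces.linear scale "(*)" \<epsilon> by (rule counit_linear)
  let ?K = "{x. \<epsilon> x = 0}"
  have "left_ideal ?K"
    by (auto simp: left_ideal_def counit_mult intro: \<epsilon>.subspace_kernel)
  then obtain L where L: "left_ideal L" "?K \<inter> L = {0}" "\<And>h. \<exists>x\<in>?K. \<exists>y\<in>L. h = x + y"
    using ss[unfolded semisimple_def, rule_format, of ?K] by auto
  obtain e x where x: "\<epsilon> e = 0" "x \<in> L" "1 = e + x" using L(3)[of 1] by auto
  have "\<epsilon> (e + x) = 1" unfolding x(3)[symmetric] by (rule counit_one)
  then have ex: "\<epsilon> x = 1" using x(1) by (simp add: \<epsilon>.add)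
  have left: "h * x = scale (\<epsilon> h) x" for h
  proof -
    have "h * x - scale (\<epsilon> h) x \<in> L"
      using L(1) x(2) by (auto simp: left_ideal_def intro: subspace_diff subspace_scale)
    moreover have "h * x - scale (\<epsilon> h) x \<in> ?K"
      by (simp add: \<epsilon>.diff counit_mult \<epsilon>.scale)
    ultimately have "h * x - scale (\<epsilon> h) x \<in> {0}" using L(2) by blast
    then show ?thesis by simp
  qed
  \<comment> \<open>the ideal of square zero\<close>
  let ?N = "(\<lambda>y. x * y) ` ?K"
  interpret lx: Vector_Spaces.linear scale scale "\<lambda>y. x * y"
    by (intro lin)
  have N: "left_ideal ?N"
    unfolding left_ideal_def
  proof (intro conjI allI ballI)
    show "subspace ?N" by (intro lx.subspace_image \<epsilon>.subspace_kernel)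
    fix h n assume "n \<in> ?N"
    then obtain y where y: "\<epsilon> y = 0" "n = x * y" by auto
    have "h * n = x * scale (\<epsilon> h) y"
      by (simp add: y(2) mult.assoc[symmetric] left scale_mult_left scale_mult_right)
    then show "h * n \<in> ?N" using y(1) by (auto simp: \<epsilon>.scale)
  qed
  then obtain M where M: "left_ideal M" "?N \<inter> M = {0}" "\<And>h. \<exists>u\<in>?N. \<exists>v\<in>M. h = u + v"
    using ss[unfolded semisimple_def, rule_format, of ?N] by auto
  obtain u v where uv: "u \<in> ?N" "v \<in> M" "1 = u + v" using M(3)[of 1] by auto
  have "n = 0" if n: "n \<in> ?N" for n
  proof -
    obtain y z where "n = x * y" "\<epsilon> y = 0" "u = x * z" using n uv(1) by auto
    \<comment> \<open>\<open>y x = \<epsilon>(y) x = 0\<close>, so products of two elements of \<open>?N\<close> vanish\<close>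
    then have "n * u = x * (y * x) * z" by (simp add: mult.assoc)
    also have "y * x = 0" using \<open>\<epsilon> y = 0\<close> left[of y] by simp
    finally have "n * u = 0" by simp
    moreover have "n * (u + v) = n" unfolding uv(3)[symmetric] by simp
    ultimately have "n = n * v" by (simp add: distrib_left)
    moreover have "n * v \<in> M" using M(1) uv(2) by (simp add: left_ideal_def)
    ultimately have "n \<in> M" by simp
    then show ?thesis using n M(2) by blast
  qed
  then have xK: "x * y = 0" if "\<epsilon> y = 0" for y using that by blast
  have "x * h = scale (\<epsilon> h) x" for h
  proof -
    have "x * (h - scale (\<epsilon> h) 1) = 0" by (rule xK) (simp add: \<epsilon>.diff \<epsilon>.scale counit_one)
    then show ?thesis by (simp add: right_diff_distrib scale_mult_right)
  qed
  then show ?thesis using left ex by (auto simp: two_sided_integral_def)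
qed

lemma normalized_integral:
  assumes semisimple
  shows "two_sided_integral normalized_integral" "\<epsilon> normalized_integral = 1"
proof -
  have "x = y" if "two_sided_integral x \<and> \<epsilon> x = 1" "two_sided_integral y \<and> \<epsilon> y = 1" for x y
    using that unfolding two_sided_integral_def by (metis scale_one)
  then have "\<exists>!x. two_sided_integral x \<and> \<epsilon> x = 1"
    using integral_exists[OF assms] by blast
  then have "two_sided_integral normalized_integral \<and> \<epsilon> normalized_integral = 1"
    unfolding normalized_integral_def by (rule theI')
  then show "two_sided_integral normalized_integral" "\<epsilon> normalized_integral = 1" by auto
qed

end

locale semisimple_hopf_algebra = hopf_algebra scale \<Delta> \<epsilon> S
  for scale :: "'k::{alg_closed_field, field_char_0} \<Rightarrow> 'h::ring_1 \<Rightarrow> 'h" and \<Delta> \<epsilon> S +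
  assumes semisimple: semisimple
begin

abbreviation Lam :: 'h where "Lam \<equiv> normalized_integral"

lemma Lam_left: "h * Lam = scale (\<epsilon> h) Lam"
  and Lam_right: "Lam * h = scale (\<epsilon> h) Lam"
  and counit_Lam: "\<epsilon> Lam = 1"
  using normalized_integral[OF semisimple] by (auto simp: two_sided_integral_def)

lemma sw_scale_arg: "bilinH s F \<Longrightarrow> sw F (scale c x) = s c (sw F x)"
  using linH_sw[of s F] by (simp add: Vector_Spaces.linear_iff)

text \<open>The next three identities move an element from one leg of \<open>\<Delta>(L)\<close> to the other. Each follows by inserting
  \<open>\<epsilon>(h) = S(h\<^sub>1) h\<^sub>2\<close> or \<open>\<epsilon>(h) = h\<^sub>1 S(h\<^sub>2)\<close> and absorbing \<open>h\<^sub>1 \<otimes> h\<^sub>2\<close> into the integral. The third one is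
  the Casimir property of \<open>L\<^sub>1 \<otimes> S(L\<^sub>2)\<close>.\<close>

lemma Lam_antipode_left:
  assumes F: "bilinH s F"
  shows "sw (\<lambda>a b. F (S h * a) b) Lam = sw (\<lambda>a b. F a (h * b)) Lam"
proof -
  note [lin] = bilin_lin[OF F] lin_scale_2[of s]
  have "sw (\<lambda>a b. F (S h * a) b) Lam = sw (\<lambda>h1 w. s (\<epsilon> w) (sw (\<lambda>u v. F (S h1 * u) v) Lam)) h"
    by (rule sw_counit_2[where f = "\<lambda>h1. sw (\<lambda>u v. F (S h1 * u) v) Lam", symmetric]) (rule lin)+
  also have "\<dots> = sw (\<lambda>h1 w. sw (\<lambda>u v. F (S h1 * u) v) (w * Lam)) h"
    unfolding Lam_left by (intro sw_cong sw_scale_arg[symmetric]) (rule lin)+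
  also have "\<dots> = sw (\<lambda>h1 w. sw (\<lambda>h2 h3. sw (\<lambda>a b. F (S h1 * (h2 * a)) (h3 * b)) Lam) w) h"
    by (intro sw_cong sw_mult[where s = s]) (rule lin)+
  also have "\<dots> = sw (\<lambda>p h3. sw (\<lambda>h1 h2. sw (\<lambda>a b. F (S h1 * h2 * a) (h3 * b)) Lam) p) h"
    unfolding mult.assoc by (rule sw_coassoc[where s = s, symmetric]) (rule lin)+
  also have "\<dots> = sw (\<lambda>p h3. s (\<epsilon> p) (sw (\<lambda>a b. F (1 * a) (h3 * b)) Lam)) h"
    by (intro sw_cong sw_antipode_1[where f = "\<lambda>z. sw (\<lambda>a b. F (z * a) (h3 * b)) Lam" for h3]) (rule lin)+
  also have "\<dots> = sw (\<lambda>a b. F (1 * a) (h * b)) Lam"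
    by (rule sw_counit_1[where f = "\<lambda>h3. sw (\<lambda>a b. F (1 * a) (h3 * b)) Lam"]) (rule lin)+
  finally show ?thesis by simp
qed

lemma Lam_antipode_right:
  assumes F: "bilinH s F"
  shows "sw (\<lambda>a b. F (a * h) b) Lam = sw (\<lambda>a b. F a (b * S h)) Lam"
proof -
  note [lin] = bilin_lin[OF F] lin_scale_2[of s]
  have "sw (\<lambda>a b. F a (b * S h)) Lam = sw (\<lambda>p h3. s (\<epsilon> p) (sw (\<lambda>u v. F u (v * S h3)) Lam)) h"
    by (rule sw_counit_1[where f = "\<lambda>h1. sw (\<lambda>u v. F u (v * S h1)) Lam", symmetric]) (rule lin)+
  also have "\<dots> = sw (\<lambda>p h3. sw (\<lambda>u v. F u (v * S h3)) (Lam * p)) h"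
    unfolding Lam_right by (intro sw_cong sw_scale_arg[symmetric]) (rule lin)+
  also have "\<dots> = sw (\<lambda>p h3. sw (\<lambda>a b. sw (\<lambda>h1 h2. F (a * h1) (b * h2 * S h3)) p) Lam) h"
    by (intro sw_cong sw_mult[where s = s]) (rule lin)+
  also have "\<dots> = sw (\<lambda>p h3. sw (\<lambda>h1 h2. sw (\<lambda>a b. F (a * h1) (b * h2 * S h3)) Lam) p) h"
    by (intro sw_cong sw_swap)
  also have "\<dots> = sw (\<lambda>h1 w. sw (\<lambda>h2 h3. sw (\<lambda>a b. F (a * h1) (b * (h2 * S h3))) Lam) w) h"
    unfolding mult.assoc by (rule sw_coassoc[where s = s]) (rule lin)+
  also have "\<dots> = sw (\<lambda>h1 w. s (\<epsilon> w) (sw (\<lambda>a b. F (a * h1) (b * 1)) Lam)) h"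
    by (intro sw_cong sw_antipode_2[where f = "\<lambda>z. sw (\<lambda>a b. F (a * h1) (b * z)) Lam" for h1]) (rule lin)+
  also have "\<dots> = sw (\<lambda>a b. F (a * h) (b * 1)) Lam"
    by (rule sw_counit_2[where f = "\<lambda>h3. sw (\<lambda>a b. F (a * h3) (b * 1)) Lam"]) (rule lin)+
  finally show ?thesis by simp
qed

lemma Lam_casimir:
  assumes F: "bilinH s F"
  shows "sw (\<lambda>a b. F (h * a) (S b)) Lam = sw (\<lambda>a b. F a (S b * h)) Lam"
proof -
  note [lin] = bilin_lin[OF F] lin_scale_2[of s]
  have "sw (\<lambda>a b. F a (S b * h)) Lam = sw (\<lambda>p h3. s (\<epsilon> p) (sw (\<lambda>u v. F u (S v * h3)) Lam)) h"
    by (rule sw_counit_1[where f = "\<lambda>h1. sw (\<lambda>u v. F u (S v * h1)) Lam", symmetric]) (rule lin)+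
  also have "\<dots> = sw (\<lambda>p h3. sw (\<lambda>u v. F u (S v * h3)) (p * Lam)) h"
    unfolding Lam_left by (intro sw_cong sw_scale_arg[symmetric]) (rule lin)+
  also have "\<dots> = sw (\<lambda>p h3. sw (\<lambda>h1 h2. sw (\<lambda>a b. F (h1 * a) (S (h2 * b) * h3)) Lam) p) h"
    by (intro sw_cong sw_mult[where s = s]) (rule lin)+
  also have "\<dots> = sw (\<lambda>h1 w. sw (\<lambda>h2 h3. sw (\<lambda>a b. F (h1 * a) (S b * (S h2 * h3))) Lam) w) h"
    unfolding antipode_mult mult.assoc by (rule sw_coassoc[where s = s]) (rule lin)+
  also have "\<dots> = sw (\<lambda>h1 w. s (\<epsilon> w) (sw (\<lambda>a b. F (h1 * a) (S b * 1)) Lam)) h"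
    by (intro sw_cong sw_antipode_1[where f = "\<lambda>z. sw (\<lambda>a b. F (h1 * a) (S b * z)) Lam" for h1]) (rule lin)+
  also have "\<dots> = sw (\<lambda>a b. F (h * a) (S b * 1)) Lam"
    by (rule sw_counit_2[where f = "\<lambda>h3. sw (\<lambda>a b. F (h3 * a) (S b * 1)) Lam"]) (rule lin)+
  finally show ?thesis by simp
qed

section \<open>Finite dimension\<close>

text \<open>The second legs of \<open>\<Delta>(L)\<close> span \<open>H\<close>. Expanding the first legs in a basis \<open>C\<close>, the identity
  \<open>h = h S(L\<^sub>1) L\<^sub>2\<close> becomes a finite sum of terms \<open>h S(c) \<cdot> r\<^sub>c(L\<^sub>1) L\<^sub>2\<close> with coordinate functionals \<open>r\<^sub>c\<close>, and
  the left factor can be moved to the first leg, inside the functional.\<close>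

lemma finite_spanning_set: "\<exists>B. finite B \<and> span B = UNIV"
proof -
  let ?A = "fst ` set (cop Lam)" and ?B = "snd ` set (cop Lam)"
  obtain C where C: "independent C" "span C = UNIV"
  proof -
    obtain C where "C \<subseteq> UNIV" "independent C" "UNIV \<subseteq> span C" "card C = dim UNIV"
      by (rule basis_exists)
    then show ?thesis using that by auto
  qed
  let ?r = "representation C"
  define C0 where "C0 = (\<Union>a\<in>?A. {c. ?r a c \<noteq> 0})"
  have C0: "finite C0" by (simp add: C0_def finite_representation)
  have r: "linH (*) (\<lambda>x. ?r x c)" for c by (rule linear_representation[OF C])
  note [lin] = lin_comp[OF r]
  have in_B: "sw (\<lambda>a b. scale (f a) b) Lam \<in> span ?B" for f
    unfolding sw_def case_prod_unfold
  proof -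
    have "set ps \<subseteq> set (cop Lam) \<Longrightarrow> (\<Sum>p\<leftarrow>ps. scale (f (fst p)) (snd p)) \<in> span ?B" for ps
    proof (induction ps)
      case (Cons p ps)
      then have "scale (f (fst p)) (snd p) \<in> span ?B" by (intro span_scale span_base) auto
      then show ?case using Cons by (auto intro: span_add)
    qed (simp add: span_zero)
    then show "(\<Sum>p\<leftarrow>cop Lam. scale (f (fst p)) (snd p)) \<in> span ?B" by simp
  qed
  have "h \<in> span ?B" for h
  proof -
    have Ca: "a = (\<Sum>c\<in>C0. scale (?r a c) c)" if "a \<in> ?A" for a
    proof -
      have "a = (\<Sum>c | ?r a c \<noteq> 0. scale (?r a c) c)"
        using sum_nonzero_representation_eq[OF C(1), of a] C(2) by simp
      also have "\<dots> = (\<Sum>c\<in>C0. scale (?r a c) c)"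
        using that by (intro sum.mono_neutral_left C0) (auto simp: C0_def)
      finally show ?thesis .
    qed
    have "h = sw (\<lambda>a b. h * (S a * b)) Lam"
      using sw_antipode_1[of scale "\<lambda>z. h * z" Lam] counit_Lam by (simp add: lin)
    also have "\<dots> = sw (\<lambda>a b. \<Sum>c\<in>C0. scale (?r a c) (h * S c * b)) Lam"
      unfolding sw_def case_prod_unfold
    proof (intro arg_cong[where f = sum_list] map_cong refl)
      fix p assume "p \<in> set (cop Lam)"
      then have p: "fst p \<in> ?A" by blast
      interpret l: Vector_Spaces.linear scale scale "\<lambda>a. h * (S a * snd p)" by (intro lin)
      have "h * (S (fst p) * snd p) = h * (S (\<Sum>c\<in>C0. scale (?r (fst p) c) c) * snd p)"
        using Ca[OF p] by simp
      also have "\<dots> = (\<Sum>c\<in>C0. scale (?r (fst p) c) (h * S c * snd p))"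
        by (simp add: l.sum l.scale mult.assoc)
      finally show "h * (S (fst p) * snd p) = (\<Sum>c\<in>C0. scale (?r (fst p) c) (h * S c * snd p))" .
    qed
    also have "\<dots> = (\<Sum>c\<in>C0. sw (\<lambda>a b. scale (?r a c) (h * S c * b)) Lam)"
      by (rule sw_sum)
    also have "\<dots> = (\<Sum>c\<in>C0. sw (\<lambda>a b. scale (?r (S (h * S c) * a) c) b) Lam)"
      by (intro sum.cong refl Lam_antipode_left[where F = "\<lambda>a b. scale (?r a c) b" for c, symmetric]) (rule lin)+
    also have "\<dots> \<in> span ?B" by (intro span_sum in_B)
    finally show ?thesis .
  qed
  then show ?thesis by (intro exI[of _ ?B]) auto
qed

sublocale fd_space_closed scale
  by unfold_locales (rule finite_spanning_set)

lemmas [lin] = lin_comp[OF crd_linear]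

lemma linear_inj_surj:
  assumes "linH scale f" and "inj f"
  shows "surj f"
proof -
  interpret finite_dimensional_vector_space scale Bas
    by unfold_locales (rule finite_Bas, rule Bas, rule Bas)
  show ?thesis by (rule linear_inj_imp_surj[OF assms])
qed

lemma crd_eqI: "(\<And>b. crd b x = crd b y) \<Longrightarrow> x = y"
  by (metis (no_types, lifting) expand sum.cong)

section \<open>The integral of the dual\<close>

text \<open>Cyclicity of a partial trace: if \<open>E\<close> and \<open>e\<close> denote a basis and its dual basis, then
  \<open>\<Sum> e(f(E\<^sub>2)\<^sub>2) G(f(E\<^sub>2)\<^sub>1, E\<^sub>1) = \<Sum> e(f(E)\<^sub>3) G(f(E)\<^sub>1, f(E)\<^sub>2)\<close>. It moves a coproduct from the argument of \<open>f\<close>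
  to its value and is the source of the integral property below and of the idempotence of the regular
  character under convolution.\<close>

lemma sw_partial_trace:
  assumes f: "linH scale f" and G: "bilinH s G"
  shows "(\<Sum>b\<in>Bas. sw (\<lambda>b1 b2. sw (\<lambda>x1 x2. s (crd b x2) (G x1 b1)) (f b2)) b) =
    (\<Sum>c\<in>Bas. sw (\<lambda>x1 x2. sw (\<lambda>y1 y2. s (crd c y2) (G x1 y1)) x2) (f c))"
proof -
  note [lin] = bilin_lin[OF G] lin_scale_2[of s] lin_comp[OF f]
  interpret s: vector_space s by (rule bilinH_target[OF G])
  let ?K = "\<lambda>c x1 b. sw (\<lambda>b1 b2. s (crd c b2) (G x1 b1)) b"
  have "sw (\<lambda>b1 b2. sw (\<lambda>x1 x2. s (crd b x2) (G x1 b1)) (f b2)) b =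
      (\<Sum>c\<in>Bas. sw (\<lambda>x1 x2. s (crd b x2) (?K c x1 b)) (f c))" for b
  proof -
    have "sw (\<lambda>b1 b2. sw (\<lambda>x1 x2. s (crd b x2) (G x1 b1)) (f b2)) b =
      sw (\<lambda>b1 b2. \<Sum>c\<in>Bas. s (crd c b2) (sw (\<lambda>x1 x2. s (crd b x2) (G x1 b1)) (f c))) b"
      by (intro sw_cong linear_expand[where f = "\<lambda>b2. sw (\<lambda>x1 x2. s (crd b x2) (G x1 b1)) (f b2)" for b1]) (rule lin)+
    also have "\<dots> = (\<Sum>c\<in>Bas. sw (\<lambda>b1 b2. s (crd c b2) (sw (\<lambda>x1 x2. s (crd b x2) (G x1 b1)) (f c))) b)"
      by (rule sw_sum)
    also have "\<dots> = (\<Sum>c\<in>Bas. sw (\<lambda>b1 b2. sw (\<lambda>x1 x2. s (crd b x2) (s (crd c b2) (G x1 b1))) (f c)) b)"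
      by (intro sum.cong refl sw_cong) (simp add: sw_apply[OF s.linear_scale_self] mult.commute)
    also have "\<dots> = (\<Sum>c\<in>Bas. sw (\<lambda>x1 x2. sw (\<lambda>b1 b2. s (crd b x2) (s (crd c b2) (G x1 b1))) b) (f c))"
      by (intro sum.cong refl sw_swap)
    finally show ?thesis by (simp only: sw_apply[OF s.linear_scale_self])
  qed
  then have "(\<Sum>b\<in>Bas. sw (\<lambda>b1 b2. sw (\<lambda>x1 x2. s (crd b x2) (G x1 b1)) (f b2)) b) =
      (\<Sum>c\<in>Bas. \<Sum>b\<in>Bas. sw (\<lambda>x1 x2. s (crd b x2) (?K c x1 b)) (f c))"
    by (simp only:) (rule sum.swap)
  also have "\<dots> = (\<Sum>c\<in>Bas. sw (\<lambda>x1 x2. \<Sum>b\<in>Bas. s (crd b x2) (?K c x1 b)) (f c))"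
    by (simp only: sw_sum)
  also have "\<dots> = (\<Sum>c\<in>Bas. sw (\<lambda>x1 x2. ?K c x1 x2) (f c))"
    by (intro sum.cong refl sw_cong linear_expand[symmetric]) (rule lin)+
  finally show ?thesis .
qed

text \<open>The trace of \<open>S\<^sup>2\<close> twisted by left multiplication; it will turn out to be a nonzero left integral of the
  dual Hopf algebra.\<close>

definition lam :: "'h \<Rightarrow> 'k" where
  "lam h = tr (\<lambda>x. h * S (S x))"

lemma lam_basis: "lam h = (\<Sum>e\<in>Bas. crd e (h * S (S e)))"
  by (simp add: lam_def tr_basis)

lemma lin_tr_mult:
  assumes "linH scale f"
  shows "linH (*) (\<lambda>x. tr (\<lambda>y. f x * g y))"
proof -
  interpret f: Vector_Spaces.linear scale scale f by fact
  show ?thesis unfolding Vector_Spaces.linear_iff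
    by (simp add: f.add f.scale distrib_right scale_mult_left tr_add tr_scale vector_space_axioms vector_space_field)
qed

lemma lin_lam [lin]: "linH scale f \<Longrightarrow> linH (*) (\<lambda>x. lam (f x))"
  unfolding lam_def by (rule lin_tr_mult)

lemma lam_Lam: "lam Lam = 1"
proof -
  have "lam Lam = (\<Sum>i\<in>{()}. \<epsilon> Lam)"
    unfolding lam_def by (rule tr_eq_sum[where \<phi> = "\<lambda>_. \<epsilon>" and w = "\<lambda>_. Lam"])
      (simp_all add: Lam_right counit_antipode counit_linear)
  then show ?thesis by (simp add: counit_Lam)
qed

text \<open>Since \<open>S\<^sup>2(E\<^sub>2) S(E\<^sub>1) = S(E\<^sub>1 S(E\<^sub>2))\<close> collapses to \<open>\<epsilon>(E)\<close>, the term \<open>h\<^sub>1 \<otimes> h\<^sub>2 S\<^sup>2(E)\<close> equals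
  \<open>(h S\<^sup>2(E\<^sub>2))\<^sub>1 S(E\<^sub>1) \<otimes> (h S\<^sup>2(E\<^sub>2))\<^sub>2\<close>. Taking the trace over \<open>E\<close> and using cyclicity turns it into an
  expression \<open>x\<^sub>1 S(x\<^sub>2) \<otimes> x\<^sub>3\<close>, which collapses again.\<close>

lemma lam_left_integral': "sw (\<lambda>a b. scale (lam b) a) h = scale (lam h) 1"
proof -
  let ?f = "\<lambda>x. h * S (S x)" and ?G = "\<lambda>x y. x * S y"
  \<comment> \<open>insertion of \<open>S\<^sup>2(E\<^sub>2) S(E\<^sub>1)\<close>\<close>
  have L: "sw (\<lambda>e1 e2. sw (\<lambda>x1 x2. scale (crd e x2) (x1 * S e1)) (h * S (S e2))) e =
      sw (\<lambda>a b. scale (crd e (b * S (S e))) a) h" for e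
  proof -
    have "sw (\<lambda>e1 w. sw (\<lambda>x1 x2. scale (crd e x2) (x1 * S e1)) (h * S (S w))) e =
        sw (\<lambda>e1 w. sw (\<lambda>a b. sw (\<lambda>c d. scale (crd e (b * d)) (a * c * S e1)) (S (S w))) h) e"
      by (intro sw_cong sw_mult[where s = scale]) (rule lin)+
    also have "\<dots> = sw (\<lambda>e1 w. sw (\<lambda>a b. sw (\<lambda>c d. scale (crd e (b * S c)) (a * S d * S e1)) (S w)) h) e"
      by (intro sw_cong sw_antipode[where s = scale]) (rule lin)+
    also have "\<dots> = sw (\<lambda>e1 w. sw (\<lambda>a b. sw (\<lambda>c d. scale (crd e (b * S (S d))) (a * S (S c) * S e1)) w) h) e"
      by (intro sw_cong sw_antipode[where s = scale]) (rule lin)+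
    also have "\<dots> = sw (\<lambda>a b. sw (\<lambda>e1 w. sw (\<lambda>c d. scale (crd e (b * S (S d))) (a * S (S c) * S e1)) w) e) h"
      by (rule sw_swap)
    also have "\<dots> = sw (\<lambda>a b. sw (\<lambda>p e3. sw (\<lambda>e1 e2. scale (crd e (b * S (S e3))) (a * S (e1 * S e2))) p) e) h"
      unfolding antipode_mult mult.assoc by (intro sw_cong sw_coassoc[where s = scale, symmetric]) (rule lin)+
    also have "\<dots> = sw (\<lambda>a b. sw (\<lambda>p e3. scale (\<epsilon> p) (scale (crd e (b * S (S e3))) (a * S 1))) e) h"
      by (intro sw_cong sw_antipode_2[where f = "\<lambda>z. scale (crd e (b * S (S e3))) (a * S z)" for a b e3]) (rule lin)+
    also have "\<dots> = sw (\<lambda>a b. scale (crd e (b * S (S e))) (a * S 1)) h"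
      by (intro sw_cong sw_counit_1[where f = "\<lambda>e3. scale (crd e (b * S (S e3))) (a * S 1)" for a b]) (rule lin)+
    finally show ?thesis by (simp add: antipode_one)
  qed
  \<comment> \<open>collapse after the cyclic move\<close>
  have R: "sw (\<lambda>x1 x2. sw (\<lambda>y1 y2. scale (crd c y2) (x1 * S y1)) x2) x = scale (crd c x) 1" for c x
  proof -
    have "sw (\<lambda>x1 x2. sw (\<lambda>y1 y2. scale (crd c y2) (x1 * S y1)) x2) x =
        sw (\<lambda>p y2. sw (\<lambda>x1 y1. scale (crd c y2) (x1 * S y1)) p) x"
      by (rule sw_coassoc[where s = scale, symmetric]) (rule lin)+
    also have "\<dots> = sw (\<lambda>p y2. scale (\<epsilon> p) (scale (crd c y2) 1)) x"
      by (intro sw_cong sw_antipode_2) (rule lin)+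
    also have "\<dots> = scale (crd c x) 1"
      by (rule sw_counit_1) (rule lin)+
    finally show ?thesis .
  qed
  have "sw (\<lambda>a b. scale (lam b) a) h = (\<Sum>e\<in>Bas. sw (\<lambda>a b. scale (crd e (b * S (S e))) a) h)"
    by (simp add: lam_basis scale_sum_left sw_sum)
  also have "\<dots> = (\<Sum>e\<in>Bas. sw (\<lambda>e1 e2. sw (\<lambda>x1 x2. scale (crd e x2) (?G x1 e1)) (?f e2)) e)"
    by (simp only: L)
  also have "\<dots> = (\<Sum>c\<in>Bas. sw (\<lambda>x1 x2. sw (\<lambda>y1 y2. scale (crd c y2) (?G x1 y1)) x2) (?f c))"
    by (rule sw_partial_trace) (rule lin)+
  also have "\<dots> = scale (lam h) 1"
    by (simp only: R) (simp add: lam_basis scale_sum_left)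
  finally show ?thesis .
qed

lemma lam_left_integral:
  assumes f: "linH s f"
  shows "sw (\<lambda>a b. s (lam b) (f a)) h = s (lam h) (f 1)"
  using arg_cong[OF lam_left_integral'[of h], of f] f
  by (simp add: sw_apply[OF f] Vector_Spaces.linear_iff)

text \<open>The two formulas \<open>S(h) = \<lambda>(h L\<^sub>2) L\<^sub>1\<close> and \<open>h = \<lambda>(L\<^sub>2 S(h)) L\<^sub>1\<close> carry the Frobenius structure: the second
  one shows that \<open>S\<close> is injective, and together they give nondegeneracy of \<open>\<lambda>\<close> and its Nakayama
  automorphism.\<close>

lemma antipode_via_lam: "sw (\<lambda>a b. scale (lam (h * b)) a) Lam = S h"
proof -
  have "sw (\<lambda>a b. scale (lam (h * b)) a) Lam = sw (\<lambda>a b. scale (lam b) (S h * a)) Lam"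
    by (rule Lam_antipode_left[where F = "\<lambda>a b. scale (lam b) a", symmetric]) (rule lin)+
  also have "\<dots> = scale (lam Lam) (S h * 1)"
    by (rule lam_left_integral) (rule lin)+
  finally show ?thesis by (simp add: lam_Lam)
qed

lemma identity_via_lam: "sw (\<lambda>a b. scale (lam (b * S h)) a) Lam = h"
proof -
  have "sw (\<lambda>a b. scale (lam (b * S h)) a) Lam = sw (\<lambda>a b. scale (lam b) (a * h)) Lam"
    by (rule Lam_antipode_right[where F = "\<lambda>a b. scale (lam b) a", symmetric]) (rule lin)+
  also have "\<dots> = scale (lam Lam) (1 * h)"
    by (rule lam_left_integral) (rule lin)+
  finally show ?thesis by (simp add: lam_Lam)
qed

lemma antipode_inj: "S x = S y \<Longrightarrow> x = y"
  by (subst identity_via_lam[symmetric], subst (2) identity_via_lam[symmetric]) (simp only:)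

lemma antipode_surj: "surj S"
  by (rule linear_inj_surj[OF antipode_linear]) (rule injI, rule antipode_inj)

lemma lam_nondegenerate_left: "(\<And>x. lam (h * x) = lam (k * x)) \<Longrightarrow> h = k"
  using antipode_via_lam[of h] antipode_via_lam[of k] antipode_inj by simp

lemma functional_eq_lam:
  assumes f: "linH (*) f"
  obtains a where "\<And>x. f x = lam (a * x)"
proof
  fix x
  obtain y where y: "x = S y" using surjD[OF antipode_surj] by blast
  have fS: "linH (*) (\<lambda>a. f (S a))" by (rule lin_comp[OF f]) (rule lin)+
  have "f x = f (S (sw (\<lambda>a b. scale (lam (b * S y)) a) Lam))" by (simp add: identity_via_lam y)
  also have "\<dots> = sw (\<lambda>a b. f (S (scale (lam (b * S y)) a))) Lam" by (rule sw_apply[OF fS])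
  also have "\<dots> = sw (\<lambda>a b. lam (scale (f (S a)) b * x)) Lam"
    using fS lin_lam[OF lin_ident] by (simp add: y scale_mult_left Vector_Spaces.linear_iff mult.commute)
  also have "\<dots> = lam (sw (\<lambda>a b. scale (f (S a)) b) Lam * x)"
    by (rule sw_apply[symmetric, of scale]) (rule lin)+
  finally show "f x = lam (sw (\<lambda>a b. scale (f (S a)) b) Lam * x)" .
qed

lemma functional_eqI:
  assumes f: "linH (*) f" and g: "linH (*) g"
    and eq: "sw (\<lambda>a b. scale (f b) a) Lam = sw (\<lambda>a b. scale (g b) a) Lam"
  shows "f x = g x"
proof -
  obtain a where a: "\<And>x. f x = lam (a * x)" by (rule functional_eq_lam[OF f]) auto
  obtain c where c: "\<And>x. g x = lam (c * x)" by (rule functional_eq_lam[OF g]) auto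
  have "S a = S c" using eq by (simp only: a c antipode_via_lam)
  then have "a = c" by (rule antipode_inj)
  then show ?thesis by (simp only: a c)
qed

text \<open>Both functionals of \<open>x\<close> are sent to \<open>S(h)\<close> by the injective map \<open>f \<mapsto> f(L\<^sub>2) L\<^sub>1\<close>.\<close>

lemma lam_nakayama: "lam (h * x) = lam (x * S (S h))"
proof (rule functional_eqI[where f = "\<lambda>x. lam (h * x)" and g = "\<lambda>x. lam (x * S (S h))"])
  show "linH (*) (\<lambda>x. lam (h * x))" "linH (*) (\<lambda>x. lam (x * S (S h)))" by (rule lin)+
  show "sw (\<lambda>a b. scale (lam (h * b)) a) Lam = sw (\<lambda>a b. scale (lam (b * S (S h))) a) Lam"
    by (simp only: antipode_via_lam identity_via_lam)
qed

section \<open>The distinguished grouplike element\<close>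

definition grp :: 'h where
  "grp = sw (\<lambda>a b. scale (lam a) b) Lam"

text \<open>The functional \<open>\<lambda> * f\<close> is again a left integral of the dual, hence a multiple of \<open>\<lambda>\<close>; evaluating at \<open>L\<close> gives
  the factor \<open>f(g)\<close>, where \<open>g = \<lambda>(L\<^sub>1) L\<^sub>2\<close>.\<close>

lemma lam_right_functional:
  assumes f: "linH (*) f"
  shows "sw (\<lambda>a b. lam a * f b) h = lam h * f grp"
proof (rule functional_eqI[where f = "sw (\<lambda>a b. lam a * f b)" and g = "\<lambda>h. lam h * f grp"])
  note [lin] = lin_comp[OF f]
  show "linH (*) (sw (\<lambda>a b. lam a * f b))" by (rule linH_sw) (rule lin)+
  show "linH (*) (\<lambda>h. lam h * f grp)" by (rule lin)+
  have "sw (\<lambda>a b. scale (sw (\<lambda>c d. lam c * f d) b) a) Lam = sw (\<lambda>a b. sw (\<lambda>c d. scale (lam c * f d) a) b) Lam"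
    by (intro sw_cong sw_apply[of "(*)" scale]) (rule linear_scale_left)
  also have "\<dots> = sw (\<lambda>p d. sw (\<lambda>a c. scale (lam c * f d) a) p) Lam"
    by (rule sw_coassoc[where s = scale, symmetric]) (rule lin)+
  also have "\<dots> = sw (\<lambda>p d. sw (\<lambda>a c. scale (lam c) (scale (f d) a)) p) Lam" by simp
  also have "\<dots> = sw (\<lambda>p d. scale (lam p) (scale (f d) 1)) Lam"
    by (intro sw_cong lam_left_integral) (rule lin)+
  also have "\<dots> = scale (sw (\<lambda>p d. lam p * f d) Lam) 1"
    by (simp add: sw_apply[OF linear_scale_left])
  also have "sw (\<lambda>p d. lam p * f d) Lam = f grp"
    using f by (simp add: grp_def sw_apply[OF f] Vector_Spaces.linear_iff)
  also have "scale (f grp) 1 = scale (f grp) (sw (\<lambda>a b. scale (lam b) a) Lam)"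
    by (simp add: lam_left_integral' lam_Lam)
  also have "\<dots> = sw (\<lambda>a b. scale (lam b * f grp) a) Lam"
    by (simp add: sw_apply[OF linear_scale_self] mult.commute)
  finally show "sw (\<lambda>a b. scale (sw (\<lambda>a b. lam a * f b) b) a) Lam = sw (\<lambda>a b. scale (lam b * f grp) a) Lam" .
qed

lemma lam_right_integral:
  assumes f: "linH s f"
  shows "sw (\<lambda>a b. s (lam a) (f b)) h = s (lam h) (f grp)"
proof -
  have "sw (\<lambda>a b. scale (lam a) b) h = scale (lam h) grp"
  proof (rule crd_eqI)
    fix e
    show "crd e (sw (\<lambda>a b. scale (lam a) b) h) = crd e (scale (lam h) grp)"
      using crd_linear[of e] lam_right_functional[OF crd_linear[of e]]
      by (simp add: sw_apply[OF crd_linear] Vector_Spaces.linear_iff)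
  qed
  from arg_cong[OF this, of f] show ?thesis
    using f by (simp add: sw_apply[OF f] Vector_Spaces.linear_iff)
qed

lemma sw_grp:
  assumes F: "bilinH s F"
  shows "sw F grp = F grp grp"
proof -
  note [lin] = bilin_lin[OF F] lin_scale_2[of s] linH_sw[OF F]
  interpret s: vector_space s by (rule bilinH_target[OF F])
  have "sw F grp = sw (\<lambda>a b. sw F (scale (lam a) b)) Lam"
    unfolding grp_def by (rule sw_apply[OF linH_sw[OF F]])
  also have "\<dots> = sw (\<lambda>a b. sw (\<lambda>c d. s (lam a) (F c d)) b) Lam"
    by (simp add: sw_scale_arg[OF F] sw_apply[OF s.linear_scale_self])
  also have "\<dots> = sw (\<lambda>p d. sw (\<lambda>a c. s (lam a) (F c d)) p) Lam"
    by (rule sw_coassoc[where s = s, symmetric]) (rule lin)+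
  also have "\<dots> = sw (\<lambda>p d. s (lam p) (F grp d)) Lam"
    by (intro sw_cong lam_right_integral) (rule lin)+
  also have "\<dots> = s (lam Lam) (F grp grp)"
    by (rule lam_right_integral) (rule lin)+
  finally show ?thesis by (simp add: lam_Lam)
qed

lemma counit_grp: "\<epsilon> grp = 1"
proof -
  have "\<epsilon> grp = sw (\<lambda>a b. \<epsilon> b * lam a) Lam"
    using counit_linear by (simp add: grp_def sw_apply[OF counit_linear] Vector_Spaces.linear_iff mult.commute)
  also have "\<dots> = lam Lam" by (rule sw_counit_2) (rule lin)+
  finally show ?thesis by (simp add: lam_Lam)
qed

lemma grp_inverse: "S grp * grp = 1" "grp * S grp = 1"
proof -
  have "S grp * grp = sw (\<lambda>a b. S a * b) grp" by (rule sw_grp[symmetric]) (rule lin)+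
  also have "\<dots> = scale (\<epsilon> grp) 1" by (rule sw_antipode_1) (rule lin)+
  finally show "S grp * grp = 1" by (simp add: counit_grp)
  have "grp * S grp = sw (\<lambda>a b. a * S b) grp" by (rule sw_grp[symmetric]) (rule lin)+
  also have "\<dots> = scale (\<epsilon> grp) 1" by (rule sw_antipode_2) (rule lin)+
  finally show "grp * S grp = 1" by (simp add: counit_grp)
qed

lemma antipode_antipode_grp: "S (S grp) = grp"
proof -
  have "S (S grp) = S (S grp) * (S grp * grp)" by (simp add: grp_inverse)
  also have "\<dots> = S (grp * S grp) * grp" by (simp add: antipode_mult mult.assoc)
  finally show ?thesis by (simp add: grp_inverse antipode_one)
qed

lemma antipode_Lam: "S Lam = Lam"
proof -
  obtain y where y: "Lam = S y" using surjD[OF antipode_surj] by blast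
  have "\<epsilon> y = 1" using counit_antipode[of y] counit_Lam y by simp
  have "S Lam * Lam = S (y * Lam)" using y by (simp add: antipode_mult)
  also have "\<dots> = S Lam" by (simp add: Lam_left \<open>\<epsilon> y = 1\<close>)
  finally show ?thesis using Lam_left[of "S Lam"] by (simp add: counit_antipode counit_Lam)
qed

text \<open>The functional \<open>\<lambda> \<circ> S\<close> is a right integral of the dual. Writing it as \<open>\<lambda>(S(k) \<cdot>)\<close> and evaluating the integral
  property at \<open>L\<close> gives \<open>k g = 1\<close>.\<close>

lemma lam_antipode: "lam (S h) = lam (grp * h)"
proof -
  have right: "sw (\<lambda>a b. scale (lam (S a)) b) h = scale (lam (S h)) 1" for h
  proof (rule antipode_inj)
    have "S (sw (\<lambda>a b. scale (lam (S a)) b) h) = sw (\<lambda>a b. scale (lam (S a)) (S b)) h"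
      using antipode_linear by (simp add: sw_apply[OF antipode_linear] Vector_Spaces.linear_iff)
    also have "\<dots> = sw (\<lambda>a b. scale (lam b) a) (S h)"
      by (rule sw_antipode[where s = scale and F = "\<lambda>a b. scale (lam b) a", symmetric]) (rule lin)+
    also have "\<dots> = S (scale (lam (S h)) 1)"
      using antipode_linear by (simp add: lam_left_integral' Vector_Spaces.linear_iff antipode_one)
    finally show "S (sw (\<lambda>a b. scale (lam (S a)) b) h) = S (scale (lam (S h)) 1)" .
  qed
  obtain c where c: "\<And>x. lam (S x) = lam (c * x)"
    by (rule functional_eq_lam[of "\<lambda>x. lam (S x)"]) (rule lin | blast)+
  obtain k where k: "c = S k" using surjD[OF antipode_surj] by blast
  have "1 = sw (\<lambda>a b. scale (lam (S a)) b) Lam" by (simp add: right antipode_Lam lam_Lam)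
  also have "\<dots> = sw (\<lambda>a b. scale (lam (S k * a)) b) Lam" by (simp add: c k)
  also have "\<dots> = sw (\<lambda>a b. scale (lam a) (k * b)) Lam"
    by (rule Lam_antipode_left[where F = "\<lambda>a b. scale (lam a) b"]) (rule lin)+
  also have "\<dots> = scale (lam Lam) (k * grp)" by (rule lam_right_integral) (rule lin)+
  finally have "k * grp = 1" by (simp add: lam_Lam)
  then have "k = S grp" by (metis grp_inverse(2) mult.assoc mult_1_left mult_1_right)
  then show ?thesis by (simp add: c k antipode_antipode_grp)
qed

lemma lam_antipode_antipode: "lam (S (S h)) = lam h"
proof -
  have "lam (S (S h)) = lam (S (h * S grp))"
    by (simp add: lam_antipode antipode_mult antipode_antipode_grp)
  also have "\<dots> = lam (grp * (h * S grp))" by (rule lam_antipode)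
  also have "\<dots> = lam h" by (simp add: lam_nakayama[of grp] antipode_antipode_grp mult.assoc grp_inverse)
  finally show ?thesis .
qed

text \<open>Radford's formula in the unimodular case. It compares the Nakayama automorphism of \<open>\<lambda> \<circ> S\<close> obtained from
  antimultiplicativity of \<open>S\<close> with the one obtained from \<open>\<lambda> \<circ> S = \<lambda>(g \<cdot>)\<close>.\<close>

lemma antipode_4_conjugation: "S (S (S (S c))) = S grp * c * grp"
proof -
  have i: "lam (grp * (a * b)) = lam (grp * (S (S b) * a))" for a b
    unfolding lam_antipode[symmetric] antipode_mult by (rule lam_nakayama)
  have ii: "lam (grp * (a * b)) = lam (b * (grp * S (S a)))" for a b
    using lam_nakayama[of "grp * a" b] by (simp add: antipode_mult antipode_antipode_grp mult.assoc)
  have "grp * S (S (S (S c))) = c * grp"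
  proof (rule lam_nondegenerate_left)
    fix a
    have "lam (grp * S (S (S (S c))) * a) = lam (S (S c) * (grp * S (S a)))"
      using i[of a "S (S c)"] ii[of a "S (S c)"] by (simp add: mult.assoc)
    also have "\<dots> = lam (S (S (c * grp * a)))"
      by (simp add: antipode_mult antipode_antipode_grp mult.assoc)
    also have "\<dots> = lam (c * grp * a)" by (rule lam_antipode_antipode)
    finally show "lam (grp * S (S (S (S c))) * a) = lam (c * grp * a)" .
  qed
  then have "S grp * (grp * S (S (S (S c)))) = S grp * (c * grp)" by simp
  then show ?thesis by (simp add: mult.assoc[symmetric] grp_inverse)
qed

end

section \<open>The regular character\<close>

lemma power_mult_commuting:
  fixes a b :: "'a::monoid_mult"
  assumes "a * b = b * a"
  shows "(a * b) ^ n = a ^ n * b ^ n"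
proof (induction n)
  case (Suc n)
  have "b ^ n * a = a * b ^ n" by (rule power_commuting_commutes[OF assms[symmetric]])
  then have "a * (b * (a ^ n * b ^ n)) = a * (a ^ n * (b * b ^ n))"
    using power_commuting_commutes[OF assms] by (metis mult.assoc)
  then show ?case using Suc by (simp add: mult.assoc)
qed simp

context semisimple_hopf_algebra
begin

definition chi :: "'h \<Rightarrow> 'k" where
  "chi h = tr (\<lambda>x. h * x)"

text \<open>Under the Wedderburn decomposition, \<open>q = S(L\<^sub>2) L\<^sub>1\<close> has as components multiples of the operators that
  implement \<open>S\<^sup>2\<close> on the simple modules (\<open>qq_comm\<close>); the multiples are normalized by \<open>chi_central\<close>.\<close>

definition qq :: 'h where
  "qq = sw (\<lambda>a b. S b * a) Lam"

lemma lin_chi [lin]: "linH scale f \<Longrightarrow> linH (*) (\<lambda>x. chi (f x))"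
  unfolding chi_def by (rule lin_tr_mult)

lemma chi_comm: "chi (a * b) = chi (b * a)"
  unfolding chi_def mult.assoc by (rule tr_comm) (rule lin)+

lemma chi_basis: "chi h = (\<Sum>e\<in>Bas. crd e (h * e))"
  by (simp add: chi_def tr_basis)

lemma chi_one: "chi 1 = of_nat (card Bas)"
  by (simp add: chi_def tr_ident)

lemma chi_Lam: "chi Lam = 1"
proof -
  have "chi Lam = (\<Sum>i\<in>{()}. \<epsilon> Lam)"
    unfolding chi_def by (rule tr_eq_sum[where \<phi> = "\<lambda>_. \<epsilon>" and w = "\<lambda>_. Lam"])
      (simp_all add: Lam_right counit_linear)
  then show ?thesis by (simp add: counit_Lam)
qed

lemma qq_comm: "qq * h = S (S h) * qq"
proof -
  have "qq * h = sw (\<lambda>a b. S b * a * h) Lam"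
    unfolding qq_def by (rule sw_apply[of scale scale "\<lambda>z. z * h"]) (rule lin)+
  also have "\<dots> = sw (\<lambda>a b. S (b * S h) * a) Lam"
    unfolding mult.assoc by (rule Lam_antipode_right[where s = scale and F = "\<lambda>a b. S b * a"]) (rule lin)+
  also have "\<dots> = sw (\<lambda>a b. S (S h) * (S b * a)) Lam"
    by (simp add: antipode_mult mult.assoc)
  also have "\<dots> = S (S h) * qq"
    unfolding qq_def by (rule sw_apply[of scale scale "\<lambda>z. S (S h) * z", symmetric]) (rule lin)+
  finally show ?thesis .
qed

text \<open>The legs of \<open>L\<^sub>1 \<otimes> S(L\<^sub>2)\<close> are dual bases for the form given by \<open>\<lambda>(g \<cdot>)\<close>, so the trace of every operator is a
  Sweedler sum (\<open>tr_eq_lam\<close>).\<close>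

lemma Lam_dual_basis: "sw (\<lambda>a b. scale (lam (grp * (x * a))) (S b)) Lam = x"
proof -
  have "sw (\<lambda>a b. scale (lam (grp * (x * a))) (S b)) Lam = sw (\<lambda>a b. scale (lam a) (S b * (grp * x))) Lam"
    unfolding mult.assoc[symmetric, of grp x]
    by (rule Lam_casimir[where s = scale and F = "\<lambda>a b. scale (lam a) b"]) (rule lin)+
  also have "\<dots> = scale (lam Lam) (S grp * (grp * x))"
    by (rule lam_right_integral) (rule lin)+
  finally show ?thesis by (simp add: lam_Lam grp_inverse mult.assoc[symmetric])
qed

lemma tr_eq_lam:
  assumes T: "linH scale T"
  shows "tr T = sw (\<lambda>a b. lam (grp * (T (S b) * a))) Lam"
proof -
  have "tr T = (\<Sum>p\<leftarrow>cop Lam. lam (grp * (T (S (snd p)) * fst p)))"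
  proof (rule tr_eq_sum_list[where \<phi> = "\<lambda>p x. lam (grp * (x * fst p))" and w = "\<lambda>p. T (S (snd p))"])
    show "linH (*) (\<lambda>x. lam (grp * (x * fst p)))" for p by (rule lin)+
    fix x
    have "T x = T (sw (\<lambda>a b. scale (lam (grp * (x * a))) (S b)) Lam)"
      by (simp only: Lam_dual_basis)
    also have "\<dots> = sw (\<lambda>a b. scale (lam (grp * (x * a))) (T (S b))) Lam"
      using T by (simp add: sw_apply[OF T] Vector_Spaces.linear_iff)
    finally show "T x = (\<Sum>p\<leftarrow>cop Lam. scale (lam (grp * (x * fst p))) (T (S (snd p))))"
      by (simp add: sw_def case_prod_unfold)
  qed
  then show ?thesis by (simp add: sw_def case_prod_unfold)
qed

lemma chi_eq_lam: "chi h = lam (grp * (h * qq))"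
proof -
  have "chi h = sw (\<lambda>a b. lam (grp * (h * S b * a))) Lam"
    unfolding chi_def by (rule tr_eq_lam) (rule lin)+
  also have "\<dots> = lam (grp * (h * qq))"
    unfolding qq_def mult.assoc
    by (rule sw_apply[of scale "(*)" "\<lambda>z. lam (grp * (h * z))", symmetric]) (rule lin)+
  finally show ?thesis .
qed

text \<open>From \<open>L\<^sub>1 S(L\<^sub>2) = 1\<close> and the trace property, \<open>\<chi>(z) = \<chi>(z L\<^sub>1 S(L\<^sub>2)) = \<chi>(S(L\<^sub>2) z L\<^sub>1)\<close>.\<close>

lemma chi_central:
  assumes z: "\<And>h. z * h = h * z"
  shows "chi (z * qq) = chi z"
proof -
  have "sw (\<lambda>a b. chi (z * (a * S b))) Lam = \<epsilon> Lam * chi (z * 1)"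
    by (rule sw_antipode_2[where f = "\<lambda>x. chi (z * x)"]) (rule lin)+
  moreover have "chi (z * (a * S b)) = chi (z * (S b * a))" for a b
    by (metis chi_comm mult.assoc z)
  moreover have "sw (\<lambda>a b. chi (z * (S b * a))) Lam = chi (z * qq)"
    unfolding qq_def by (rule sw_apply[of scale "(*)" "\<lambda>x. chi (z * x)", symmetric]) (rule lin)+
  ultimately show ?thesis by (simp add: counit_Lam)
qed

text \<open>By semisimplicity the left ideal \<open>H x\<close> is generated by an idempotent \<open>e\<close>. Its rank is \<open>\<chi>(e) = 0\<close>, so it
  vanishes.\<close>

lemma chi_nondegenerate:
  assumes x: "\<And>h. chi (h * x) = 0"
  shows "x = 0"
proof -
  let ?L = "range (\<lambda>h. h * x)"
  interpret rx: Vector_Spaces.linear scale scale "\<lambda>h. h * x" by (rule lin)+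
  have "left_ideal ?L"
    unfolding left_ideal_def
  proof (intro conjI allI ballI)
    show "subspace ?L" by (rule rx.subspace_image[OF subspace_UNIV])
    show "h * y \<in> ?L" if "y \<in> ?L" for h y
      using that by (auto simp: mult.assoc[symmetric])
  qed
  then obtain M where M: "left_ideal M" "?L \<inter> M = {0}" "\<And>h. \<exists>u\<in>?L. \<exists>v\<in>M. h = u + v"
    using semisimple[unfolded semisimple_def, rule_format, of ?L] by auto
  obtain e f where e: "e \<in> ?L" "f \<in> M" "1 = e + f" using M(3)[of 1] by blast
  have idem: "y * e = y" if y: "y \<in> ?L" for y
  proof -
    have "y * (e + f) = y" unfolding e(3)[symmetric] by simp
    then have yf: "y * f = y - y * e" by (simp add: distrib_left eq_diff_eq add.commute)
    have "y - y * e \<in> ?L"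
      using \<open>left_ideal ?L\<close> y e(1) unfolding left_ideal_def by (blast intro: subspace_diff)
    moreover have "y * f \<in> M" using M(1) e(2) by (simp add: left_ideal_def)
    ultimately have "y * f \<in> {0}" unfolding M(2)[symmetric] using yf by simp
    then show ?thesis using yf by simp
  qed
  have "chi e = 0" using e(1) x by auto
  moreover obtain r where r: "chi e = of_nat r" "r = 0 \<longrightarrow> (\<forall>x. e * x = 0)"
    unfolding chi_def using tr_idempotent[of "\<lambda>x. e * x"] idem[OF e(1)]
    by (auto simp: lin mult.assoc[symmetric])
  ultimately have "r = 0" by simp
  then have "e * 1 = 0" using r(2) by blast
  moreover have "1 * x \<in> ?L" by blast
  then have "x * e = x" using idem by simp
  ultimately show ?thesis by simp
qed

lemma antipode_zero: "S 0 = 0"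
  using antipode_linear module_hom.zero[OF module_hom_linearI] by blast

lemma counit_qq: "\<epsilon> qq = 1"
proof -
  have "\<epsilon> qq = sw (\<lambda>a b. \<epsilon> b * \<epsilon> a) Lam"
    unfolding qq_def by (simp add: sw_apply[OF counit_linear] counit_mult counit_antipode)
  also have "\<dots> = \<epsilon> Lam" by (rule sw_counit_2[OF counit_linear])
  finally show ?thesis by (simp add: counit_Lam)
qed

text \<open>If \<open>q z = 0\<close>, then \<open>\<chi>(h S\<^sup>2(z)) = \<lambda>(g h S\<^sup>2(z) q) = \<lambda>(g h q z) = 0\<close> for all \<open>h\<close>.\<close>

lemma qq_invertible: obtains p where "qq * p = 1" "p * qq = 1"
proof -
  have cancel: "z = 0" if "qq * z = 0" for z
  proof -
    have "chi (h * S (S z)) = 0" for h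
      using that by (simp add: chi_eq_lam mult.assoc qq_comm[symmetric])
        (simp add: lam_basis module_hom.zero[OF module_hom_linearI[OF crd_linear]])
    then have "S (S z) = 0" by (rule chi_nondegenerate)
    then show ?thesis using antipode_inj antipode_zero by metis
  qed
  have "inj (\<lambda>x. qq * x)"
  proof (rule injI)
    fix x y assume "qq * x = qq * y"
    then have "qq * (x - y) = 0" by (simp add: right_diff_distrib)
    then show "x = y" using cancel by fastforce
  qed
  then have "surj (\<lambda>x. qq * x)" by (intro linear_inj_surj lin)
  then obtain p where p: "qq * p = 1" by (metis surjD)
  then have "qq * (p * qq - 1) = 0" by (simp add: right_diff_distrib mult.assoc[symmetric])
  then have "p * qq = 1" using cancel by fastforce
  then show ?thesis using p that by blast
qed

section \<open>The dual is semisimple as well\<close>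

text \<open>Bilinear maps with values in \<open>H\<close> itself suffice here, since the integral property of \<open>\<lambda>\<close> is an equation
  in \<open>H\<close>.\<close>

definition grouplike :: "'h \<Rightarrow> bool" where
  "grouplike k \<longleftrightarrow> (\<forall>F. bilinH scale F \<longrightarrow> sw F k = F k k)"

lemma grouplike_mult:
  assumes "grouplike x" "grouplike y"
  shows "grouplike (x * y)"
  unfolding grouplike_def
proof (intro allI impI)
  fix F assume F: "bilinH scale F"
  note [lin] = bilin_1[OF F] bilin_2[OF F]
  have "sw F (x * y) = sw (\<lambda>a b. sw (\<lambda>c d. F (a * c) (b * d)) y) x" by (rule sw_mult[OF F])
  also have "\<dots> = sw (\<lambda>a b. F (a * y) (b * y)) x"
    by (intro sw_cong assms(2)[unfolded grouplike_def, rule_format]) (rule lin)+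
  also have "\<dots> = F (x * y) (x * y)"
    by (rule assms(1)[unfolded grouplike_def, rule_format]) (rule lin)+
  finally show "sw F (x * y) = F (x * y) (x * y)" .
qed

lemma grouplike_one: "grouplike 1"
  by (simp add: grouplike_def sw_one)

lemma grouplike_grp: "grouplike grp"
  by (simp add: grouplike_def sw_grp)

lemma grouplike_antipode_grp: "grouplike (S grp)"
  unfolding grouplike_def
proof (intro allI impI)
  fix F assume F: "bilinH scale F"
  note [lin] = bilin_1[OF F] bilin_2[OF F]
  have "sw F (S grp) = sw (\<lambda>a b. F (S b) (S a)) grp" by (rule sw_antipode[OF F])
  also have "\<dots> = F (S grp) (S grp)" by (rule sw_grp[where s = scale]) (rule lin)+
  finally show "sw F (S grp) = F (S grp) (S grp)" .
qed

lemma grouplike_power: "grouplike k \<Longrightarrow> grouplike (k ^ i)"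
  by (induction i) (auto intro: grouplike_one grouplike_mult)

lemma lam_grouplike:
  assumes "grouplike k" and "lam k \<noteq> 0"
  shows "k = 1"
proof -
  have "sw (\<lambda>a b. scale (lam b) a) k = scale (lam k) k"
    by (rule assms(1)[unfolded grouplike_def, rule_format]) (rule lin)+
  then show ?thesis using assms(2) by (simp add: lam_left_integral')
qed

text \<open>Let \<open>p = q\<^sup>-\<^sup>1\<close> and suppose \<open>\<lambda>(1) = 0\<close>. A grouplike element on which \<open>\<lambda>\<close> does not vanish equals \<open>1\<close>, so \<open>\<lambda>\<close>
  vanishes on all \<open>g \<cdot> g\<^sup>-\<^sup>i\<close>, that is, \<open>\<chi>(p g\<^sup>-\<^sup>i) = 0\<close>. On the other hand \<open>d = p\<^sup>2 g\<^sup>-\<^sup>1\<close> is central by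
  Radford's formula, and \<open>chi_central\<close> yields \<open>\<chi>(d\<^sup>j p g\<^sup>-\<^sup>1) = \<chi>(d\<^sup>j\<^sup>+\<^sup>1)\<close>. Triangularizing the left
  multiplications by \<open>p\<close> and \<open>g\<^sup>-\<^sup>1\<close> simultaneously, with the common eigenvector \<open>L\<close> first, turns these
  relations into the unsolvable system of eigenvalues. In other words: the dual Hopf algebra satisfies
  Maschke's criterion.\<close>

lemma lam_one_nonzero: "lam 1 \<noteq> 0"
proof
  assume 0: "lam 1 = 0"
  obtain p where p: "qq * p = 1" "p * qq = 1" by (rule qq_invertible)
  let ?g = "S grp"
  have hp: "h * p = p * S (S h)" for h
  proof -
    have "h * p = (p * qq) * h * p" by (simp add: p)
    also have "\<dots> = p * (qq * h) * p" by (simp add: mult.assoc)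
    also have "\<dots> = p * S (S h) * (qq * p)" by (simp add: qq_comm mult.assoc)
    finally show ?thesis by (simp add: p)
  qed
  have gp: "p * ?g = ?g * p" using hp[of ?g] by (simp add: antipode_antipode_grp)
  have gq: "qq * ?g = ?g * qq" using qq_comm[of ?g] by (simp add: antipode_antipode_grp)
  have lam_chi: "lam h = chi (?g * (h * p))" for h
    by (simp add: chi_eq_lam mult.assoc p) (simp add: mult.assoc[symmetric] grp_inverse)
  define d where "d = p * p * ?g"
  have d_central: "d * h = h * d" for h
  proof -
    have "h * d = (h * p) * p * ?g" by (simp only: d_def mult.assoc)
    also have "\<dots> = p * (S (S h) * p) * ?g" by (simp only: hp[of h] mult.assoc)
    also have "\<dots> = p * (p * (S (S (S (S h))) * ?g))" by (simp only: hp[of "S (S h)"] mult.assoc)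
    also have "S (S (S (S h))) * ?g = ?g * h"
      by (simp add: antipode_4_conjugation mult.assoc grp_inverse)
    finally show ?thesis by (simp add: d_def mult.assoc)
  qed
  have d_pow: "d ^ j * h = h * d ^ j" for j h
    by (induction j) (simp_all add: mult.assoc d_central, simp add: mult.assoc[symmetric] d_central)
  have ppg: "p * p * ?g = ?g * (p * p)" by (metis gp mult.assoc)
  have d_eq: "d ^ j = p ^ (2 * j) * ?g ^ j" for j
    unfolding d_def power_mult_commuting[OF ppg] by (simp add: power_mult power2_eq_square)
  have dq: "d * qq = p * ?g"
  proof -
    have "d * qq = p * ((p * qq) * ?g)" by (simp only: d_def gq[symmetric] mult.assoc)
    then show ?thesis by (simp add: p)
  qed
  have eq2: "chi (d ^ j * (p * ?g)) = chi (d ^ Suc j)" for j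
  proof -
    have "d ^ j * (p * ?g) = d ^ Suc j * qq" by (simp add: dq[symmetric] mult.assoc[symmetric] power_commutes)
    then show ?thesis using chi_central[of "d ^ Suc j"] d_pow by metis
  qed
  have eq1: "chi (p * ?g ^ i) = 0" for i
  proof -
    have "grouplike (grp * ?g ^ i)"
      by (intro grouplike_mult grouplike_power grouplike_grp grouplike_antipode_grp)
    then have "lam (grp * ?g ^ i) = 0" using lam_grouplike 0 by metis
    then have "chi (?g * (grp * ?g ^ i * p)) = 0" by (simp add: lam_chi)
    moreover have "?g * (grp * ?g ^ i * p) = ?g ^ i * p"
      by (simp add: mult.assoc[symmetric] grp_inverse)
    ultimately show ?thesis using chi_comm by metis
  qed
  have Lam0: "Lam \<noteq> 0" using counit_Lam module_hom.zero[OF module_hom_linearI[OF counit_linear]] by auto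
  have "\<epsilon> p = 1" using arg_cong[OF p(1), of \<epsilon>] by (simp add: counit_mult counit_qq counit_one)
  then have p_Lam: "p * Lam = Lam" and g_Lam: "?g * Lam = Lam"
    by (simp_all add: Lam_left counit_antipode counit_grp)
  have "p * (?g * x) = ?g * (p * x)" for x by (simp add: mult.assoc[symmetric] gp)
  then obtain X a b where X: "finite X" "Lam \<in> X" "a Lam = 1" "b Lam = 1"
      and tr: "\<And>i j. tr (\<lambda>x. ((\<lambda>x. p * x) ^^ i) (((\<lambda>x. ?g * x) ^^ j) x)) = (\<Sum>v\<in>X. a v ^ i * b v ^ j)"
    using commuting_triangular[of "\<lambda>x. p * x" "\<lambda>x. ?g * x" Lam] Lam0 p_Lam g_Lam by (auto simp: lin)
  have funpow: "((\<lambda>x. c * x) ^^ i) x = c ^ i * x" for c x :: 'h and i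
    by (induction i) (simp_all add: mult.assoc)
  have chi_sum: "chi (p ^ i * ?g ^ j) = (\<Sum>v\<in>X. a v ^ i * b v ^ j)" for i j
    using tr[of i j] by (simp add: chi_def funpow mult.assoc)
  show False
  proof (rule eigenvalue_system_unsolvable[where X = X and a = a and b = b, OF X(1) _ _ X(2-4)])
    show "(\<Sum>x\<in>X. a x * b x ^ i) = 0" for i using eq1[of i] chi_sum[of 1 i] by simp
    fix j
    have "?g ^ j * p = p * ?g ^ j" by (rule power_commuting_commutes[OF gp[symmetric]])
    then have "d ^ j * (p * ?g) = p ^ (2 * j) * (p * ?g ^ j) * ?g"
      by (simp only: d_eq mult.assoc) (simp only: mult.assoc[symmetric])
    also have "\<dots> = p ^ Suc (2 * j) * ?g ^ Suc j" by (simp only: power_Suc2 mult.assoc)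
    finally have "(\<Sum>v\<in>X. a v ^ Suc (2 * j) * b v ^ Suc j) = (\<Sum>v\<in>X. a v ^ (2 * Suc j) * b v ^ Suc j)"
      using eq2[of j] chi_sum[of "Suc (2 * j)" "Suc j"] chi_sum[of "2 * Suc j" "Suc j"] d_eq[of "Suc j"] by simp
    moreover have "a v ^ Suc (2 * j) * b v ^ Suc j = a v * b v * ((a v)\<^sup>2 * b v) ^ j" for v
      by (simp add: power_mult_distrib mult_ac flip: power_mult)
    moreover have "a v ^ (2 * Suc j) * b v ^ Suc j = ((a v)\<^sup>2 * b v) ^ Suc j" for v
      by (simp only: power_mult_distrib power_mult)
    ultimately show "(\<Sum>x\<in>X. a x * b x * ((a x)\<^sup>2 * b x) ^ j) = (\<Sum>x\<in>X. ((a x)\<^sup>2 * b x) ^ Suc j)"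
      by (simp only:)
  qed
qed

lemma grp_one: "grp = 1"
proof -
  have "sw (\<lambda>a b. scale (lam a) b) 1 = scale (lam 1) grp"
    by (rule lam_right_integral) (rule lin)+
  moreover have "sw (\<lambda>a b. scale (lam a) b) 1 = scale (lam 1) 1"
    by (rule sw_one) (rule lin)+
  ultimately show ?thesis using lam_one_nonzero by simp
qed

lemma antipode_order_4: "S (S (S (S c))) = c"
  using antipode_4_conjugation[of c] by (simp add: grp_one antipode_one)

section \<open>The antipode is an involution\<close>

lemma sw_antipode_cubed:
  assumes f: "linH s f"
  shows "sw (\<lambda>a b. f (S (S (S b)) * a)) h = s (\<epsilon> h) (f 1)"
proof -
  have "sw (\<lambda>a b. f (S (S (S (S a * b))))) h = s (\<epsilon> h) (f (S (S (S 1))))"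
    by (rule sw_antipode_1[where f = "\<lambda>z. f (S (S (S z)))"]) (rule lin lin_comp[OF f])+
  then show ?thesis by (simp add: antipode_mult antipode_order_4 antipode_one)
qed

text \<open>By \<open>tr_eq_lam\<close> the trace is \<open>\<Sum> f(S(L\<^sub>3)) \<lambda>(S\<^sup>3(L\<^sub>2) L\<^sub>1)\<close>, and \<open>S\<^sup>3 = S\<^sup>-\<^sup>1\<close> makes \<open>S\<^sup>3(L\<^sub>2) L\<^sub>1\<close> collapse.\<close>

lemma tr_twisted_convolution:
  assumes f: "linH (*) f"
  shows "tr (sw (\<lambda>u v. scale (f u) (S (S v)))) = lam 1 * f Lam"
proof -
  note [lin] = lin_comp[OF f]
  let ?T = "sw (\<lambda>u v. scale (f u) (S (S v)))"
  have T: "linH scale ?T" by (rule linH_sw) (rule lin)+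
  have "tr ?T = sw (\<lambda>a b. lam (?T (S b) * a)) Lam"
    using tr_eq_lam[OF T] by (simp add: grp_one)
  also have "\<dots> = sw (\<lambda>a b. sw (\<lambda>u v. lam (scale (f u) (S (S v)) * a)) (S b)) Lam"
    by (intro sw_cong sw_apply[of scale "(*)" "\<lambda>z. lam (z * a)" for a]) (rule lin)+
  also have "\<dots> = sw (\<lambda>a b. sw (\<lambda>u v. f u * lam (S (S v) * a)) (S b)) Lam"
    using lin_lam[OF lin_ident] by (simp add: scale_mult_left Vector_Spaces.linear_iff)
  also have "\<dots> = sw (\<lambda>a b. sw (\<lambda>u v. f (S v) * lam (S (S (S u)) * a)) b) Lam"
    by (intro sw_cong sw_antipode[where s = "(*)"]) (rule lin)+
  also have "\<dots> = sw (\<lambda>p v. sw (\<lambda>a u. f (S v) * lam (S (S (S u)) * a)) p) Lam"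
    by (rule sw_coassoc[where s = "(*)", symmetric]) (rule lin)+
  also have "\<dots> = sw (\<lambda>p v. \<epsilon> p * (f (S v) * lam 1)) Lam"
    by (intro sw_cong sw_antipode_cubed[where f = "\<lambda>z. f (S v) * lam z" for v]) (rule lin)+
  also have "\<dots> = f (S Lam) * lam 1"
    by (rule sw_counit_1[where f = "\<lambda>v. f (S v) * lam 1"]) (rule lin)+
  finally show ?thesis by (simp add: antipode_Lam)
qed

text \<open>This is the isomorphism of \<open>H \<otimes> H\<close> with a free module of rank \<open>dim H\<close>, on the level of characters. Since
  \<open>E\<^sub>2 S\<^sup>3(E\<^sub>1)\<close> collapses, \<open>\<chi>(h\<^sub>1) e(h\<^sub>2 E)\<close> can be rewritten so that the partial trace identity applies; what
  remains is \<open>\<chi>(x\<^sub>1 S\<^sup>3(x\<^sub>2))\<close>, which collapses because \<open>\<chi>\<close> is a trace.\<close>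

lemma chi_convolution: "sw (\<lambda>a b. chi a * chi b) h = of_nat (card Bas) * chi h"
proof -
  let ?S3 = "\<lambda>x. S (S (S x))"
  have S3: "?S3 (x * S y) = y * ?S3 x" for x y by (simp add: antipode_mult antipode_order_4)
  have L: "sw (\<lambda>e1 e2. sw (\<lambda>x1 x2. crd e x2 * chi (x1 * ?S3 e1)) (h * e2)) e =
      sw (\<lambda>a b. crd e (b * e) * chi a) h" for e
  proof -
    have "sw (\<lambda>e1 w. sw (\<lambda>x1 x2. crd e x2 * chi (x1 * ?S3 e1)) (h * w)) e =
        sw (\<lambda>e1 w. sw (\<lambda>a b. sw (\<lambda>c d. crd e (b * d) * chi (a * c * ?S3 e1)) w) h) e"
      by (intro sw_cong sw_mult[where s = "(*)"]) (rule lin)+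
    also have "\<dots> = sw (\<lambda>a b. sw (\<lambda>e1 w. sw (\<lambda>c d. crd e (b * d) * chi (a * c * ?S3 e1)) w) e) h"
      by (rule sw_swap)
    also have "\<dots> = sw (\<lambda>a b. sw (\<lambda>p e3. sw (\<lambda>e1 e2. crd e (b * e3) * chi (a * ?S3 (e1 * S e2))) p) e) h"
      unfolding S3 mult.assoc by (intro sw_cong sw_coassoc[where s = "(*)", symmetric]) (rule lin)+
    also have "\<dots> = sw (\<lambda>a b. sw (\<lambda>p e3. \<epsilon> p * (crd e (b * e3) * chi (a * ?S3 1))) e) h"
      by (intro sw_cong sw_antipode_2[where f = "\<lambda>z. crd e (b * e3) * chi (a * ?S3 z)" for a b e3]) (rule lin)+
    also have "\<dots> = sw (\<lambda>a b. crd e (b * e) * chi (a * ?S3 1)) h"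
      by (intro sw_cong sw_counit_1[where f = "\<lambda>e3. crd e (b * e3) * chi (a * ?S3 1)" for a b]) (rule lin)+
    finally show ?thesis by (simp add: antipode_one)
  qed
  have R: "sw (\<lambda>x1 x2. sw (\<lambda>y1 y2. crd c y2 * chi (x1 * ?S3 y1)) x2) x = crd c x * chi 1" for c x
  proof -
    have "sw (\<lambda>x1 x2. sw (\<lambda>y1 y2. crd c y2 * chi (?S3 y1 * x1)) x2) x =
        sw (\<lambda>p y2. sw (\<lambda>x1 y1. crd c y2 * chi (?S3 y1 * x1)) p) x"
      by (rule sw_coassoc[where s = "(*)", symmetric]) (rule lin)+
    also have "\<dots> = sw (\<lambda>p y2. \<epsilon> p * (crd c y2 * chi 1)) x"
      by (intro sw_cong sw_antipode_cubed[where f = "\<lambda>z. crd c y * chi z" for y]) (rule lin)+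
    also have "\<dots> = crd c x * chi 1"
      by (rule sw_counit_1[where f = "\<lambda>y. crd c y * chi 1"]) (rule lin)+
    finally show ?thesis by (simp add: chi_comm)
  qed
  have "sw (\<lambda>a b. chi a * chi b) h = (\<Sum>e\<in>Bas. sw (\<lambda>a b. crd e (b * e) * chi a) h)"
    unfolding sw_sum[symmetric] by (simp add: chi_basis sum_distrib_right[symmetric] mult.commute)
  also have "\<dots> = (\<Sum>e\<in>Bas. sw (\<lambda>e1 e2. sw (\<lambda>x1 x2. crd e x2 * chi (x1 * ?S3 e1)) (h * e2)) e)"
    by (simp only: L)
  also have "\<dots> = (\<Sum>c\<in>Bas. sw (\<lambda>x1 x2. sw (\<lambda>y1 y2. crd c y2 * chi (x1 * ?S3 y1)) x2) (h * c))"
    by (rule sw_partial_trace[where s = "(*)" and G = "\<lambda>x y. chi (x * ?S3 y)"]) (rule lin)+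
  also have "\<dots> = chi h * chi 1"
    by (simp only: R) (simp add: chi_basis sum_distrib_right)
  finally show ?thesis by (simp add: chi_one)
qed

lemma chi_antipode_antipode: "chi (S (S u)) = chi u"
proof -
  have "chi (S (S u)) = tr (\<lambda>x. S (S (u * S (S x))))"
    by (simp add: chi_def antipode_mult antipode_order_4)
  also have "\<dots> = tr (\<lambda>x. u * S (S (S (S x))))"
    by (rule tr_comm[of "\<lambda>x. S (S x)" "\<lambda>x. u * S (S x)"]) (rule lin)+
  finally show ?thesis by (simp add: chi_def antipode_order_4)
qed

text \<open>\<open>E\<close> is the sum and \<open>T\<close> the difference of the idempotents \<open>(E + T) / 2\<close> and \<open>(E - T) / 2\<close>, whose ranks are \<open>r\<close>
  and \<open>s\<close>.\<close>

lemma trace_partial_involution: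
  assumes E: "linH scale E" "\<And>x. E (E x) = E x" and T: "linH scale T" "\<And>x. T (T x) = E x"
    and ET: "\<And>x. E (T x) = T x" "\<And>x. T (E x) = T x"
  shows "\<exists>r s. tr T = of_nat r - of_nat s \<and> tr E = of_nat r + of_nat s \<and>
    (r = 0 \<longrightarrow> (\<forall>x. T x = - E x)) \<and> (s = 0 \<longrightarrow> (\<forall>x. T x = E x))"
proof -
  let ?A = "\<lambda>x. scale (1/2) (E x + T x)" and ?B = "\<lambda>x. scale (1/2) (E x + scale (-1) (T x))"
  interpret E: Vector_Spaces.linear scale scale E by (rule E)
  interpret T: Vector_Spaces.linear scale scale T by (rule T)
  have half: "scale (1/2) (x + x) = x" for x
    by (simp add: scale_right_distrib scale_left_distrib[symmetric])
  have "linH scale ?A" "linH scale ?B"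
    unfolding Vector_Spaces.linear_iff
    by (simp_all add: vector_space_axioms E.add T.add E.scale T.scale scale_right_distrib
        scale_right_diff_distrib add_ac mult.commute)
  moreover have "?A (?A x) = ?A x" for x
    unfolding E.scale T.scale E.add T.add E(2) T(2) ET
    using half[of "?A x"] by (simp add: scale_right_distrib add_ac)
  moreover have "?B (?B x) = ?B x" for x
    unfolding E.scale T.scale E.add T.add E(2) T(2) ET
    using half[of "?B x"] by (simp add: scale_right_distrib scale_right_diff_distrib algebra_simps)
  ultimately obtain r s where rs: "tr ?A = of_nat r" "r = 0 \<longrightarrow> (\<forall>x. ?A x = 0)"
      "tr ?B = of_nat s" "s = 0 \<longrightarrow> (\<forall>x. ?B x = 0)"
    using tr_idempotent[of ?A] tr_idempotent[of ?B] by auto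
  have "tr ?A = (tr E + tr T) / 2" "tr ?B = (tr E - tr T) / 2"
    by (simp_all only: tr_scale tr_add) simp_all
  then have sum: "tr E + tr T = 2 * of_nat r" and diff: "tr E - tr T = 2 * of_nat s"
    using rs(1,3) by (simp_all add: field_simps)
  have "2 * tr T = (tr E + tr T) - (tr E - tr T)" by simp
  also have "\<dots> = 2 * (of_nat r - of_nat s)" unfolding sum diff by (simp add: right_diff_distrib)
  finally have "tr T = of_nat r - of_nat s" by (simp only: mult_cancel_left) simp
  moreover have "2 * tr E = (tr E + tr T) + (tr E - tr T)" by simp
  then have "2 * tr E = 2 * (of_nat r + of_nat s)" unfolding sum diff by (simp add: distrib_left)
  then have "tr E = of_nat r + of_nat s" by (simp only: mult_cancel_left) simp
  moreover have "r = 0 \<longrightarrow> (\<forall>x. T x = - E x)" "s = 0 \<longrightarrow> (\<forall>x. T x = E x)"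
    using rs by (auto simp: eq_neg_iff_add_eq_0 add.commute)
  ultimately show ?thesis by blast
qed

text \<open>\<open>trace_partial_involution\<close> is applied to \<open>S\<^sup>2\<close> itself, giving \<open>\<lambda>(1) = r\<^sub>0 - s\<^sub>0\<close> and \<open>dim H = r\<^sub>0 + s\<^sub>0\<close>, and to
  \<open>S\<^sup>2\<close> composed with the idempotent \<open>h \<mapsto> \<chi>(h\<^sub>1) h\<^sub>2 / dim H\<close>, giving \<open>\<lambda>(1) / dim H = r - s\<close>. A nonzero
  difference \<open>r\<^sub>0 - s\<^sub>0\<close> that is divisible by the sum \<open>r\<^sub>0 + s\<^sub>0\<close> leaves only \<open>r\<^sub>0 = 0\<close> or \<open>s\<^sub>0 = 0\<close>.\<close>

theorem antipode_involution: "S (S x) = x"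
proof -
  let ?n = "of_nat (card Bas) :: 'k"
  have "Bas \<noteq> {}" using Bas(2) one_neq_zero[where 'a = 'h] by (metis UNIV_I singletonD span_empty)
  then have n: "card Bas > 0" using finite_Bas by (simp add: card_gt_0_iff)
  have lin2: "linH scale (\<lambda>x. S (S x))" by (rule lin)+
  obtain r0 s0 where r0: "tr (\<lambda>x. S (S x)) = of_nat r0 - of_nat s0" "tr (\<lambda>x. x) = of_nat r0 + of_nat s0"
      "r0 = 0 \<longrightarrow> (\<forall>x. S (S x) = - x)" "s0 = 0 \<longrightarrow> (\<forall>x. S (S x) = x)"
    using trace_partial_involution[of "\<lambda>x. x" "\<lambda>x. S (S x)", OF lin_ident refl lin2] antipode_order_4 by auto
  have lam1: "lam 1 = of_nat r0 - of_nat s0" using r0(1) by (simp add: lam_def)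
  have "of_nat (card Bas) = (of_nat (r0 + s0) :: 'k)" using r0(2) by (simp add: tr_ident)
  then have n_eq: "card Bas = r0 + s0" by (simp only: of_nat_eq_iff)
  let ?conv = "sw (\<lambda>u v. scale (chi u) v)"
  let ?E = "\<lambda>x. scale (1 / ?n) (?conv x)" and ?T = "\<lambda>x. scale (1 / ?n) (S (S (?conv x)))"
  have E0: "linH scale ?conv" by (rule linH_sw) (rule lin)+
  have E0_add: "?conv (x + y) = ?conv x + ?conv y" and E0_scale: "?conv (scale c x) = scale c (?conv x)" for c x y
    using E0 by (simp_all add: Vector_Spaces.linear_iff)
  have S_scale: "S (scale c x) = scale c (S x)" for c x
    using antipode_linear by (simp add: Vector_Spaces.linear_iff)
  have E0E0: "?conv (?conv x) = scale ?n (?conv x)" for x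
  proof -
    have "?conv (?conv x) = sw (\<lambda>u v. sw (\<lambda>c d. scale (chi u) (scale (chi c) d)) v) x"
      by (simp add: sw_apply[OF E0] E0_scale sw_apply[OF linear_scale_self])
    also have "\<dots> = sw (\<lambda>p d. sw (\<lambda>u c. scale (chi u) (scale (chi c) d)) p) x"
      by (rule sw_coassoc[where s = scale, symmetric]) (rule lin)+
    also have "\<dots> = sw (\<lambda>p d. scale (sw (\<lambda>u c. chi u * chi c) p) d) x"
      by (simp add: sw_apply[OF linear_scale_left])
    also have "\<dots> = scale ?n (?conv x)"
      by (simp add: chi_convolution sw_apply[OF linear_scale_self])
    finally show ?thesis .
  qed
  have E0S: "?conv (S (S x)) = S (S (?conv x))" for x
  proof -
    have "?conv (S (S x)) = sw (\<lambda>a b. scale (chi (S b)) (S a)) (S x)"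
      by (rule sw_antipode[where s = scale and F = "\<lambda>u v. scale (chi u) v"]) (rule lin)+
    also have "\<dots> = sw (\<lambda>a b. scale (chi (S (S a))) (S (S b))) x"
      by (rule sw_antipode[where s = scale and F = "\<lambda>a b. scale (chi (S b)) (S a)"]) (rule lin)+
    also have "\<dots> = S (S (?conv x))"
      by (simp add: chi_antipode_antipode sw_apply[OF lin2] S_scale)
    finally show ?thesis .
  qed
  have "linH scale ?E" "linH scale ?T"
    by (rule lin_scale_2[OF E0], rule lin_scale_2[OF lin_comp[OF lin2 E0]])
  moreover have "?E (?E x) = ?E x" "?T (?T x) = ?E x" "?E (?T x) = ?T x" "?T (?E x) = ?T x" for x
    using n by (simp_all add: E0_scale S_scale E0S E0E0 antipode_order_4)
  ultimately obtain r s where "tr ?T = of_nat r - of_nat s"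
    using trace_partial_involution[of ?E ?T] by auto
  moreover have "tr ?T = lam 1 / ?n"
  proof -
    have "sw (\<lambda>u v. scale (chi u) (S (S v))) = (\<lambda>x. S (S (?conv x)))"
      by (rule ext) (simp add: sw_apply[OF lin2] S_scale)
    then have "tr (\<lambda>x. S (S (?conv x))) = lam 1"
      using tr_twisted_convolution[of chi] lin_chi[OF lin_ident] by (simp add: chi_Lam)
    then show ?thesis by (simp add: tr_scale)
  qed
  ultimately have "lam 1 = ?n * (of_nat r - of_nat s)" using n by (simp add: field_simps)
  then have "(of_int (int r0 - int s0) :: 'k) = of_int ((int r0 + int s0) * (int r - int s))"
    using lam1 n_eq by simp
  then have eq: "int r0 - int s0 = (int r0 + int s0) * (int r - int s)" by (simp only: of_int_eq_iff)
  have "r0 \<noteq> s0" using lam1 lam_one_nonzero by auto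
  have "int r - int s \<noteq> 0"
  proof
    assume "int r - int s = 0"
    then show False using eq \<open>r0 \<noteq> s0\<close> by simp
  qed
  then have "1 \<le> \<bar>int r - int s\<bar>" by linarith
  from mult_left_mono[OF this, of "int r0 + int s0"]
  have "int r0 + int s0 \<le> \<bar>(int r0 + int s0) * (int r - int s)\<bar>" by (simp add: abs_mult)
  then have "r0 = 0 \<or> s0 = 0" using eq by linarith
  moreover have "r0 \<noteq> 0"
  proof
    assume "r0 = 0"
    then have "S (S 1) = - 1" using r0(3) by blast
    then have "1 + 1 = (0 :: 'h)" by (simp add: antipode_one eq_neg_iff_add_eq_0)
    then have "scale 2 1 = (0 :: 'h)"
      using scale_left_distrib[of 1 1 "1 :: 'h"] by simp
    then show False by simp
  qed
  ultimately show ?thesis using r0(4) by blast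
qed

text \<open>Every functional is of the form \<open>f = \<lambda>(h \<cdot>)\<close>, and then \<open>f(L\<^sub>2) L\<^sub>1 = S(h)\<close>, while \<open>f(L\<^sub>1) L\<^sub>2 = S\<^sup>-\<^sup>1(h) g\<close>. For
  \<open>g = 1\<close> and \<open>S\<^sup>2 = id\<close> the two agree.\<close>

lemma Lam_cocommutative:
  assumes F: "bilinH s F"
  shows "sw F Lam = sw (\<lambda>a b. F b a) Lam"
proof -
  interpret s: vector_space s by (rule bilinH_target[OF F])
  have lin1: "linH s (\<lambda>a. F a b)" and lin2: "linH s (F a)" for a b
    using F by (auto simp: bilinH_def)
  have swap: "sw (\<lambda>a b. scale (f a) b) Lam = sw (\<lambda>a b. scale (f b) a) Lam" if f: "linH (*) f" for f
  proof -
    obtain h where h: "\<And>x. f x = lam (h * x)" by (rule functional_eq_lam[OF f]) auto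
    have "sw (\<lambda>a b. scale (lam (S (S h) * a)) b) Lam = sw (\<lambda>a b. scale (lam a) (S h * b)) Lam"
      by (rule Lam_antipode_left[where F = "\<lambda>a b. scale (lam a) b"]) (rule lin)+
    also have "\<dots> = scale (lam Lam) (S h * grp)" by (rule lam_right_integral) (rule lin)+
    finally show ?thesis by (simp add: h antipode_via_lam antipode_involution lam_Lam grp_one)
  qed
  have "sw F Lam = sw (\<lambda>a b. \<Sum>c\<in>Bas. s (crd c a) (F c b)) Lam"
    by (intro sw_cong linear_expand[OF lin1])
  also have "\<dots> = (\<Sum>c\<in>Bas. F c (sw (\<lambda>a b. scale (crd c a) b) Lam))"
    using lin2 by (simp add: sw_sum sw_apply[OF lin2] Vector_Spaces.linear_iff)
  also have "\<dots> = (\<Sum>c\<in>Bas. F c (sw (\<lambda>a b. scale (crd c b) a) Lam))"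
    by (simp only: swap[OF crd_linear])
  also have "\<dots> = sw (\<lambda>a b. \<Sum>c\<in>Bas. s (crd c b) (F c a)) Lam"
    using lin2 by (simp add: sw_sum sw_apply[OF lin2] Vector_Spaces.linear_iff)
  also have "\<dots> = sw (\<lambda>a b. F b a) Lam"
    by (intro sw_cong linear_expand[OF lin1, symmetric])
  finally show ?thesis .
qed

end

section \<open>Iterated Sweedler sums\<close>

lemma multilinearD:
  "multilinear s t n F \<Longrightarrow> length vs = n \<Longrightarrow> i < n \<Longrightarrow> Vector_Spaces.linear s t (\<lambda>v. F (vs[i := v]))"
  by (auto simp: multilinear_def)

lemma multilinear_Cons:
  assumes "multilinear s t (Suc n) F"
  shows "multilinear s t n (\<lambda>xs. F (a # xs))"
  unfolding multilinear_def
proof (intro allI impI)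
  fix vs :: "'b list" and i assume "length vs = n" "i < n"
  then show "Vector_Spaces.linear s t (\<lambda>v. F (a # vs[i := v]))"
    using multilinearD[OF assms, of "a # vs" "Suc i"] by simp
qed

lemma multilinear_head:
  assumes "multilinear s t (Suc n) F" and "length xs = n"
  shows "Vector_Spaces.linear s t (\<lambda>a. F (a # xs))"
  using multilinearD[OF assms(1), of "undefined # xs" 0] assms(2) by simp

lemma multilinear_snoc:
  assumes "multilinear s t (Suc n) F"
  shows "multilinear s t n (\<lambda>xs. F (xs @ [a]))"
  unfolding multilinear_def
proof (intro allI impI)
  fix vs :: "'b list" and i assume "length vs = n" "i < n"
  then show "Vector_Spaces.linear s t (\<lambda>v. F (vs[i := v] @ [a]))"
    using multilinearD[OF assms, of "vs @ [a]" i] by (simp add: list_update_append)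
qed

lemma multilinear_last:
  assumes "multilinear s t (Suc n) F" and "length xs = n"
  shows "Vector_Spaces.linear s t (\<lambda>a. F (xs @ [a]))"
  using multilinearD[OF assms(1), of "xs @ [undefined]" n] assms(2) by (simp add: list_update_append)

lemma multilinear_target: "multilinear s t (Suc n) F \<Longrightarrow> vector_space t"
  using multilinear_head[of s t n F "replicate n undefined"] by (simp add: Vector_Spaces.linear_iff)

context hopf_algebra
begin

text \<open>The Sweedler sum \<open>\<Sum> F [h\<^sub>1, \<dots>, h\<^sub>n\<^sub>+\<^sub>1]\<close>, obtained by splitting the last factor repeatedly. This recursion
  matches the constructors of lists; \<open>swn_split_first\<close> and \<open>tensor_lift_iter_comult\<close> compare it with
  \<^const>\<open>iter_comult\<close>, which splits the first factor.\<close>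

primrec swn :: "nat \<Rightarrow> ('h list \<Rightarrow> 'w::comm_monoid_add) \<Rightarrow> 'h \<Rightarrow> 'w" where
  "swn 0 = (\<lambda>F h. F [h])"
| "swn (Suc n) = (\<lambda>F h. sw (\<lambda>a b. swn n (\<lambda>xs. F (a # xs)) b) h)"

lemma swn_cong:
  "(\<And>xs. length xs = Suc n \<Longrightarrow> F xs = G xs) \<Longrightarrow> swn n F h = swn n G h"
proof (induction n arbitrary: F G h)
  case (Suc n)
  have "swn n (\<lambda>xs. F (a # xs)) b = swn n (\<lambda>xs. G (a # xs)) b" for a b
    by (rule Suc.IH) (simp add: Suc.prems)
  then show ?case unfolding swn.simps by (rule sw_cong)
qed simp

lemma swn_apply:
  "Vector_Spaces.linear s t g \<Longrightarrow> g (swn n F h) = swn n (\<lambda>xs. g (F xs)) h"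
  by (induction n arbitrary: F h) (simp_all add: sw_apply)

lemma swn_add: "swn n (\<lambda>xs. F xs + G xs) h = swn n F h + swn n G h"
proof (induction n arbitrary: F G h)
  case (Suc n)
  show ?case unfolding swn.simps sw_add[symmetric] by (intro sw_cong Suc)
qed simp

lemma swn_sum: "swn n (\<lambda>xs. \<Sum>i\<in>I. F i xs) h = (\<Sum>i\<in>I. swn n (F i) h)"
proof (induction n arbitrary: F h)
  case (Suc n)
  show ?case unfolding swn.simps sw_sum[symmetric] by (intro sw_cong Suc)
qed simp

lemma swn_sw_swap: "swn n (\<lambda>xs. sw (\<lambda>a b. F a b xs) g) h = sw (\<lambda>a b. swn n (F a b) h) g"
proof (induction n arbitrary: F h)
  case (Suc n)
  have "swn (Suc n) (\<lambda>xs. sw (\<lambda>a b. F a b xs) g) h =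
      sw (\<lambda>c d. sw (\<lambda>a b. swn n (\<lambda>xs. F a b (c # xs)) d) g) h"
    unfolding swn.simps by (intro sw_cong Suc)
  also have "\<dots> = sw (\<lambda>a b. sw (\<lambda>c d. swn n (\<lambda>xs. F a b (c # xs)) d) h) g"
    by (rule sw_swap)
  finally show ?case by simp
qed simp

lemma swn_swap: "swn m (\<lambda>xs. swn n (F xs) g) h = swn n (\<lambda>ys. swn m (\<lambda>xs. F xs ys) h) g"
proof (induction n arbitrary: F g)
  case (Suc n)
  have "swn m (\<lambda>xs. swn (Suc n) (F xs) g) h = sw (\<lambda>a b. swn m (\<lambda>xs. swn n (\<lambda>ys. F xs (a # ys)) b) h) g"
    unfolding swn.simps by (rule swn_sw_swap)
  also have "\<dots> = sw (\<lambda>a b. swn n (\<lambda>ys. swn m (\<lambda>xs. F xs (a # ys)) h) b) g"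
    by (intro sw_cong Suc)
  finally show ?case by simp
qed simp

lemma linH_swn_par:
  "(\<And>xs. length xs = Suc n \<Longrightarrow> linH s (\<lambda>a. G a xs)) \<Longrightarrow> linH s (\<lambda>a. swn n (G a) h)"
proof (induction n arbitrary: G h)
  case (Suc n)
  show ?case unfolding swn.simps
    by (intro lin_sw_par Suc.IH) (simp add: Suc.prems)
qed simp

lemma linH_swn: "multilinear scale s (Suc n) F \<Longrightarrow> linH s (swn n F)"
proof (induction n arbitrary: F)
  case 0
  show ?case using multilinear_head[OF 0, of "[]"] by simp
next
  case (Suc n)
  have "linH s (\<lambda>a. swn n (\<lambda>xs. F (a # xs)) b)" for b
    by (rule linH_swn_par) (rule multilinear_head[OF Suc.prems])
  moreover have "linH s (swn n (\<lambda>xs. F (a # xs)))" for a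
    by (rule Suc.IH[OF multilinear_Cons[OF Suc.prems]])
  ultimately show ?case by (simp add: linH_sw bilinH_def)
qed

lemma swn_snoc:
  "multilinear scale s (Suc (Suc n)) F \<Longrightarrow> swn (Suc n) F h = sw (\<lambda>a b. swn n (\<lambda>xs. F (xs @ [b])) a) h"
proof (induction n arbitrary: F h)
  case (Suc n)
  note ml = multilinear_Cons[OF Suc.prems]
  have "swn (Suc (Suc n)) F h = sw (\<lambda>a b. sw (\<lambda>c d. swn n (\<lambda>xs. F (a # xs @ [d])) c) b) h"
    unfolding swn.simps(2)[of "Suc n"] by (intro sw_cong Suc.IH[OF ml])
  also have "\<dots> = sw (\<lambda>p d. sw (\<lambda>a c. swn n (\<lambda>xs. F (a # xs @ [d])) c) p) h"
  proof (rule sw_coassoc[where s = s, symmetric])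
    show "linH s (\<lambda>a. swn n (\<lambda>xs. F (a # xs @ [d])) c)" for c d
      by (rule linH_swn_par) (rule multilinear_head[OF Suc.prems], simp)
    show "linH s (swn n (\<lambda>xs. F (a # xs @ [d])))" for a d
      by (rule linH_swn) (use multilinear_snoc[OF ml] in simp)
    show "linH s (\<lambda>d. swn n (\<lambda>xs. F (a # xs @ [d])) c)" for a c
      by (rule linH_swn_par) (use multilinear_last[OF ml] in simp)
  qed
  finally show ?case by simp
qed simp

lemma swn_split_first:
  assumes ml: "multilinear scale s (Suc (Suc n)) F"
  shows "swn n (\<lambda>xs. sw (\<lambda>a b. F (a # b # tl xs)) (hd xs)) h = swn (Suc n) F h"
proof (cases n)
  case (Suc k)
  note ml = ml[unfolded Suc]
  have "swn n (\<lambda>xs. sw (\<lambda>a b. F (a # b # tl xs)) (hd xs)) h =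
      sw (\<lambda>x y. sw (\<lambda>a b. swn k (\<lambda>xs. F (a # b # xs)) y) x) h"
    unfolding Suc swn.simps list.sel by (intro sw_cong swn_sw_swap)
  also have "\<dots> = sw (\<lambda>a w. sw (\<lambda>b y. swn k (\<lambda>xs. F (a # b # xs)) y) w) h"
  proof (rule sw_coassoc[where s = s])
    show "linH s (\<lambda>a. swn k (\<lambda>xs. F (a # b # xs)) y)" for b y
      by (rule linH_swn_par) (rule multilinear_head[OF ml], simp)
    show "linH s (\<lambda>b. swn k (\<lambda>xs. F (a # b # xs)) y)" for a y
      by (rule linH_swn_par) (rule multilinear_head[OF multilinear_Cons[OF ml]], simp)
    show "linH s (swn k (\<lambda>xs. F (a # b # xs)))" for a b
      by (rule linH_swn) (rule multilinear_Cons[OF multilinear_Cons[OF ml]])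
  qed
  finally show ?thesis by (simp add: Suc)
qed simp

lemma swn_in_power:
  "(\<And>xs. T xs \<in> tensor_power k) \<Longrightarrow> swn n T h \<in> tensor_power k"
proof (induction n arbitrary: T h)
  case (Suc n)
  show ?case unfolding swn.simps sw_def case_prod_unfold
    by (intro tensor_power_sum_list Suc)
qed simp

lemma tensor_lift_swn:
  assumes vs: "vector_space s" and ml: "multilinear scale s k F"
  shows "(\<And>xs. T xs \<in> tensor_power k) \<Longrightarrow>
    tensor_lift s k F (swn n T h) = swn n (\<lambda>xs. tensor_lift s k F (T xs)) h"
proof (induction n arbitrary: T h)
  case (Suc n)
  have "tensor_lift s k F (swn (Suc n) T h) =
      (\<Sum>p\<leftarrow>cop h. tensor_lift s k F (swn n (\<lambda>xs. T (fst p # xs)) (snd p)))"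
    unfolding swn.simps sw_def case_prod_unfold
    by (intro tensor_lift_sum_list vs ml swn_in_power Suc.prems)
  also have "\<dots> = swn (Suc n) (\<lambda>xs. tensor_lift s k F (T xs)) h"
    unfolding swn.simps sw_def case_prod_unfold by (simp only: Suc.IH[OF Suc.prems])
  finally show ?case .
qed simp

lemma tensor_lift_iter_comult:
  "multilinear scale s (Suc n) F \<Longrightarrow> tensor_lift s (Suc n) F (iter_comult n h) = swn n F h"
proof -
  have lift: "tensor_lift s (Suc n) F (iter_comult n h) = swn n F h"
    if ml: "multilinear scale s (Suc n) F" and eq: "iter_comult n h = swn n tensor h"
    for s :: "'k \<Rightarrow> 'x::ab_group_add \<Rightarrow> 'x" and F n
  proof -
    note vs = multilinear_target[OF ml]
    let ?T = "\<lambda>xs. if length xs = Suc n then tensor xs else 0"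
    have T: "?T xs \<in> tensor_power (Suc n)" for xs
      using tensor_space.subspace_0[OF tensor_power_subspace] by (simp add: tensor_in_power)
    have "iter_comult n h = swn n ?T h"
      unfolding eq by (rule swn_cong) simp
    then have "tensor_lift s (Suc n) F (iter_comult n h) = swn n (\<lambda>xs. tensor_lift s (Suc n) F (?T xs)) h"
      by (simp only: tensor_lift_swn[where T = ?T, OF vs ml T])
    also have "\<dots> = swn n F h"
      by (rule swn_cong) (simp add: tensor_lift_tensor[OF vs ml])
    finally show ?thesis .
  qed
  have eq: "iter_comult n h = swn n tensor h" for n
  proof (induction n)
    case (Suc n)
    let ?K = "\<lambda>xs. sw (\<lambda>a b. tensor (a # b # tl xs)) (hd xs)"
    have inner: "tensor_lift tscale 2 (\<lambda>ys. tensor (ys @ tl xs)) (\<Delta> (hd xs)) = ?K xs" for xs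
    proof -
      have "multilinear scale tscale 2 (\<lambda>ys. tensor (ys @ tl xs))"
        unfolding multilinear_def
      proof (intro allI impI)
        fix vs :: "'h list" and i :: nat assume "length vs = 2" "i < 2"
        then show "linH tscale (\<lambda>v. tensor (vs[i := v] @ tl xs))"
          using tensor_update[of i "vs @ tl xs"] by (simp add: list_update_append)
      qed
      then show ?thesis by (simp add: tensor_lift_comult[OF tensor_space.vector_space_axioms])
    qed
    have "multilinear scale tscale (Suc n) ?K"
      unfolding multilinear_def
    proof (intro allI impI)
      fix vs :: "'h list" and i assume vs: "length vs = Suc n" "i < Suc n"
      then obtain v us where us: "vs = v # us" by (cases vs) auto
      show "linH tscale (\<lambda>v. ?K (vs[i := v]))"
      proof (cases i)
        case 0
        have "linH tscale (\<lambda>v. sw (\<lambda>a b. tensor (a # b # us)) v)"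
          using tensor_update[of 0 "0 # _ # us"] tensor_update[of 1 "_ # 0 # us"]
          by (intro linH_sw) (simp add: bilinH_def)
        then show ?thesis by (simp add: us 0)
      next
        case (Suc j)
        have "linH tscale (\<lambda>x. tensor (a # b # us[j := x]))" for a b
          using tensor_update[of "Suc (Suc j)" "a # b # us"] vs us Suc by simp
        then show ?thesis by (simp add: us Suc) (rule lin_sw_par)
      qed
    qed
    from lift[OF this Suc] have "iter_comult (Suc n) h = swn n ?K h"
      by (simp add: inner)
    also have "\<dots> = swn (Suc n) tensor h"
      by (rule swn_split_first) (rule multilinear_tensor)
    finally show ?case .
  qed simp
  show "multilinear scale s (Suc n) F \<Longrightarrow> tensor_lift s (Suc n) F (iter_comult n h) = swn n F h"
    by (rule lift[OF _ eq])
qed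

lemma swn_mult:
  "multilinear scale s (Suc n) F \<Longrightarrow>
    swn n F (g * h) = swn n (\<lambda>xs. swn n (\<lambda>ys. F (map2 (*) xs ys)) h) g"
proof (induction n arbitrary: F g h)
  case (Suc n)
  have lin1: "linH s (\<lambda>a. swn n (\<lambda>xs. F (a # xs)) b)" for b
    by (rule linH_swn_par) (rule multilinear_head[OF Suc.prems])
  have lin2: "linH s (swn n (\<lambda>xs. F (a # xs)))" for a
    by (rule linH_swn[OF multilinear_Cons[OF Suc.prems]])
  have "swn (Suc n) F (g * h) =
      sw (\<lambda>a b. sw (\<lambda>c d. swn n (\<lambda>xs. F (a * c # xs)) (b * d)) h) g"
    unfolding swn.simps by (rule sw_mult[where s = s]) (simp add: bilinH_def lin1 lin2)
  also have "\<dots> = sw (\<lambda>a b. sw (\<lambda>c d. swn n (\<lambda>xs. swn n (\<lambda>ys. F (a * c # map2 (*) xs ys)) d) b) h) g"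
    by (intro sw_cong Suc.IH[OF multilinear_Cons[OF Suc.prems]])
  also have "\<dots> = sw (\<lambda>a b. swn n (\<lambda>xs. sw (\<lambda>c d. swn n (\<lambda>ys. F (a * c # map2 (*) xs ys)) d) h) b) g"
    by (intro sw_cong swn_sw_swap[symmetric])
  finally show ?case by simp
qed simp

context
  fixes \<tau> assumes \<tau>: "hopf_automorphism \<tau>"
begin

lemma auto_linear: "linH scale \<tau>" and auto_mult: "\<tau> (g * h) = \<tau> g * \<tau> h"
  and auto_counit: "\<epsilon> (\<tau> h) = \<epsilon> h"
  and auto_surj: "surj \<tau>"
  using \<tau> by (simp_all add: hopf_automorphism_def bij_def)

lemma sw_auto:
  assumes F: "bilinH s F"
  shows "sw F (\<tau> h) = sw (\<lambda>a b. F (\<tau> a) (\<tau> b)) h"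
proof -
  note vs = bilinH_target[OF F] and ml = multilinear_bilinH[OF F]
  note [lin] = lin_comp[OF auto_linear]
  let ?G = "\<lambda>xs. F (xs ! 0) (xs ! 1)"
  have "\<Delta> (\<tau> h) = tensor_lift tscale 2 (\<lambda>xs. tensor [\<tau> (xs ! 0), \<tau> (xs ! 1)]) (\<Delta> h)"
    using \<tau> unfolding hopf_automorphism_def by blast
  also have "\<dots> = sw (\<lambda>a b. tensor [\<tau> a, \<tau> b]) h"
    by (rule tensor_lift_sw) (rule lin)+
  finally have "sw F (\<tau> h) = tensor_lift s 2 ?G (sw (\<lambda>a b. tensor [\<tau> a, \<tau> b]) h)"
    using tensor_lift_sw[OF F, of "\<tau> h"] by simp
  also have "\<dots> = sw (\<lambda>a b. tensor_lift s 2 ?G (tensor [\<tau> a, \<tau> b])) h"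
    unfolding sw_def case_prod_unfold
    by (intro tensor_lift_sum_list vs ml tensor_in_power) simp
  also have "\<dots> = sw (\<lambda>a b. F (\<tau> a) (\<tau> b)) h"
    by (subst tensor_lift_tensor[OF vs ml]) simp_all
  finally show ?thesis .
qed

lemma swn_auto:
  "multilinear scale s (Suc n) F \<Longrightarrow> swn n F (\<tau> h) = swn n (\<lambda>xs. F (map \<tau> xs)) h"
proof (induction n arbitrary: F h)
  case (Suc n)
  have "swn (Suc n) F (\<tau> h) = sw (\<lambda>a b. swn n (\<lambda>xs. F (\<tau> a # xs)) (\<tau> b)) h"
    unfolding swn.simps
  proof (rule sw_auto[where s = s])
    show "bilinH s (\<lambda>a. swn n (\<lambda>xs. F (a # xs)))"
      unfolding bilinH_def
      using linH_swn_par[of n s "\<lambda>a xs. F (a # xs)"] multilinear_head[OF Suc.prems]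
        linH_swn[OF multilinear_Cons[OF Suc.prems]] by blast
  qed
  also have "\<dots> = sw (\<lambda>a b. swn n (\<lambda>xs. F (\<tau> a # map \<tau> xs)) b) h"
    by (intro sw_cong Suc.IH[OF multilinear_Cons[OF Suc.prems]])
  finally show ?case by simp
qed simp

lemma auto_power_linear: "linH scale (\<tau> ^^ i)"
proof (induction i)
  case 0
  show ?case by (simp add: id_def linear_ident)
next
  case (Suc i)
  then show ?case using lin_comp[OF auto_linear Suc] by (simp add: o_def)
qed

lemma auto_power_mult: "(\<tau> ^^ i) (g * h) = (\<tau> ^^ i) g * (\<tau> ^^ i) h"
  by (induction i) (simp_all add: auto_mult)

end

end

context semisimple_hopf_algebra
begin

text \<open>Both sides are \<open>\<tau>(L) L\<close>, by the left integral property of \<open>L\<close> and the right integral property of \<open>\<tau>(L)\<close>.\<close>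

lemma auto_Lam:
  assumes \<tau>: "hopf_automorphism \<tau>"
  shows "\<tau> Lam = Lam"
proof -
  obtain y where y: "Lam = \<tau> y" using surjD[OF auto_surj[OF \<tau>]] by blast
  have "\<epsilon> y = 1" using auto_counit[OF \<tau>, of y] counit_Lam y by simp
  have "\<tau> Lam * Lam = \<tau> (Lam * y)" using y by (simp add: auto_mult[OF \<tau>])
  also have "\<dots> = \<tau> Lam" by (simp add: Lam_right \<open>\<epsilon> y = 1\<close>)
  finally show ?thesis using Lam_left[of "\<tau> Lam"] by (simp add: auto_counit[OF \<tau>] counit_Lam)
qed

text \<open>Splitting off the first factor writes the iterated coproduct of \<open>L\<close> as \<open>L\<^sub>1 \<otimes> \<Delta>\<^sup>n\<^sup>-\<^sup>1(L\<^sub>2)\<close>, splitting off the last one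
  as \<open>\<Delta>\<^sup>n\<^sup>-\<^sup>1(L\<^sub>1) \<otimes> L\<^sub>2\<close>. Cocommutativity of \<open>L\<close> makes them cyclic rotations of each other.\<close>

lemma swn_Lam_rotate:
  assumes ml: "multilinear scale s (Suc n) F"
  shows "swn n (\<lambda>xs. F (rotate1 xs)) Lam = swn n F Lam"
proof (cases n)
  case (Suc k)
  note ml = ml[unfolded Suc]
  have "swn n (\<lambda>xs. F (rotate1 xs)) Lam = sw (\<lambda>a b. swn k (\<lambda>xs. F (xs @ [a])) b) Lam"
    by (simp add: Suc)
  also have "\<dots> = sw (\<lambda>a b. swn k (\<lambda>xs. F (xs @ [b])) a) Lam"
  proof (rule Lam_cocommutative)
    show "bilinH s (\<lambda>a. swn k (\<lambda>xs. F (xs @ [a])))"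
      unfolding bilinH_def
      using linH_swn_par[of k s "\<lambda>a xs. F (xs @ [a])"] multilinear_last[OF ml]
        linH_swn[OF multilinear_snoc[OF ml]] by blast
  qed
  also have "\<dots> = swn n F Lam" unfolding Suc by (rule swn_snoc[OF ml, symmetric])
  finally show ?thesis .
qed simp

end

section \<open>Tensor powers of a finite-dimensional space\<close>

lemma multilinear_compose_linear:
  assumes "multilinear s t n F" and "Vector_Spaces.linear t u g"
  shows "multilinear s u n (\<lambda>xs. g (F xs))"
  using assms Vector_Spaces.linear_compose unfolding multilinear_def o_def by blast

lemma multilinear_rotate1:
  assumes F: "multilinear s t (Suc m) F"
  shows "multilinear s t (Suc m) (\<lambda>xs. F (rotate1 xs))"
  unfolding multilinear_def
proof (intro allI impI)
  fix xs :: "'b list" and i assume i: "length xs = Suc m" "i < Suc m"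
  then obtain y ys where ys: "xs = y # ys" "length ys = m" by (cases xs) auto
  show "Vector_Spaces.linear s t (\<lambda>x. F (rotate1 (xs[i := x])))"
  proof (cases i)
    case 0
    then show ?thesis using multilinear_last[OF F ys(2)] by (simp add: ys)
  next
    case (Suc j)
    then show ?thesis using multilinearD[OF multilinear_snoc[OF F] ys(2), of j] i by (simp add: ys)
  qed
qed

lemma linear_plus:
  assumes "Vector_Spaces.linear s t f" and "Vector_Spaces.linear s t g"
  shows "Vector_Spaces.linear s t (\<lambda>x. f x + g x)"
proof -
  interpret f: Vector_Spaces.linear s t f by fact
  interpret g: Vector_Spaces.linear s t g by fact
  show ?thesis
    unfolding Vector_Spaces.linear_iff
    by (simp add: f.vs1.vector_space_axioms f.vs2.vector_space_axioms f.add g.add f.scale g.scale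
        f.vs2.scale_right_distrib add_ac)
qed

lemma multilinear_plus:
  "multilinear s t n F \<Longrightarrow> multilinear s t n G \<Longrightarrow> multilinear s t n (\<lambda>xs. F xs + G xs)"
  by (simp add: multilinear_def linear_plus)

lemma multilinear_scaled:
  assumes "multilinear s t (Suc n) F"
  shows "multilinear s t (Suc n) (\<lambda>xs. t c (F xs))"
  by (rule multilinear_compose_linear[OF assms vector_space.linear_scale_self[OF multilinear_target[OF assms]]])

lemma multilinear_zero:
  "vector_space s \<Longrightarrow> vector_space t \<Longrightarrow> multilinear s t n (\<lambda>xs. 0)"
  by (simp add: multilinear_def Vector_Spaces.linear_iff module.scale_zero_right module_iff_vector_space)

lemma sum_lists_Suc:
  fixes F :: "'b list \<Rightarrow> 'w::comm_monoid_add"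
  assumes "finite B"
  shows "(\<Sum>bs | set bs \<subseteq> B \<and> length bs = Suc n. F bs) =
    (\<Sum>b\<in>B. \<Sum>bs | set bs \<subseteq> B \<and> length bs = n. F (b # bs))"
proof -
  have "(\<Sum>bs | set bs \<subseteq> B \<and> length bs = Suc n. F bs) =
      (\<Sum>(bs, b)\<in>{bs. set bs \<subseteq> B \<and> length bs = n} \<times> B. F (b # bs))"
    unfolding lists_length_Suc_eq by (subst sum.reindex) (auto simp: inj_on_def case_prod_unfold)
  also have "\<dots> = (\<Sum>bs | set bs \<subseteq> B \<and> length bs = n. \<Sum>b\<in>B. F (b # bs))"
    by (rule sum.cartesian_product[symmetric])
  finally show ?thesis by (simp add: sum.swap[of _ B])
qed

context fd_space
begin

definition words :: "nat \<Rightarrow> 'v list set" where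
  "words n = {bs. set bs \<subseteq> Bas \<and> length bs = n}"

definition coords :: "'v list \<Rightarrow> 'v list \<Rightarrow> 'k" where
  "coords bs vs = prod_list (map2 crd bs vs)"

lemma finite_words: "finite (words n)"
  unfolding words_def by (rule finite_lists_length_eq[OF finite_Bas])

lemma words_0: "words 0 = {[]}"
  by (auto simp: words_def)

lemma sum_words_Suc:
  fixes F :: "'v list \<Rightarrow> 'w::comm_monoid_add"
  shows "(\<Sum>bs\<in>words (Suc n). F bs) = (\<Sum>b\<in>Bas. \<Sum>bs\<in>words n. F (b # bs))"
  unfolding words_def by (rule sum_lists_Suc[OF finite_Bas])

lemma multilinear_expand:
  "multilinear scale s n F \<Longrightarrow> vector_space s \<Longrightarrow> length vs = n \<Longrightarrow>
    F vs = (\<Sum>bs\<in>words n. s (coords bs vs) (F bs))"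
proof (induction n arbitrary: F vs)
  case 0
  then interpret s: vector_space s by simp
  show ?case using 0 by (simp add: words_0 coords_def)
next
  case (Suc n)
  interpret s: vector_space s by fact
  obtain v us where vs: "vs = v # us" "length us = n" using Suc.prems(3) by (cases vs) auto
  have "F vs = (\<Sum>b\<in>Bas. s (crd b v) (F (b # us)))"
    unfolding vs(1) by (rule linear_expand[OF multilinear_head[OF Suc.prems(1) vs(2)]])
  also have "\<dots> = (\<Sum>b\<in>Bas. s (crd b v) (\<Sum>bs\<in>words n. s (coords bs us) (F (b # bs))))"
    using Suc.IH[OF multilinear_Cons[OF Suc.prems(1)] Suc.prems(2) vs(2)] by simp
  also have "\<dots> = (\<Sum>bs\<in>words (Suc n). s (coords bs vs) (F bs))"
    by (simp add: sum_words_Suc s.scale_sum_right vs(1) coords_def)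
  finally show ?case .
qed

lemma multilinear_coords:
  "length bs = n \<Longrightarrow> multilinear scale (*) n (coords bs)"
proof (induction n arbitrary: bs)
  case 0
  show ?case by (simp add: multilinear_def)
next
  case (Suc n)
  obtain c cs where bs: "bs = c # cs" "length cs = n" using Suc.prems by (cases bs) auto
  interpret k: vector_space "(*) :: 'k \<Rightarrow> 'k \<Rightarrow> 'k" by (rule vector_space_field)
  show ?case
    unfolding multilinear_def
  proof (intro allI impI)
    fix vs :: "'v list" and i assume vs: "length vs = Suc n" "i < Suc n"
    then obtain u us where us: "vs = u # us" "length us = n" by (cases vs) auto
    show "Vector_Spaces.linear scale (*) (\<lambda>v. coords bs (vs[i := v]))"
    proof (cases i)
      case 0
      have "Vector_Spaces.linear scale (*) (\<lambda>v. coords cs us * crd c v)"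
        using Vector_Spaces.linear_compose[OF crd_linear k.linear_scale_self] by (simp add: o_def)
      then show ?thesis by (simp add: 0 bs us coords_def mult.commute)
    next
      case (Suc j)
      have "Vector_Spaces.linear scale (*) (\<lambda>v. crd c u * coords cs (us[j := v]))"
        using Vector_Spaces.linear_compose[OF multilinearD[OF Suc.IH[OF bs(2)] us(2), of j] k.linear_scale_self]
          vs Suc by (simp add: o_def)
      then show ?thesis by (simp add: Suc bs us coords_def)
    qed
  qed
qed

text \<open>Matrix multiplication: the sum over all intermediate basis vectors of the products of matrix entries
  along a path from \<open>c\<close> to \<open>b\<close> is an entry of the product.\<close>

lemma coords_path:
  "(\<And>C. C \<in> set Cs \<Longrightarrow> endo C) \<Longrightarrow> length Cs = Suc n \<Longrightarrow>
    (\<Sum>bs\<in>words n. coords (b # bs) (map2 (\<lambda>A v. A v) Cs (bs @ [c]))) = crd b (foldr (\<lambda>A. A) Cs c)"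
proof (induction n arbitrary: b Cs)
  case 0
  then obtain C where "Cs = [C]" by (auto simp: length_Suc_conv)
  then show ?case by (simp add: words_0 coords_def)
next
  case (Suc n)
  obtain C Ds where C: "Cs = C # Ds" "length Ds = Suc n" using Suc.prems(2) by (cases Cs) auto
  have "(\<Sum>bs\<in>words (Suc n). coords (b # bs) (map2 (\<lambda>A v. A v) Cs (bs @ [c]))) =
      (\<Sum>d\<in>Bas. crd b (C d) * (\<Sum>bs\<in>words n. coords (d # bs) (map2 (\<lambda>A v. A v) Ds (bs @ [c]))))"
    by (simp add: sum_words_Suc C(1) coords_def sum_distrib_left)
  also have "\<dots> = (\<Sum>d\<in>Bas. crd b (C d) * crd d (foldr (\<lambda>A. A) Ds c))"
    using Suc.IH[of Ds] Suc.prems(1) C by simp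
  also have "\<dots> = crd b (C (foldr (\<lambda>A. A) Ds c))"
  proof -
    have "Vector_Spaces.linear scale (*) (\<lambda>x. crd b (C x))"
      using Vector_Spaces.linear_compose[OF Suc.prems(1) crd_linear] C by (simp add: o_def)
    from linear_expand[OF this, of "foldr (\<lambda>A. A) Ds c"] show ?thesis by (simp add: mult.commute)
  qed
  finally show ?case by (simp add: C(1))
qed

lemma linear_foldr:
  "(\<And>C. C \<in> set Cs \<Longrightarrow> endo C) \<Longrightarrow>
    endo (foldr (\<lambda>A. A) Cs)"
proof (induction Cs)
  case Nil
  show ?case by (simp add: id_def linear_ident)
next
  case (Cons C Cs)
  then have "endo (C \<circ> foldr (\<lambda>A. A) Cs)"
    by (intro Vector_Spaces.linear_compose) auto
  then show ?case by (simp add: o_def)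
qed

text \<open>The diagonal coefficients of \<open>\<alpha> \<circ> (A\<^sub>1 \<otimes> \<dots> \<otimes> A\<^sub>m)\<close> in the basis of pure tensors. Rotation by one shifts the column
  indices against the row indices, so the sum runs over closed paths and is the trace of
  \<open>A\<^sub>2 \<cdots> A\<^sub>m A\<^sub>1\<close>, which equals that of \<open>A\<^sub>1 \<cdots> A\<^sub>m\<close>.\<close>

lemma sum_coords_rotate:
  assumes lin: "\<And>A. A \<in> set As \<Longrightarrow> endo A" and len: "length As = Suc n"
  shows "(\<Sum>bs\<in>words (Suc n). coords bs (rotate1 (map2 (\<lambda>A v. A v) As bs))) = tr (foldr (\<lambda>A. A) As)"
proof -
  obtain A Cs where A: "As = A # Cs" "length Cs = n" using len by (cases As) auto
  have "(\<Sum>bs\<in>words (Suc n). coords bs (rotate1 (map2 (\<lambda>A v. A v) As bs))) =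
      (\<Sum>b\<in>Bas. \<Sum>bs\<in>words n. coords (b # bs) (map2 (\<lambda>A v. A v) (Cs @ [A]) (bs @ [b])))"
    unfolding sum_words_Suc
    by (intro sum.cong refl) (simp add: A words_def)
  also have "\<dots> = (\<Sum>b\<in>Bas. crd b (foldr (\<lambda>A. A) (Cs @ [A]) b))"
    using lin A by (intro sum.cong refl coords_path) auto
  also have "\<dots> = tr (\<lambda>x. foldr (\<lambda>A. A) Cs (A x))" by (simp add: tr_basis)
  also have "\<dots> = tr (\<lambda>x. A (foldr (\<lambda>A. A) Cs x))"
    using lin A by (intro tr_comm linear_foldr) auto
  finally show ?thesis by (simp add: A(1) o_def)
qed

end

section \<open>The twisted tensor power\<close>

text \<open>The number of tensor factors is \<open>Suc n\<close>, so that positivity of \<open>m\<close> is built in and the iterated coproduct is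
  \<open>\<Delta>\<^sup>n\<close>.\<close>

locale twisted_module = semisimple_hopf_algebra scale \<Delta> \<epsilon> S + hopf_module scale \<Delta> \<epsilon> S sV \<rho>
  for scale :: "'k::{alg_closed_field, field_char_0} \<Rightarrow> 'h::ring_1 \<Rightarrow> 'h" and \<Delta> \<epsilon> S
    and sV :: "'k \<Rightarrow> 'v::ab_group_add \<Rightarrow> 'v" and \<rho> +
  fixes \<tau> :: "'h \<Rightarrow> 'h" and n :: nat
  assumes auto: "hopf_automorphism \<tau>" and period: "\<tau> ^^ Suc n = id"
    and V_finite: "\<exists>B. finite B \<and> V.span B = UNIV"
begin

sublocale V: fd_space sV
  by unfold_locales (rule V_finite)

definition twist :: "'h list \<Rightarrow> 'v list \<Rightarrow> 'v list" where
  "twist hs vs = map (\<lambda>i. \<rho> ((\<tau> ^^ i) (hs ! i)) (vs ! i)) [0..<Suc n]"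

lemma length_twist: "length (twist hs vs) = Suc n"
  by (simp add: twist_def)

lemma nth_twist: "i < Suc n \<Longrightarrow> twist hs vs ! i = \<rho> ((\<tau> ^^ i) (hs ! i)) (vs ! i)"
  by (simp add: twist_def del: upt_Suc)

lemma action_linear_left: "linH sV (\<lambda>h. \<rho> h v)"
  by (simp add: Vector_Spaces.linear_iff action_add action_scale vector_space_axioms V.vector_space_axioms)

lemma multilinear_twist_left:
  assumes F: "multilinear sV s (Suc n) F"
  shows "multilinear scale s (Suc n) (\<lambda>hs. F (twist hs vs))"
  unfolding multilinear_def
proof (intro allI impI)
  fix hs :: "'h list" and i assume i: "length hs = Suc n" "i < Suc n"
  have "twist (hs[i := h]) vs = (twist hs vs)[i := \<rho> ((\<tau> ^^ i) h) (vs ! i)]" for h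
    using i by (intro nth_equalityI) (simp_all add: length_twist nth_twist nth_list_update)
  then show "linH s (\<lambda>h. F (twist (hs[i := h]) vs))"
    using lin_comp[OF multilinearD[OF F length_twist i(2)] lin_comp[OF action_linear_left auto_power_linear[OF auto]]]
    by simp
qed

lemma multilinear_twist_right:
  assumes F: "multilinear sV s (Suc n) F"
  shows "multilinear sV s (Suc n) (\<lambda>vs. F (twist hs vs))"
  unfolding multilinear_def
proof (intro allI impI)
  fix vs :: "'v list" and i assume i: "length vs = Suc n" "i < Suc n"
  have "twist hs (vs[i := v]) = (twist hs vs)[i := \<rho> ((\<tau> ^^ i) (hs ! i)) v]" for v
    using i by (intro nth_equalityI) (simp_all add: length_twist nth_twist nth_list_update)
  then show "Vector_Spaces.linear sV s (\<lambda>v. F (twist hs (vs[i := v])))"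
    using lin_comp[OF multilinearD[OF F length_twist i(2)] action_linear] by simp
qed

abbreviation T :: "('k, 'v) tensor set" where "T \<equiv> V.tensor_power (Suc n)"
abbreviation act :: "'h \<Rightarrow> ('k, 'v) tensor \<Rightarrow> ('k, 'v) tensor" where "act \<equiv> twisted_action (Suc n) \<tau>"
abbreviation \<alpha> :: "('k, 'v) tensor \<Rightarrow> ('k, 'v) tensor" where "\<alpha> \<equiv> V.cyclic_perm (Suc n)"
abbreviation W :: "('k, 'v) tensor set" where "W \<equiv> twisted_invariants (Suc n) \<tau>"

definition inner_act :: "('k, 'v) tensor \<Rightarrow> 'h list \<Rightarrow> ('k, 'v) tensor" where
  "inner_act t hs = V.tensor_lift tscale (Suc n) (\<lambda>vs. V.tensor (twist hs vs)) t"

lemmas inner_lift = tensor_space.vector_space_axioms multilinear_twist_right[OF V.multilinear_tensor]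

lemma inner_act_tensor: "length vs = Suc n \<Longrightarrow> inner_act (V.tensor vs) hs = V.tensor (twist hs vs)"
  unfolding inner_act_def by (rule V.tensor_lift_tensor[OF inner_lift])

lemma inner_act_add: "t \<in> T \<Longrightarrow> u \<in> T \<Longrightarrow> inner_act (t + u) hs = inner_act t hs + inner_act u hs"
  unfolding inner_act_def by (rule V.tensor_lift_add[OF inner_lift])

lemma inner_act_scale: "t \<in> T \<Longrightarrow> inner_act (tscale c t) hs = tscale c (inner_act t hs)"
  unfolding inner_act_def by (rule V.tensor_lift_scale[OF inner_lift])

lemma T_induct [consumes 1, case_names zero step]:
  assumes "t \<in> T" and "P 0"
    and "\<And>c vs t. length vs = Suc n \<Longrightarrow> t \<in> T \<Longrightarrow> P t \<Longrightarrow> P (tscale c (V.tensor vs) + t)"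
  shows "P t"
proof -
  have "t \<in> T \<and> P t"
    using assms(1) unfolding V.tensor_power_def
  proof (induction rule: tensor_space.span_induct_alt)
    case base
    show ?case using assms(2) by (simp only: tensor_space.span_zero conj_absorb simp_thms)
  next
    case (step c x y)
    then obtain vs where vs: "x = V.tensor vs" "length vs = Suc n" by blast
    then have "tscale c x + y \<in> T"
      using step unfolding V.tensor_power_def
      by (intro tensor_space.span_add tensor_space.span_scale) (auto intro: tensor_space.span_base)
    moreover have "P (tscale c x + y)"
      using assms(3)[OF vs(2), of y c] step vs by (simp only: V.tensor_power_def simp_thms)
    ultimately show ?case unfolding V.tensor_power_def ..
  qed
  then show ?thesis ..
qed

lemma multilinear_inner_act: "t \<in> T \<Longrightarrow> multilinear scale tscale (Suc n) (inner_act t)"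
proof (induction rule: T_induct)
  case zero
  have "inner_act 0 = (\<lambda>hs. 0)"
    by (rule ext) (simp only: inner_act_def V.tensor_lift_zero[OF inner_lift])
  then show ?case
    by (simp only: multilinear_zero[OF vector_space_axioms tensor_space.vector_space_axioms])
next
  case (step c vs t)
  have "inner_act (tscale c (V.tensor vs) + t) = (\<lambda>hs. tscale c (V.tensor (twist hs vs)) + inner_act t hs)"
  proof (rule ext)
    fix hs
    have vs: "V.tensor vs \<in> T" by (rule V.tensor_in_power[OF step(1)])
    then have "tscale c (V.tensor vs) \<in> T"
      by (rule tensor_space.subspace_scale[OF V.tensor_power_subspace])
    then show "inner_act (tscale c (V.tensor vs) + t) hs = tscale c (V.tensor (twist hs vs)) + inner_act t hs"
      by (simp only: inner_act_add[OF _ step(2)] inner_act_scale[OF vs] inner_act_tensor[OF step(1)])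
  qed
  then show ?case
    by (simp only:)
      (intro multilinear_plus step(3) multilinear_scaled multilinear_twist_left V.multilinear_tensor)
qed

lemma T_zero: "0 \<in> T" and T_add: "t \<in> T \<Longrightarrow> u \<in> T \<Longrightarrow> t + u \<in> T"
  and T_scale: "t \<in> T \<Longrightarrow> tscale c t \<in> T"
  using tensor_space.subspace_0 tensor_space.subspace_add tensor_space.subspace_scale
    V.tensor_power_subspace by blast+

text \<open>The induced maps are linear only on the tensor power, not on the ambient function type, so linearity is
  always relative to \<open>T\<close>.\<close>

lemma T_eqI:
  assumes t: "t \<in> T"
    and f: "\<And>c v t. v \<in> T \<Longrightarrow> t \<in> T \<Longrightarrow> f (tscale c v + t) = tscale c (f v) + f t"
    and g: "\<And>c v t. v \<in> T \<Longrightarrow> t \<in> T \<Longrightarrow> g (tscale c v + t) = tscale c (g v) + g t"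
    and eq: "\<And>vs. length vs = Suc n \<Longrightarrow> f (V.tensor vs) = g (V.tensor vs)"
  shows "f t = g t"
  using t
proof (induction rule: T_induct)
  case zero
  have "f 0 = f (tscale (-1) 0 + 0)" "g 0 = g (tscale (-1) 0 + 0)"
    by (simp_all only: tensor_space.scale_zero_right add_0_right)
  then have "f 0 = 0" "g 0 = 0"
    unfolding f[OF T_zero T_zero] g[OF T_zero T_zero]
    by (simp_all only: tensor_space.scale_minus_left tensor_space.scale_one add.left_inverse)
  then show ?case by (simp only:)
next
  case (step c vs t)
  then show ?case using V.tensor_in_power[OF step(1)] by (simp only: f g eq)
qed

lemma inner_act_in_T:
  assumes "t \<in> T"
  shows "inner_act t hs \<in> T"
  using assms
proof (induction rule: T_induct)
  case zero
  show ?case by (simp only: inner_act_def V.tensor_lift_zero[OF inner_lift] T_zero)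
next
  case (step c vs t)
  have vs: "V.tensor vs \<in> T" by (rule V.tensor_in_power[OF step(1)])
  show ?case
    by (simp only: inner_act_add[OF T_scale[OF vs] step(2)] inner_act_scale[OF vs] inner_act_tensor[OF step(1)])
      (intro T_add T_scale step(3) V.tensor_in_power length_twist)
qed

lemma act_eq_swn: "t \<in> T \<Longrightarrow> act h t = swn n (inner_act t) h"
  using tensor_lift_iter_comult[OF multilinear_inner_act, of t h]
  unfolding twisted_action_def inner_act_def twist_def by simp

lemma act_tensor: "length vs = Suc n \<Longrightarrow> act h (V.tensor vs) = swn n (\<lambda>hs. V.tensor (twist hs vs)) h"
  unfolding act_eq_swn[OF V.tensor_in_power] by (rule swn_cong) (rule inner_act_tensor)

lemma act_linear:
  assumes v: "v \<in> T" and t: "t \<in> T"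
  shows "act h (tscale c v + t) = tscale c (act h v) + act h t"
proof -
  have "act h (tscale c v + t) = swn n (inner_act (tscale c v + t)) h"
    by (intro act_eq_swn T_add T_scale v t)
  also have "\<dots> = swn n (\<lambda>hs. tscale c (inner_act v hs) + inner_act t hs) h"
    by (rule swn_cong) (simp only: inner_act_add[OF T_scale[OF v] t] inner_act_scale[OF v])
  also have "\<dots> = tscale c (swn n (inner_act v) h) + swn n (inner_act t) h"
    by (simp only: swn_add swn_apply[OF tensor_space.linear_scale_self])
  finally show ?thesis by (simp only: act_eq_swn v t)
qed

lemma act_zero: "act h 0 = 0"
  using act_linear[OF T_zero T_zero, of h "-1"]
  by (simp only: tensor_space.scale_zero_right add_0_right tensor_space.scale_minus_left
      tensor_space.scale_one add.left_inverse)

lemma sum_list_apply_on: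
  assumes "0 \<in> A" "\<And>x y. x \<in> A \<Longrightarrow> y \<in> A \<Longrightarrow> x + y \<in> A"
    and "f 0 = 0" "\<And>x y. x \<in> A \<Longrightarrow> y \<in> A \<Longrightarrow> f (x + y) = f x + f y"
    and "\<And>p. p \<in> set ps \<Longrightarrow> F p \<in> A"
  shows "(\<Sum>p\<leftarrow>ps. F p) \<in> A \<and> f (\<Sum>p\<leftarrow>ps. F p) = (\<Sum>p\<leftarrow>ps. f (F p))"
  using assms(5)
proof (induction ps)
  case Nil
  show ?case by (simp only: list.map sum_list.Nil assms(1,3) simp_thms)
next
  case (Cons p ps)
  then have "F p \<in> A" "(\<Sum>p\<leftarrow>ps. F p) \<in> A" "f (\<Sum>p\<leftarrow>ps. F p) = (\<Sum>p\<leftarrow>ps. f (F p))" by auto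
  then show ?case by (simp only: list.map sum_list.Cons assms(2,4) simp_thms)
qed

lemma swn_apply_on:
  assumes A: "0 \<in> A" "\<And>x y. x \<in> A \<Longrightarrow> y \<in> A \<Longrightarrow> x + y \<in> A"
    and f: "f 0 = 0" "\<And>x y. x \<in> A \<Longrightarrow> y \<in> A \<Longrightarrow> f (x + y) = f x + f y"
  shows "(\<And>xs. F xs \<in> A) \<Longrightarrow> swn k F h \<in> A \<and> f (swn k F h) = swn k (\<lambda>xs. f (F xs)) h"
proof (induction k arbitrary: F h)
  case (Suc k)
  have IH: "swn k (\<lambda>xs. F (a # xs)) b \<in> A" "f (swn k (\<lambda>xs. F (a # xs)) b) = swn k (\<lambda>xs. f (F (a # xs))) b" for a b
    using Suc.IH[of "\<lambda>xs. F (a # xs)" b] Suc.prems by auto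
  show ?case
    unfolding swn.simps sw_def case_prod_unfold IH(2)[symmetric]
    by (rule sum_list_apply_on[OF A f IH(1)])
qed simp

lemma act_in_T: "t \<in> T \<Longrightarrow> act h t \<in> T"
  using swn_apply_on[of T "\<lambda>x. x", OF T_zero T_add refl refl, of "inner_act t" n h]
  by (simp only: act_eq_swn inner_act_in_T simp_thms)

lemma swn_act:
  assumes "\<And>xs. F xs \<in> T"
  shows "act g (swn k F h) = swn k (\<lambda>xs. act g (F xs)) h"
proof -
  have add: "act g (t + u) = act g t + act g u" if "t \<in> T" "u \<in> T" for t u
    using act_linear[OF that, of g 1] by (simp only: tensor_space.scale_one)
  show ?thesis
    by (rule conjunct2[OF swn_apply_on[where A = T and f = "act g"]])
      (assumption | rule T_zero T_add act_zero add assms)+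
qed

lemma alpha_tensor: "length vs = Suc n \<Longrightarrow> \<alpha> (V.tensor vs) = V.tensor (rotate1 vs)"
  unfolding V.cyclic_perm_def
  by (rule V.tensor_lift_tensor[OF tensor_space.vector_space_axioms multilinear_rotate1[OF V.multilinear_tensor]])

lemma alpha_linear: "v \<in> T \<Longrightarrow> t \<in> T \<Longrightarrow> \<alpha> (tscale c v + t) = tscale c (\<alpha> v) + \<alpha> t"
  unfolding V.cyclic_perm_def
  by (simp only: T_scale
      V.tensor_lift_add[OF tensor_space.vector_space_axioms multilinear_rotate1[OF V.multilinear_tensor]]
      V.tensor_lift_scale[OF tensor_space.vector_space_axioms multilinear_rotate1[OF V.multilinear_tensor]])

lemma alpha_zero: "\<alpha> 0 = 0"
  unfolding V.cyclic_perm_def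
  by (rule V.tensor_lift_zero[OF tensor_space.vector_space_axioms multilinear_rotate1[OF V.multilinear_tensor]])

lemma alpha_in_T: "t \<in> T \<Longrightarrow> \<alpha> t \<in> T"
proof (induction rule: T_induct)
  case zero
  show ?case by (simp only: alpha_zero T_zero)
next
  case (step c vs t)
  show ?case
    by (simp only: alpha_linear[OF V.tensor_in_power[OF step(1)] step(2)] alpha_tensor[OF step(1)])
      (intro T_add T_scale step(3) V.tensor_in_power, simp add: step(1))
qed

lemma alpha_swn:
  assumes "\<And>xs. F xs \<in> T"
  shows "\<alpha> (swn k F h) = swn k (\<lambda>xs. \<alpha> (F xs)) h"
proof -
  have add: "\<alpha> (t + u) = \<alpha> t + \<alpha> u" if "t \<in> T" "u \<in> T" for t u
    using alpha_linear[OF that, of 1] by (simp only: tensor_space.scale_one)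
  show ?thesis
    by (rule conjunct2[OF swn_apply_on[where A = T and f = \<alpha>]])
      (assumption | rule T_zero T_add alpha_zero add assms)+
qed

lemma twist_twist:
  assumes "length gs = Suc n" "length hs = Suc n"
  shows "twist gs (twist hs vs) = twist (map2 (*) gs hs) vs"
  using assms
  by (intro nth_equalityI) (simp_all add: length_twist nth_twist auto_power_mult[OF auto] action_mult)

text \<open>Rotating the twisted tensor shifts the exponent of \<open>\<tau>\<close> by one in each slot; in the slot that is wrapped
  around, the exponent \<open>Suc n\<close> may be replaced by \<open>0\<close>.\<close>

lemma twist_rotate1:
  assumes "length hs = Suc n" "length vs = Suc n"
  shows "rotate1 (twist hs vs) = twist (map \<tau> (rotate1 hs)) (rotate1 vs)"
proof (rule nth_equalityI)
  show "length (rotate1 (twist hs vs)) = length (twist (map \<tau> (rotate1 hs)) (rotate1 vs))"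
    by (simp add: length_twist)
  fix i assume "i < length (rotate1 (twist hs vs))"
  then have i: "i < Suc n" by (simp add: length_twist)
  let ?j = "Suc i mod Suc n"
  have "\<tau> ^^ ?j = \<tau> ^^ Suc i"
  proof (cases "i = n")
    case True
    then have "?j = 0" by simp
    then show ?thesis using period True by (simp only: funpow_0 funpow.simps(1))
  qed (use i in simp)
  then have "(\<tau> ^^ ?j) h = (\<tau> ^^ i) (\<tau> h)" for h
    by (simp only: funpow_Suc_right o_apply)
  moreover have "?j < Suc n" by simp
  ultimately show "rotate1 (twist hs vs) ! i = twist (map \<tau> (rotate1 hs)) (rotate1 vs) ! i"
    using i assms by (simp add: nth_rotate1 length_twist nth_twist del: funpow.simps mod_Suc)
qed

lemma act_mult:
  assumes "t \<in> T"
  shows "act (g * h) t = act g (act h t)"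
proof (rule T_eqI[OF assms act_linear, where g = "\<lambda>t. act g (act h t)"])
  show "act g (act h (tscale c v + t)) = tscale c (act g (act h v)) + act g (act h t)"
    if "v \<in> T" "t \<in> T" for c v t
    by (simp only: act_linear act_in_T that)
  fix vs :: "'v list" assume vs: "length vs = Suc n"
  have T: "V.tensor (twist hs vs) \<in> T" for hs by (rule V.tensor_in_power[OF length_twist])
  have "act g (act h (V.tensor vs)) = swn n (\<lambda>hs. swn n (\<lambda>gs. V.tensor (twist gs (twist hs vs))) g) h"
    by (simp only: act_tensor[OF vs] swn_act[OF T] act_tensor[OF length_twist])
  also have "\<dots> = swn n (\<lambda>gs. swn n (\<lambda>hs. V.tensor (twist gs (twist hs vs))) h) g"
    by (rule swn_swap)
  also have "\<dots> = swn n (\<lambda>gs. swn n (\<lambda>hs. V.tensor (twist (map2 (*) gs hs) vs)) h) g"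
    by (intro swn_cong) (simp only: twist_twist)
  also have "\<dots> = swn n (\<lambda>xs. V.tensor (twist xs vs)) (g * h)"
    by (rule swn_mult[where s = tscale, symmetric]) (rule multilinear_twist_left[OF V.multilinear_tensor])
  finally show "act (g * h) (V.tensor vs) = act g (act h (V.tensor vs))"
    by (simp only: act_tensor[OF vs])
qed

lemma act_scale: "t \<in> T \<Longrightarrow> act (scale c h) t = tscale c (act h t)"
  using linH_swn[OF multilinear_inner_act, of t]
  by (simp only: act_eq_swn Vector_Spaces.linear_iff simp_thms)

lemma act_Lam_invariant:
  assumes t: "t \<in> T"
  shows "act Lam t \<in> W"
proof -
  have "act h (act Lam t) = tscale (\<epsilon> h) (act Lam t)" for h
    by (simp only: act_mult[OF t, symmetric] Lam_left act_scale[OF t])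
  then show ?thesis using act_in_T[OF t] unfolding twisted_invariants_def by blast
qed

lemma W_T: "w \<in> W \<Longrightarrow> w \<in> T"
  by (simp only: twisted_invariants_def mem_Collect_eq)

lemma act_Lam_fixes:
  assumes "w \<in> W"
  shows "act Lam w = w"
proof -
  have "act Lam w = tscale (\<epsilon> Lam) w"
    using assms unfolding twisted_invariants_def by blast
  then show ?thesis by (simp only: counit_Lam tensor_space.scale_one)
qed

text \<open>On pure tensors both sides are Sweedler sums over the iterated coproduct of \<open>L\<close> that differ by a rotation of
  the factors and an application of \<open>\<tau>\<close> to each of them; neither changes the sum.\<close>

lemma alpha_act_Lam:
  assumes "t \<in> T"
  shows "\<alpha> (act Lam t) = act Lam (\<alpha> t)"
proof (rule T_eqI[OF assms, where f = "\<lambda>t. \<alpha> (act Lam t)" and g = "\<lambda>t. act Lam (\<alpha> t)"])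
  show "\<alpha> (act Lam (tscale c v + t)) = tscale c (\<alpha> (act Lam v)) + \<alpha> (act Lam t)"
    "act Lam (\<alpha> (tscale c v + t)) = tscale c (act Lam (\<alpha> v)) + act Lam (\<alpha> t)"
    if "v \<in> T" "t \<in> T" for c v t
    by (simp_all only: act_linear alpha_linear act_in_T alpha_in_T that)
  fix vs :: "'v list" assume vs: "length vs = Suc n"
  let ?F = "\<lambda>hs. V.tensor (twist hs (rotate1 vs))"
  have ml: "multilinear scale tscale (Suc n) ?F"
    by (rule multilinear_twist_left[OF V.multilinear_tensor])
  have mlt: "multilinear scale tscale (Suc n) (\<lambda>hs. ?F (map \<tau> hs))"
    unfolding multilinear_def
  proof (intro allI impI)
    fix hs :: "'h list" and i assume "length hs = Suc n" "i < Suc n"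
    then show "linH tscale (\<lambda>h. ?F (map \<tau> (hs[i := h])))"
      using lin_comp[OF multilinearD[OF ml, of "map \<tau> hs" i] auto_linear[OF auto]] by (simp add: map_update)
  qed
  have T: "V.tensor (twist hs us) \<in> T" for hs us by (rule V.tensor_in_power[OF length_twist])
  have "\<alpha> (act Lam (V.tensor vs)) = swn n (\<lambda>hs. V.tensor (rotate1 (twist hs vs))) Lam"
    by (simp only: act_tensor[OF vs] alpha_swn[OF T] alpha_tensor[OF length_twist])
  also have "\<dots> = swn n (\<lambda>hs. ?F (map \<tau> (rotate1 hs))) Lam"
    by (intro swn_cong) (simp only: twist_rotate1 vs)
  also have "\<dots> = swn n (\<lambda>hs. ?F (map \<tau> hs)) Lam"
    by (rule swn_Lam_rotate[OF mlt])
  also have "\<dots> = swn n ?F (\<tau> Lam)"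
    by (rule swn_auto[OF auto ml, symmetric])
  also have "\<dots> = act Lam (V.tensor (rotate1 vs))"
    using act_tensor[of "rotate1 vs" Lam] vs by (simp only: auto_Lam[OF auto] length_rotate1)
  finally show "\<alpha> (act Lam (V.tensor vs)) = act Lam (\<alpha> (V.tensor vs))"
    by (simp only: alpha_tensor[OF vs])
qed

section \<open>The trace of the cyclic permutation\<close>

text \<open>Tensors are functionals on multilinear forms, so the coefficient of a basis tensor is an evaluation at the
  corresponding product of coordinate functionals.\<close>

lemma T_expand:
  assumes "t \<in> T"
  shows "t = (\<Sum>bs\<in>V.words (Suc n). tscale (t (V.coords bs)) (V.tensor bs))"
proof (rule T_eqI[OF assms, where f = "\<lambda>t. t" and
      g = "\<lambda>t. (\<Sum>bs\<in>V.words (Suc n). tscale (t (V.coords bs)) (V.tensor bs))"])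
  fix vs :: "'v list" assume vs: "length vs = Suc n"
  have "V.tensor vs (V.coords bs) = V.coords bs vs" if "bs \<in> V.words (Suc n)" for bs
    using V.multilinear_coords[of bs "Suc n"] that vs by (simp add: V.tensor_def V.words_def)
  then have "(\<Sum>bs\<in>V.words (Suc n). tscale (V.tensor vs (V.coords bs)) (V.tensor bs)) =
      (\<Sum>bs\<in>V.words (Suc n). tscale (V.coords bs vs) (V.tensor bs))"
    by (intro sum.cong refl) simp
  also have "\<dots> = V.tensor vs"
    by (rule V.multilinear_expand[OF V.multilinear_tensor tensor_space.vector_space_axioms vs, symmetric])
  finally show "V.tensor vs = (\<Sum>bs\<in>V.words (Suc n). tscale (V.tensor vs (V.coords bs)) (V.tensor bs))" ..
next
  fix c and v t :: "('k, 'v) tensor"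
  show "(\<Sum>bs\<in>V.words (Suc n). tscale ((tscale c v + t) (V.coords bs)) (V.tensor bs)) =
      tscale c (\<Sum>bs\<in>V.words (Suc n). tscale (v (V.coords bs)) (V.tensor bs)) +
      (\<Sum>bs\<in>V.words (Suc n). tscale (t (V.coords bs)) (V.tensor bs))"
    unfolding tensor_space.scale_sum_right sum.distrib[symmetric]
    by (intro sum.cong refl) (simp add: tscale_def fun_eq_iff algebra_simps)
qed (rule refl)

lemma action_prod_list: "\<rho> (prod_list zs) = foldr (\<lambda>A. A) (map \<rho> zs)"
proof (induction zs)
  case Nil
  show ?case by (simp add: fun_eq_iff action_one)
next
  case (Cons z zs)
  then show ?case by (simp add: fun_eq_iff action_mult)
qed

text \<open>On \<open>W\<close> the permutation \<open>\<alpha>\<close> agrees with \<open>\<alpha> \<circ> L\<close>, which maps the basis tensors of the whole tensor power into \<open>W\<close>.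
  This presents \<open>\<alpha>\<close> as a finite sum of functionals times vectors of \<open>W\<close>.\<close>

lemma trace_alpha:
  "trace_on tscale W \<alpha> = swn n (\<lambda>hs. character (prod_list (map (\<lambda>i. (\<tau> ^^ i) (hs ! i)) [0..<Suc n]))) Lam"
proof -
  let ?w = "\<lambda>bs. \<alpha> (act Lam (V.tensor bs))"
  let ?B = "V.words (Suc n)"
  have ev: "Vector_Spaces.linear tscale (*) (\<lambda>t. t f)" for f :: "'v list \<Rightarrow> 'k"
    by (simp add: Vector_Spaces.linear_iff tensor_space.vector_space_axioms vector_space_field tscale_def)
  have bsT: "V.tensor bs \<in> T" if "bs \<in> ?B" for bs
    using that by (intro V.tensor_in_power) (simp add: V.words_def)
  have wW: "?w bs \<in> W" if "bs \<in> ?B" for bs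
    by (simp only: alpha_act_Lam[OF bsT[OF that]]) (intro act_Lam_invariant alpha_in_T bsT[OF that])
  have W: "tensor_space.subspace W"
  proof (rule tensor_space.subspaceI)
    have eq: "W = {w \<in> T. act Lam w = w}"
    proof (intro set_eqI iffI)
      fix w assume "w \<in> {w \<in> T. act Lam w = w}"
      then show "w \<in> W" using act_Lam_invariant[of w] by auto
    qed (auto intro: W_T act_Lam_fixes)
    show "0 \<in> W" unfolding eq using act_zero T_zero by blast
    show "x + y \<in> W" if "x \<in> W" "y \<in> W" for x y
      using that act_linear[of x y Lam 1] unfolding eq by (simp only: mem_Collect_eq T_add tensor_space.scale_one simp_thms)
    show "tscale c x \<in> W" if "x \<in> W" for c x
      using that act_linear[of x 0 Lam c] T_zero act_zero unfolding eq
      by (simp only: mem_Collect_eq T_scale add_0_right simp_thms)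
  qed
  have sumT: "t \<in> tensor_space.span (V.tensor ` ?B)" if "t \<in> T" for t
    by (subst T_expand[OF that]) (intro tensor_space.span_sum tensor_space.span_scale tensor_space.span_base imageI)
  have "trace_on tscale W \<alpha> = (\<Sum>bs\<in>?B. ?w bs (V.coords bs))"
  proof (rule tensor_space.trace_on_eq_sum[OF W _ _ V.finite_words ev wW, where S = "V.tensor ` ?B"])
    show "finite (V.tensor ` ?B)" using V.finite_words by blast
    show "W \<subseteq> tensor_space.span (V.tensor ` ?B)" using sumT W_T by blast
    fix x assume x: "x \<in> W"
    have lin: "\<alpha> (act Lam (\<Sum>bs\<in>B. tscale (x (V.coords bs)) (V.tensor bs))) =
        (\<Sum>bs\<in>B. tscale (x (V.coords bs)) (?w bs)) \<and> (\<Sum>bs\<in>B. tscale (x (V.coords bs)) (V.tensor bs)) \<in> T"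
      if "finite B" "B \<subseteq> ?B" for B
      using that
    proof (induction B rule: finite_induct)
      case empty
      show ?case by (simp only: sum.empty act_zero alpha_zero T_zero simp_thms)
    next
      case (insert b B)
      then have b: "V.tensor b \<in> T" and IH: "\<alpha> (act Lam (\<Sum>bs\<in>B. tscale (x (V.coords bs)) (V.tensor bs))) =
        (\<Sum>bs\<in>B. tscale (x (V.coords bs)) (?w bs))" "(\<Sum>bs\<in>B. tscale (x (V.coords bs)) (V.tensor bs)) \<in> T"
        using bsT by auto
      show ?case
        by (simp only: sum.insert[OF insert.hyps] act_linear[OF b IH(2)] alpha_linear[OF act_in_T[OF b] act_in_T[OF IH(2)]]
            IH T_add T_scale b simp_thms)
    qed
    show "\<alpha> x = (\<Sum>bs\<in>?B. tscale (x (V.coords bs)) (?w bs))"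
      using lin[OF V.finite_words subset_refl] T_expand[OF W_T[OF x]] act_Lam_fixes[OF x] by metis
  qed
  also have "\<dots> = (\<Sum>bs\<in>?B. swn n (\<lambda>hs. V.coords bs (rotate1 (twist hs bs))) Lam)"
  proof (rule sum.cong[OF refl])
    fix bs assume bs: "bs \<in> ?B"
    then have len: "length bs = Suc n" by (simp add: V.words_def)
    have T: "V.tensor (twist hs us) \<in> T" for hs us by (rule V.tensor_in_power[OF length_twist])
    have "?w bs = swn n (\<lambda>hs. V.tensor (rotate1 (twist hs bs))) Lam"
      by (simp only: act_tensor[OF len] alpha_swn[OF T] alpha_tensor[OF length_twist])
    then have "?w bs (V.coords bs) = swn n (\<lambda>hs. V.tensor (rotate1 (twist hs bs)) (V.coords bs)) Lam"
      by (simp only: swn_apply[OF ev])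
    also have "\<dots> = swn n (\<lambda>hs. V.coords bs (rotate1 (twist hs bs))) Lam"
      using V.multilinear_coords[OF len] by (intro swn_cong) (simp add: V.tensor_def length_twist)
    finally show "?w bs (V.coords bs) = swn n (\<lambda>hs. V.coords bs (rotate1 (twist hs bs))) Lam" .
  qed
  also have "\<dots> = swn n (\<lambda>hs. \<Sum>bs\<in>?B. V.coords bs (rotate1 (twist hs bs))) Lam"
    by (rule swn_sum[symmetric])
  also have "\<dots> = swn n (\<lambda>hs. character (prod_list (map (\<lambda>i. (\<tau> ^^ i) (hs ! i)) [0..<Suc n]))) Lam"
  proof (rule swn_cong)
    fix hs :: "'h list" assume "length hs = Suc n"
    let ?As = "map \<rho> (map (\<lambda>i. (\<tau> ^^ i) (hs ! i)) [0..<Suc n])"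
    have "twist hs bs = map2 (\<lambda>A v. A v) ?As bs" if "bs \<in> ?B" for bs
      using that by (intro nth_equalityI) (simp_all add: length_twist nth_twist V.words_def del: upt_Suc)
    then have "(\<Sum>bs\<in>?B. V.coords bs (rotate1 (twist hs bs))) =
        (\<Sum>bs\<in>?B. V.coords bs (rotate1 (map2 (\<lambda>A v. A v) ?As bs)))"
      by (intro sum.cong refl) simp
    also have "\<dots> = V.tr (foldr (\<lambda>A. A) ?As)"
      by (rule V.sum_coords_rotate) (auto intro: action_linear simp del: upt_Suc)
    finally show "(\<Sum>bs\<in>?B. V.coords bs (rotate1 (twist hs bs))) =
        character (prod_list (map (\<lambda>i. (\<tau> ^^ i) (hs ! i)) [0..<Suc n]))"
      by (simp only: character_def action_prod_list)
  qed
  finally show ?thesis .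
qed

lemma character_linear: "linH (*) character"
proof -
  have "\<rho> (g + h) = (\<lambda>v. \<rho> g v + \<rho> h v)" "\<rho> (scale c h) = (\<lambda>v. sV c (\<rho> h v))" for g h c
    by (simp_all add: fun_eq_iff action_add action_scale)
  then show ?thesis
    unfolding Vector_Spaces.linear_iff character_def
    by (simp add: V.tr_add V.tr_scale vector_space_axioms vector_space_field)
qed

lemma multilinear_character:
  "multilinear scale (*) (Suc n) (\<lambda>hs. character (prod_list (map (\<lambda>i. (\<tau> ^^ i) (hs ! i)) [0..<Suc n])))"
  unfolding multilinear_def
proof (intro allI impI)
  fix hs :: "'h list" and i assume i: "length hs = Suc n" "i < Suc n"
  let ?f = "\<lambda>j. (\<tau> ^^ j) (hs ! j)"
  let ?P = "prod_list (map ?f [0..<i])" and ?Q = "prod_list (map ?f [Suc i..<Suc n])"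
  have split: "[0..<Suc n] = [0..<i] @ i # [Suc i..<Suc n]"
    using i(2) by (metis less_imp_le_nat upt_add_eq_append upt_conv_Cons le_add_diff_inverse zero_le)
  have "prod_list (map (\<lambda>j. (\<tau> ^^ j) (hs[i := h] ! j)) [0..<Suc n]) = ?P * ((\<tau> ^^ i) h * ?Q)" for h
  proof -
    have eq: "map (\<lambda>j. (\<tau> ^^ j) (hs[i := h] ! j)) [0..<i] = map ?f [0..<i]"
      "map (\<lambda>j. (\<tau> ^^ j) (hs[i := h] ! j)) [Suc i..<Suc n] = map ?f [Suc i..<Suc n]"
      by (auto simp del: upt_Suc)
    have "hs[i := h] ! i = h" using i by simp
    then show ?thesis
      by (simp only: split map_append list.map prod_list.append prod_list.Cons eq)
  qed
  moreover have "linH (*) (\<lambda>h. character (?P * ((\<tau> ^^ i) h * ?Q)))"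
    by (rule lin_comp[OF character_linear]) (rule lin lin_comp[OF auto_power_linear[OF auto]])+
  ultimately show "linH (*) (\<lambda>h. character (prod_list (map (\<lambda>j. (\<tau> ^^ j) (hs[i := h] ! j)) [0..<Suc n])))"
    by (simp only:)
qed

theorem indicator_eq_trace:
  "twisted_FS_indicator (Suc n) character \<tau> = trace_on tscale W \<alpha>"
  unfolding trace_alpha twisted_FS_indicator_def diff_Suc_1
  by (rule tensor_lift_iter_comult[OF multilinear_character])

end

theorem theorem3p5:
  fixes scale :: "'k::{alg_closed_field, field_char_0} \<Rightarrow> 'h::ring_1 \<Rightarrow> 'h"
    and \<Delta> :: "'h \<Rightarrow> ('k, 'h) tensor" and \<epsilon> :: "'h \<Rightarrow> 'k" and S :: "'h \<Rightarrow> 'h"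
    and sV :: "'k \<Rightarrow> 'v::ab_group_add \<Rightarrow> 'v" and \<rho> :: "'h \<Rightarrow> 'v \<Rightarrow> 'v"
    and \<tau> :: "'h \<Rightarrow> 'h" and m :: nat
  assumes "hopf_algebra scale \<Delta> \<epsilon> S"
    and "k_algebra.semisimple scale"
    and "m > 0"
    and "hopf_algebra.hopf_automorphism scale \<Delta> \<epsilon> S \<tau>"
    and "\<tau> ^^ m = id"
    and "hopf_module scale \<Delta> \<epsilon> S sV \<rho>"
    and "\<exists>B. finite B \<and> module.span sV B = UNIV"
  shows "hopf_algebra.twisted_FS_indicator scale \<Delta> \<epsilon> m (hopf_module.character sV \<rho>) \<tau> =
         trace_on tscale
           (hopf_module.twisted_invariants scale \<Delta> \<epsilon> sV \<rho> m \<tau>)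
           (tensor_powers.cyclic_perm sV m)"
proof -
  obtain n where m: "m = Suc n" using assms(3) gr0_implies_Suc by blast
  interpret twisted_module scale \<Delta> \<epsilon> S sV \<rho> \<tau> n
    using assms unfolding m
    by (intro twisted_module.intro twisted_module_axioms.intro semisimple_hopf_algebra.intro
        semisimple_hopf_algebra_axioms.intro)
  show ?thesis unfolding m by (rule indicator_eq_trace)
qed

end
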